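(* Let $\nu>0$ be a constant, let $\Omega\subset\mathbb{R}^d$, $d\in\mathbb{N}$, be a bounded domain with Lipschitz boundary, and let $H:\overline\Omega\times\mathbb{R}^d\to\mathbb{R}$ be given by $H(x,p)=\sup_{\alpha\in\overline{B_1(0)}}\{\alpha\cdot p\}=|p|$. Let $F\equiv0$ on $\mathcal{X}=L^2(\Omega)$ and $G\equiv1\in L^2(\Omega)\subset H^{-1}(\Omega)$. Then there exist a sequence $\{\lambda_j\}_{j\in\mathbb{N}}\subset(0,1]$ with $\lambda_j\to0$ as $j\to\infty$, an admissible family of regularized Hamiltonians $\{H_{\lambda_j}\}_{j\in\mathbb{N}}$ for $H$, and two distinct functions $m_1,m_2\in H_0^1(\Omega)$, $m_1\neq m_2$, such that: (1) the pairs $(0,m_1)$ and $(0,m_2)$ in $H_0^1(\Omega)\times H_0^1(\Omega)$ are both weak solutions of the MFG partial differential inclusion; (2) for each $j\in\mathbb{N}$, the regularized problem with Hamiltonian $H_{\lambda_j}$ has a unique weak solution $(u_{\lambda_j},m_{\lambda_j})\in H_0^1(\Omega)\times H_0^1(\Omega)$; (3) $m_{\lambda_{2k+1}}=m_1$ and $m_{\lambda_{2k}}=m_2$ for all $k\in\mathbb{N}$.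
   Context: $\mathbb{N}=\{1,2,3,\dots\}$; $\overline{B_1(0)}$ is the closed unit ball of $\mathbb{R}^d$. The subdifferential is $\partial_pH(x,p):=\{\tilde b\in\mathbb{R}^d: H(x,q)\ge H(x,p)+\tilde b\cdot(q-p)\ \forall q\in\mathbb{R}^d\}$, and for $v\in W^{1,1}(\Omega)$, $D_pH[v]:=\{\tilde b\in L^\infty(\Omega;\mathbb{R}^d):\tilde b(x)\in\partial_pH(x,\nabla v(x))\text{ for a.e. }x\in\Omega\}$. Weak solution of the MFG partial differential inclusion (with $F\equiv 0$, $G\equiv 1$): a pair $(u,m)\in H_0^1(\Omega)\times H_0^1(\Omega)$ for which there exists $\tilde b_*\in D_pH[u]$ such that $\int_\Omega \nu\nabla u\cdot\nabla\psi+H(x,\nabla u)\psi\,dx=0$ for all $\psi\in H_0^1(\Omega)$, and $\int_\Omega \nu\nabla m\cdot\nabla\phi+m\tilde b_*\cdot\nabla\phi\,dx=\int_\Omega\phi\,dx$ for all $\phi\in H_0^1(\Omega)$. Admissible family of regularized Hamiltonians $\{H_{\lambda_j}\}_{j\in\mathbb{N}}$: real-valued functions on $\overline\Omega\times\mathbb{R}^d$ for which there are a continuous $\omega:[0,1]\to[0,\infty)$ with $\omega(0)=0$ and a constant $L_H$ that is a Lipschitz constant of $p\mapsto H(x,p)$ for every $x\in\overline\Omega$, such that, for each $j$: $H_{\lambda_j}$ is continuous on $\overline\Omega\times\mathbb{R}^d$ and $|H_{\lambda_j}(x,p)-H_{\lambda_j}(x,q)|\le L_H|p-q|$ for all $x\in\overline\Omega$,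 $p,q\in\mathbb{R}^d$; $p\mapsto H_{\lambda_j}(x,p)$ is convex for each $x\in\overline\Omega$; the partial derivative $\frac{\partial H_{\lambda_j}}{\partial p}:\overline\Omega\times\mathbb{R}^d\to\mathbb{R}^d$ exists and is continuous; and $|H_{\lambda_j}(x,p)-H(x,p)|\le\omega(\lambda_j)$ for all $(x,p)\in\overline\Omega\times\mathbb{R}^d$. Weak solution of the regularized problem with Hamiltonian $H_\lambda$: a pair $(u_\lambda,m_\lambda)\in H_0^1(\Omega)\times H_0^1(\Omega)$ such that $\int_\Omega \nu\nabla u_\lambda\cdot\nabla\psi+H_\lambda(x,\nabla u_\lambda)\psi\,dx=0$ for all $\psi\in H_0^1(\Omega)$, and $\int_\Omega \nu\nabla m_\lambda\cdot\nabla\phi+m_\lambda\frac{\partial H_\lambda}{\partial p}(x,\nabla u_\lambda)\cdot\nabla\phi\,dx=\int_\Omega\phi\,dx$ for all $\phi\in H_0^1(\Omega)$. *)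

theory Defs
  imports "HOL-Analysis.Analysis"
begin

section \<open>Domains with Lipschitz boundary\<close>

text \<open>Near each boundary point, and for a suitable unit vector \<open>e\<close>, the set is the part of a ball
  above the graph, in direction \<open>e\<close>, of a Lipschitz function on the hyperplane orthogonal to \<open>e\<close>.
  In dimension one that hyperplane is \<open>{0}\<close>.\<close>

definition lipschitz_boundary :: "'a::euclidean_space set \<Rightarrow> bool" where
  "lipschitz_boundary \<Omega> \<longleftrightarrow>
    (\<forall>z\<in>frontier \<Omega>. \<exists>e r \<gamma> L. norm e = 1 \<and> 0 < r \<and> L-lipschitz_on {y. y \<bullet> e = 0} \<gamma> \<and>
      \<Omega> \<inter> ball z r = {x \<in> ball z r. \<gamma> (x - (x \<bullet> e) *\<^sub>R e) < x \<bullet> e})"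

definition bounded_lipschitz_domain :: "'a::euclidean_space set \<Rightarrow> bool" where
  "bounded_lipschitz_domain \<Omega> \<longleftrightarrow>
    open \<Omega> \<and> connected \<Omega> \<and> \<Omega> \<noteq> {} \<and> bounded \<Omega> \<and> lipschitz_boundary \<Omega>"


section \<open>Sobolev spaces\<close>

text \<open>Elements of Lebesgue and Sobolev spaces on \<open>\<Omega>\<close> are represented by functions on the whole space,
  of which only the values on \<open>\<Omega>\<close> matter; equality in these spaces is \<open>ae_eq\<close>.\<close>

definition ae_eq :: "'a::euclidean_space set \<Rightarrow> ('a \<Rightarrow> 'b) \<Rightarrow> ('a \<Rightarrow> 'b) \<Rightarrow> bool" where
  "ae_eq \<Omega> f g \<longleftrightarrow> (AE x in lebesgue_on \<Omega>. f x = g x)"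

definition L2 :: "'a::euclidean_space set \<Rightarrow> ('a \<Rightarrow> 'b::euclidean_space) set" where
  "L2 \<Omega> = {f \<in> borel_measurable (lebesgue_on \<Omega>). integrable (lebesgue_on \<Omega>) (\<lambda>x. (norm (f x))\<^sup>2)}"

definition Linf :: "'a::euclidean_space set \<Rightarrow> ('a \<Rightarrow> 'b::euclidean_space) set" where
  "Linf \<Omega> = {f \<in> borel_measurable (lebesgue_on \<Omega>). \<exists>C. AE x in lebesgue_on \<Omega>. norm (f x) \<le> C}"

definition L1loc :: "'a::euclidean_space set \<Rightarrow> ('a \<Rightarrow> 'b::euclidean_space) set" where
  "L1loc \<Omega> = {f. \<forall>K. compact K \<longrightarrow> K \<subseteq> \<Omega> \<longrightarrow> integrable (lebesgue_on K) f}"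

primrec C_k :: "nat \<Rightarrow> ('a::euclidean_space \<Rightarrow> real) \<Rightarrow> bool" where
  "C_k 0 f \<longleftrightarrow> continuous_on UNIV f"
| "C_k (Suc k) f \<longleftrightarrow> (\<forall>x. f differentiable (at x)) \<and>
     (\<forall>i\<in>Basis. C_k k (\<lambda>x. frechet_derivative f (at x) i))"

text \<open>Smooth functions with compact support in \<open>\<Omega>\<close>, extended by zero.\<close>

definition test_functions :: "'a::euclidean_space set \<Rightarrow> ('a \<Rightarrow> real) set" where
  "test_functions \<Omega> =
    {\<phi>. (\<forall>k. C_k k \<phi>) \<and> compact (closure {x. \<phi> x \<noteq> 0}) \<and> closure {x. \<phi> x \<noteq> 0} \<subseteq> \<Omega>}"

definition has_weak_gradient ::
    "'a::euclidean_space set \<Rightarrow> ('a \<Rightarrow> real) \<Rightarrow> ('a \<Rightarrow> 'a) \<Rightarrow> bool" where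
  "has_weak_gradient \<Omega> u g \<longleftrightarrow> u \<in> L1loc \<Omega> \<and> g \<in> L1loc \<Omega> \<and>
    (\<forall>\<phi>\<in>test_functions \<Omega>. \<forall>i\<in>Basis.
      (\<integral>x. u x * frechet_derivative \<phi> (at x) i \<partial>lebesgue_on \<Omega>) =
      - (\<integral>x. (g x \<bullet> i) * \<phi> x \<partial>lebesgue_on \<Omega>))"

text \<open>The weak gradient is determined up to equality almost everywhere; \<open>wgrad\<close> selects a
  representative, and is unspecified if there is no weak gradient.\<close>

definition wgrad :: "'a::euclidean_space set \<Rightarrow> ('a \<Rightarrow> real) \<Rightarrow> 'a \<Rightarrow> 'a" where
  "wgrad \<Omega> u = (SOME g. has_weak_gradient \<Omega> u g)"

definition H1 :: "'a::euclidean_space set \<Rightarrow> ('a \<Rightarrow> real) set" where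
  "H1 \<Omega> = {u \<in> L2 \<Omega>. \<exists>g \<in> L2 \<Omega>. has_weak_gradient \<Omega> u g}"

definition H1_norm :: "'a::euclidean_space set \<Rightarrow> ('a \<Rightarrow> real) \<Rightarrow> real" where
  "H1_norm \<Omega> u = sqrt (\<integral>x. (u x)\<^sup>2 + (norm (wgrad \<Omega> u x))\<^sup>2 \<partial>lebesgue_on \<Omega>)"

text \<open>The closure of the test functions in \<open>H1 \<Omega>\<close>.\<close>

definition H1_0 :: "'a::euclidean_space set \<Rightarrow> ('a \<Rightarrow> real) set" where
  "H1_0 \<Omega> = {u \<in> H1 \<Omega>. \<exists>\<phi>. (\<forall>n. \<phi> n \<in> test_functions \<Omega>) \<and>
     (\<lambda>n. H1_norm \<Omega> (\<lambda>x. \<phi> n x - u x)) \<longlonglongrightarrow> 0}"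


section \<open>Hamiltonians\<close>

text \<open>A Hamiltonian on \<open>closure \<Omega> \<times> 'a\<close> is a curried function of which only the values at
  \<open>x \<in> closure \<Omega>\<close> matter.\<close>

definition ball_hamiltonian :: "'a::euclidean_space \<Rightarrow> 'a \<Rightarrow> real" where
  "ball_hamiltonian x p = (SUP \<alpha>\<in>cball 0 1. \<alpha> \<bullet> p)"

lemma ball_hamiltonian_eq_norm: "ball_hamiltonian x p = norm p"
  unfolding ball_hamiltonian_def
proof (rule cSup_eq_maximum)
  have "sgn p \<bullet> p = norm p"
    by (cases "p = 0") (simp_all add: sgn_div_norm dot_square_norm power2_eq_square)
  then show "norm p \<in> (\<lambda>\<alpha>. \<alpha> \<bullet> p) ` cball 0 1"
    by (intro image_eqI[of _ _ "sgn p"]) (auto simp: norm_sgn)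
next
  fix y assume "y \<in> (\<lambda>\<alpha>. \<alpha> \<bullet> p) ` cball 0 1"
  then obtain \<alpha> where "norm \<alpha> \<le> 1" "y = \<alpha> \<bullet> p" by auto
  then show "y \<le> norm p"
    using norm_cauchy_schwarz[of \<alpha> p] mult_right_mono[of "norm \<alpha>" 1 "norm p"] by simp
qed

definition subdiff_p :: "('a \<Rightarrow> 'a::euclidean_space \<Rightarrow> real) \<Rightarrow> 'a \<Rightarrow> 'a \<Rightarrow> 'a set" where
  "subdiff_p H x p = {b. \<forall>q. H x q \<ge> H x p + b \<bullet> (q - p)}"

text \<open>Meant for \<open>v\<close> in \<open>W^{1,1}(\<Omega>)\<close>, so that \<open>wgrad \<Omega> v\<close> is the weak gradient of \<open>v\<close>.\<close>

definition DpH :: "'a::euclidean_space set \<Rightarrow> ('a \<Rightarrow> 'a \<Rightarrow> real) \<Rightarrow> ('a \<Rightarrow> real) \<Rightarrow> ('a \<Rightarrow> 'a) set" where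
  "DpH \<Omega> H v = {b \<in> Linf \<Omega>. AE x in lebesgue_on \<Omega>. b x \<in> subdiff_p H x (wgrad \<Omega> v x)}"

text \<open>The partial derivative in \<open>p\<close>, as a gradient; meaningful where it exists.\<close>

definition grad_p :: "('a \<Rightarrow> 'a::euclidean_space \<Rightarrow> real) \<Rightarrow> 'a \<Rightarrow> 'a \<Rightarrow> 'a" where
  "grad_p H x p = (THE D. GDERIV (H x) p :> D)"

text \<open>The family is indexed by the parameter value itself, and only its members \<open>Hreg (lam j)\<close> with \<open>j \<ge> 1\<close> matter.\<close>

definition admissible_family ::
    "'a::euclidean_space set \<Rightarrow> ('a \<Rightarrow> 'a \<Rightarrow> real) \<Rightarrow> (nat \<Rightarrow> real) \<Rightarrow> (real \<Rightarrow> 'a \<Rightarrow> 'a \<Rightarrow> real) \<Rightarrow> bool" where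
  "admissible_family \<Omega> H lam Hreg \<longleftrightarrow>
    (\<exists>\<omega> :: real \<Rightarrow> real. \<exists>L.
      continuous_on {0..1} \<omega> \<and> (\<forall>t\<in>{0..1}. 0 \<le> \<omega> t) \<and> \<omega> 0 = 0 \<and>
      (\<forall>x\<in>closure \<Omega>. L-lipschitz_on UNIV (H x)) \<and>
      (\<forall>j\<ge>1.
        continuous_on (closure \<Omega> \<times> UNIV) (\<lambda>(x, p). Hreg (lam j) x p) \<and>
        (\<forall>x\<in>closure \<Omega>. L-lipschitz_on UNIV (Hreg (lam j) x)) \<and>
        (\<forall>x\<in>closure \<Omega>. convex_on UNIV (Hreg (lam j) x)) \<and>
        (\<forall>x\<in>closure \<Omega>. \<forall>p. \<exists>D. GDERIV (Hreg (lam j) x) p :> D) \<and>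
        continuous_on (closure \<Omega> \<times> UNIV) (\<lambda>(x, p). grad_p (Hreg (lam j)) x p) \<and>
        (\<forall>x\<in>closure \<Omega>. \<forall>p. \<bar>Hreg (lam j) x p - H x p\<bar> \<le> \<omega> (lam j))))"


section \<open>Weak solutions for zero coupling and unit source\<close>

definition weak_HJB :: "real \<Rightarrow> 'a::euclidean_space set \<Rightarrow> ('a \<Rightarrow> 'a \<Rightarrow> real) \<Rightarrow> ('a \<Rightarrow> real) \<Rightarrow> bool" where
  "weak_HJB \<nu> \<Omega> H u \<longleftrightarrow>
    (\<forall>\<psi>\<in>H1_0 \<Omega>. (\<integral>x. \<nu> * (wgrad \<Omega> u x \<bullet> wgrad \<Omega> \<psi> x) + H x (wgrad \<Omega> u x) * \<psi> x \<partial>lebesgue_on \<Omega>) = 0)"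

definition weak_KFP :: "real \<Rightarrow> 'a::euclidean_space set \<Rightarrow> ('a \<Rightarrow> 'a) \<Rightarrow> ('a \<Rightarrow> real) \<Rightarrow> bool" where
  "weak_KFP \<nu> \<Omega> b m \<longleftrightarrow>
    (\<forall>\<phi>\<in>H1_0 \<Omega>. (\<integral>x. \<nu> * (wgrad \<Omega> m x \<bullet> wgrad \<Omega> \<phi> x) + m x * (b x \<bullet> wgrad \<Omega> \<phi> x) \<partial>lebesgue_on \<Omega>) =
      (\<integral>x. \<phi> x \<partial>lebesgue_on \<Omega>))"

definition MFG_inclusion_solution ::
    "real \<Rightarrow> 'a::euclidean_space set \<Rightarrow> ('a \<Rightarrow> 'a \<Rightarrow> real) \<Rightarrow> ('a \<Rightarrow> real) \<Rightarrow> ('a \<Rightarrow> real) \<Rightarrow> bool" where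
  "MFG_inclusion_solution \<nu> \<Omega> H u m \<longleftrightarrow> u \<in> H1_0 \<Omega> \<and> m \<in> H1_0 \<Omega> \<and>
    (\<exists>b\<in>DpH \<Omega> H u. weak_HJB \<nu> \<Omega> H u \<and> weak_KFP \<nu> \<Omega> b m)"

definition regularized_solution ::
    "real \<Rightarrow> 'a::euclidean_space set \<Rightarrow> ('a \<Rightarrow> 'a \<Rightarrow> real) \<Rightarrow> ('a \<Rightarrow> real) \<Rightarrow> ('a \<Rightarrow> real) \<Rightarrow> bool" where
  "regularized_solution \<nu> \<Omega> H u m \<longleftrightarrow> u \<in> H1_0 \<Omega> \<and> m \<in> H1_0 \<Omega> \<and>
    weak_HJB \<nu> \<Omega> H u \<and> weak_KFP \<nu> \<Omega> (\<lambda>x. grad_p H x (wgrad \<Omega> u x)) m"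

end

theory Submission
  imports Defs "HOL-Computational_Algebra.Polynomial"
begin

text \<open>
  For \<open>u = 0\<close> the inclusion only requires the drift to take values in the closed unit ball, so the
  solution of the Kolmogorov--Fokker--Planck equation for any constant drift \<open>b\<close> with \<open>|b| \<le> 1\<close>
  solves the system together with \<open>0\<close>. The convex functions \<open>p \<mapsto> |(p + t a, t)| - |(t a, t)|\<close> are
  smooth approximations of \<open>|p|\<close> that vanish at \<open>0\<close> and have there the gradient
  \<open>a / sqrt (|a|\<^sup>2 + 1)\<close>, whatever \<open>t > 0\<close> is. Alternating between \<open>a = 0\<close> and a unit vector \<open>a\<close>
  therefore makes the regularized density alternate between the solutions \<open>m1\<close>, \<open>m2\<close> for two
  different constant drifts. If these agreed, their derivative along the second drift would vanish,
  and so would they, by the Poincare inequality in that direction.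

  For uniqueness let \<open>(v, w)\<close> solve the regularized problem. The Hamiltonian lies above its tangent
  at \<open>0\<close>, and the tangent contributes a constant drift, which integrates to zero against functions
  of \<open>v\<close>; hence \<open>v \<le> 0\<close>. The conservative form of the second equation gives \<open>w \<ge> 0\<close> for every
  bounded drift. Testing the first equation with \<open>w\<close> and the second one with \<open>v\<close>, convexity yields
  a nonnegative integral of \<open>v\<close>. Hence \<open>v = 0\<close>, and then \<open>w\<close> solves the equation with constant
  drift, whose solution is unique. Truncations are replaced throughout by the smooth function
  equal to \<open>exp (-1/t\<^sup>2)\<close> for \<open>t > 0\<close> and to \<open>0\<close> otherwise, which maps test functions to test
  functions.
\<close>

section \<open>Smooth functions\<close>

text \<open>Zero boundary values are encoded by approximation with smooth functions, so a nonlinear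
  test function is cheapest when the nonlinearity is itself smooth and vanishes at 0. The price is
  that the derivative of the truncation is a weight \<open>flat'\<close> instead of an indicator,
  and the estimate for the sign of a density m leaves the error t^2 * \<open>flat' t\<close> at t =
  - n * m. The square in exp (-1/t^2) makes this error vanish as t tends to infinity; exp (-1/t)
  would leave the limit 1. The order of the uniqueness argument is dictated by the drift. For a
  constant drift the energy method applies directly, whereas for the drift of an arbitrary
  regularized solution only nonnegativity of the density is obtained; hence v = 0 has to be known
  before w can be identified. The extra coordinate in |(p + t a, t)| keeps the argument of the norm
  off the origin. Since (t a, t) = t (a, 1), homogeneity of the norm makes the gradient at p = 0
  independent of t.\<close>

lemma C_k_SucD: "C_k (Suc k) f \<Longrightarrow> C_k k f"
proof (induction k arbitrary: f)
  case 0
  then show ?case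
    by (auto intro!: continuous_at_imp_continuous_on differentiable_imp_continuous_within)
next
  case (Suc k)
  then show ?case by simp
qed

lemma C_k_const: "C_k k (\<lambda>_. c)"
  by (induction k arbitrary: c) auto

lemma C_k_add: "C_k k f \<Longrightarrow> C_k k g \<Longrightarrow> C_k k (\<lambda>x. f x + g x)"
proof (induction k arbitrary: f g)
  case 0
  then show ?case by (auto intro: continuous_intros)
next
  case (Suc k)
  then have "frechet_derivative (\<lambda>x. f x + g x) (at x) =
      (\<lambda>h. frechet_derivative f (at x) h + frechet_derivative g (at x) h)" for x
    by (intro frechet_derivative_at[symmetric] has_derivative_add) (simp_all add: frechet_derivative_works)
  with Suc show ?case by (auto intro: differentiable_add)
qed

lemma frechet_derivative_mult_real:
  fixes f g :: "'a::euclidean_space \<Rightarrow> real"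
  assumes "f differentiable (at x)" "g differentiable (at x)"
  shows "frechet_derivative (\<lambda>x. f x * g x) (at x) =
      (\<lambda>h. f x * frechet_derivative g (at x) h + frechet_derivative f (at x) h * g x)"
proof -
  have "((\<lambda>x. f x * g x) has_derivative
      (\<lambda>h. f x * frechet_derivative g (at x) h + frechet_derivative f (at x) h * g x)) (at x)"
    using assms by (intro has_derivative_mult) (auto simp: frechet_derivative_works)
  then show ?thesis by (rule frechet_derivative_at[symmetric])
qed

text \<open>The product rule multiplies derivatives by the undifferentiated factors, so the
  induction needs both factors at order \<open>k\<close> as well; \<open>C_k_SucD\<close> supplies
  this.\<close>

lemma C_k_mult: "C_k k f \<Longrightarrow> C_k k g \<Longrightarrow> C_k k (\<lambda>x. f x * g x)"
proof (induction k arbitrary: f g)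
  case 0
  then show ?case by (auto intro: continuous_intros)
next
  case (Suc k)
  have "C_k k f" "C_k k g" using Suc.prems C_k_SucD by blast+
  with Suc show ?case
    by (auto simp: frechet_derivative_mult_real intro!: C_k_add)
qed

lemma C_k_prod: "finite A \<Longrightarrow> (\<And>i. i \<in> A \<Longrightarrow> C_k k (f i)) \<Longrightarrow> C_k k (\<lambda>x. \<Prod>i\<in>A. f i x)"
  by (induction A rule: finite_induct) (auto intro: C_k_const C_k_mult)

lemma C_k_linear:
  fixes f :: "'a::euclidean_space \<Rightarrow> real"
  assumes "bounded_linear f"
  shows "C_k k f"
proof (cases k)
  case 0
  then show ?thesis using assms by (simp add: linear_continuous_on)
next
  case (Suc n)
  have "frechet_derivative f (at x) = f" for x
    using assms by (intro frechet_derivative_at[symmetric] bounded_linear_imp_has_derivative)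
  then show ?thesis using Suc assms
    by (simp add: C_k_const bounded_linear_imp_differentiable)
qed

lemma frechet_derivative_compose_real:
  fixes \<phi> :: "'a::euclidean_space \<Rightarrow> real"
  assumes "(F has_real_derivative D) (at (\<phi> x))" "\<phi> differentiable (at x)"
  shows "((\<lambda>x. F (\<phi> x)) has_derivative (\<lambda>h. D * frechet_derivative \<phi> (at x) h)) (at x)"
    and "frechet_derivative (\<lambda>x. F (\<phi> x)) (at x) = (\<lambda>h. D * frechet_derivative \<phi> (at x) h)"
proof -
  show "((\<lambda>x. F (\<phi> x)) has_derivative (\<lambda>h. D * frechet_derivative \<phi> (at x) h)) (at x)"
    using has_derivative_compose[OF assms(2)[unfolded frechet_derivative_works]
        assms(1)[unfolded has_field_derivative_def]] by simp
  then show "frechet_derivative (\<lambda>x. F (\<phi> x)) (at x) = (\<lambda>h. D * frechet_derivative \<phi> (at x) h)"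
    by (rule frechet_derivative_at[symmetric])
qed

text \<open>\<open>F n\<close> plays the role of the \<open>n\<close>-th derivative of \<open>F 0\<close>.\<close>

lemma C_k_compose:
  fixes \<phi> :: "'a::euclidean_space \<Rightarrow> real"
  assumes F: "\<And>n t. (F n has_real_derivative F (Suc n) t) (at t)"
  shows "C_k k \<phi> \<Longrightarrow> C_k k (\<lambda>x. F n (\<phi> x))"
proof (induction k arbitrary: n)
  case 0
  have "continuous_on UNIV (F n)"
    using F DERIV_isCont by (blast intro: continuous_at_imp_continuous_on)
  with 0 show ?case using continuous_on_compose2[of UNIV "F n" UNIV \<phi>] by simp
next
  case (Suc k)
  note fd = frechet_derivative_compose_real[OF F, of \<phi>]
  have d: "\<And>x. \<phi> differentiable (at x)" using Suc.prems by simp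
  have "C_k k (\<lambda>x. F (Suc n) (\<phi> x))" using Suc C_k_SucD by blast
  with Suc.prems show ?case
    using fd(1)[OF d] by (auto simp: fd(2)[OF d] differentiable_def intro!: C_k_mult)
qed

subsection \<open>A flat function\<close>

text \<open>The derivative of \<open>p (1/t) * exp (-1/t\<^sup>2)\<close> is \<open>flat_step p (1/t) * exp (-1/t\<^sup>2)\<close>, so the functions
  \<open>flat_poly p\<close> are closed under differentiation.\<close>

definition flat_step :: "real poly \<Rightarrow> real poly" where
  "flat_step p = [:0, 0, -1:] * pderiv p + [:0, 0, 0, 2:] * p"

definition flat_poly :: "real poly \<Rightarrow> real \<Rightarrow> real" where
  "flat_poly p t = (if t > 0 then poly p (1 / t) * exp (- (1 / t)\<^sup>2) else 0)"

text \<open>For s \<ge> 1 the Gaussian lies below exp (- s), which beats every power. The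
  substitution s = 1/t turns this limit at infinity into flatness at 0.\<close>

lemma poly_times_gaussian_tendsto_0: "((\<lambda>s. poly p s * exp (- s\<^sup>2)) \<longlongrightarrow> (0::real)) at_top"
proof -
  have e: "((\<lambda>s. s ^ k * exp (- s\<^sup>2)) \<longlongrightarrow> (0::real)) at_top" for k
  proof (rule tendsto_sandwich)
    show "eventually (\<lambda>s. 0 \<le> s ^ k * exp (- s\<^sup>2)) (at_top :: real filter)"
      using eventually_ge_at_top[of 0] by eventually_elim auto
    show "eventually (\<lambda>s. s ^ k * exp (- s\<^sup>2) \<le> s ^ k / exp s) (at_top :: real filter)"
      using eventually_ge_at_top[of 1]
    proof eventually_elim
      case (elim s)
      then have "s * 1 \<le> s * s" by (intro mult_left_mono) auto
      then have "exp (- s\<^sup>2) \<le> exp (- s)" by (simp add: power2_eq_square)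
      with elim show ?case by (auto simp: divide_inverse exp_minus[symmetric] intro!: mult_left_mono)
    qed
  qed (auto intro: tendsto_power_div_exp_0)
  have "(\<lambda>s. poly p s * exp (- s\<^sup>2)) = (\<lambda>s. \<Sum>i\<le>degree p. coeff p i * (s ^ i * exp (- s\<^sup>2)))"
    by (simp add: poly_altdef sum_distrib_right mult.assoc)
  moreover have "((\<lambda>s. \<Sum>i\<le>degree p. coeff p i * (s ^ i * exp (- s\<^sup>2))) \<longlongrightarrow> (\<Sum>i\<le>degree p. coeff p i * 0)) at_top"
    by (intro tendsto_sum tendsto_mult e tendsto_const)
  ultimately show ?thesis by simp
qed

lemma flat_poly_tendsto_0: "(flat_poly p \<longlongrightarrow> 0) (at 0)"
  unfolding filterlim_at_split
proof
  show "(flat_poly p \<longlongrightarrow> 0) (at_left 0)"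
    by (rule tendsto_eventually) (auto simp: flat_poly_def eventually_at_filter)
  have "((\<lambda>t. poly p (1 / t) * exp (- (1 / t)\<^sup>2)) \<longlongrightarrow> 0) (at_right 0)"
    using filterlim_compose[OF poly_times_gaussian_tendsto_0[of p] filterlim_inverse_at_top_right]
    by (simp add: inverse_eq_divide)
  then show "(flat_poly p \<longlongrightarrow> 0) (at_right 0)"
    by (rule Lim_transform_eventually)
       (auto simp: flat_poly_def eventually_at_filter)
qed

lemma flat_poly_has_derivative: "(flat_poly p has_real_derivative flat_poly (flat_step p) t) (at t)"
proof (rule linorder_cases[of t 0])
  assume t: "t < 0"
  have "((\<lambda>_. 0) has_real_derivative 0) (at t)" by simp
  then have "(flat_poly p has_real_derivative 0) (at t)"
    by (rule has_field_derivative_transform_within_open[where S = "{..<0}"])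
       (use t in \<open>auto simp: flat_poly_def\<close>)
  then show ?thesis using t by (simp add: flat_poly_def)
next
  assume t: "0 < t"
  have "((\<lambda>t. poly p (1 / t) * exp (- (1 / t)\<^sup>2)) has_real_derivative
      poly (flat_step p) (1 / t) * exp (- (1 / t)\<^sup>2)) (at t)"
    using t
    by (auto intro!: derivative_eq_intros poly_DERIV[THEN DERIV_chain2]
        simp: flat_step_def power2_eq_square algebra_simps divide_simps)
  then have "(flat_poly p has_real_derivative poly (flat_step p) (1 / t) * exp (- (1 / t)\<^sup>2)) (at t)"
    by (rule has_field_derivative_transform_within_open[where S = "{0<..}"])
       (use t in \<open>auto simp: flat_poly_def\<close>)
  then show ?thesis using t by (simp add: flat_poly_def)
next
  assume t: "t = 0"
  \<comment> \<open>The difference quotient at 0 stays in the same class: dividing by h multiplies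
    the polynomial in 1/h by its variable, which gives \<open>pCons 0 p\<close>.\<close>
  have "((\<lambda>h. flat_poly p h / h) \<longlongrightarrow> 0) (at 0)"
    by (rule Lim_transform_eventually[OF flat_poly_tendsto_0[of "pCons 0 p"]])
       (auto simp: flat_poly_def eventually_at_filter)
  then show ?thesis using t by (simp add: has_field_derivative_iff flat_poly_def)
qed

definition flat :: "real \<Rightarrow> real" where "flat = flat_poly 1"
definition flat' :: "real \<Rightarrow> real" where "flat' = flat_poly (flat_step 1)"

lemma flat_eq: "flat t = (if t > 0 then exp (- (1 / t)\<^sup>2) else 0)"
  by (simp add: flat_def flat_poly_def)

lemma flat'_eq: "flat' t = (if t > 0 then 2 * (1 / t) ^ 3 * exp (- (1 / t)\<^sup>2) else 0)"
  by (simp add: flat'_def flat_poly_def flat_step_def power3_eq_cube)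

lemma flat_has_derivative: "(flat has_real_derivative flat' t) (at t)"
  unfolding flat_def flat'_def by (rule flat_poly_has_derivative)

text \<open>The iterates of \<open>flat_step\<close> on the polynomial 1 list all derivatives of
  \<open>flat\<close>, which is the family that the composition lemma asks for.\<close>

lemma C_k_flat:
  assumes "C_k k \<phi>" shows "C_k k (\<lambda>x. flat (\<phi> x))"
proof -
  have "C_k k (\<lambda>x. flat_poly ((flat_step ^^ 0) 1) (\<phi> x))"
    by (rule C_k_compose[where F = "\<lambda>n. flat_poly ((flat_step ^^ n) 1)", OF _ assms])
       (simp add: flat_poly_has_derivative)
  then show ?thesis by (simp add: flat_def)
qed

lemma C_k_exp:
  assumes "C_k k \<phi>" shows "C_k k (\<lambda>x. exp (\<phi> x))"
  by (rule C_k_compose[where F = "\<lambda>n. exp", OF _ assms]) (rule DERIV_exp)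

section \<open>Bounds for the flat function and its derivative\<close>

lemma flat_nonneg: "0 \<le> flat t" and flat_le_1: "flat t \<le> 1"
  and flat_nonpos_eq: "t \<le> 0 \<Longrightarrow> flat t = 0" and flat_pos: "0 < t \<Longrightarrow> 0 < flat t"
  by (auto simp: flat_eq)

lemma flat'_nonneg: "0 \<le> flat' t" and flat'_nonpos_eq: "t \<le> 0 \<Longrightarrow> flat' t = 0"
  by (auto simp: flat'_eq)

text \<open>Taken at s = 1/t, these give the uniform bounds on \<open>flat'\<close> and on t^2 *
  \<open>flat' t\<close>. The square of s - 1 trades odd powers of s for the even ones in the Taylor
  polynomial of exp (s^2).\<close>

lemma power_gaussian_le:
  fixes s :: real assumes "0 < s"
  shows "s * exp (- s\<^sup>2) \<le> 1" "s ^ 3 * exp (- s\<^sup>2) \<le> 2"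
proof -
  have e: "1 + s\<^sup>2 \<le> exp (s\<^sup>2)" by (rule exp_ge_add_one_self)
  have e2: "1 + s\<^sup>2 + (s\<^sup>2)\<^sup>2 / 2 \<le> exp (s\<^sup>2)"
    using exp_lower_Taylor_quadratic[of "s\<^sup>2"] by simp
  have "s \<le> 1 + s\<^sup>2" using zero_le_power2[of "s - 1"] assms by (simp add: power2_eq_square algebra_simps)
  with e have "s \<le> exp (s\<^sup>2)" by linarith
  then show "s * exp (- s\<^sup>2) \<le> 1" by (simp add: exp_minus divide_simps)
  have "0 \<le> s\<^sup>2 * (s - 1)\<^sup>2" by simp
  then have "2 * s ^ 3 \<le> s\<^sup>2 + (s\<^sup>2)\<^sup>2"
    by (simp add: power2_eq_square power3_eq_cube algebra_simps)
  then have "s ^ 3 \<le> 2 * (1 + s\<^sup>2 + (s\<^sup>2)\<^sup>2 / 2)"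
    using zero_le_power2[of s] zero_le_power2[of "s\<^sup>2"] unfolding distrib_left by linarith
  also have "\<dots> \<le> 2 * exp (s\<^sup>2)" by (rule mult_left_mono[OF e2]) simp
  finally show "s ^ 3 * exp (- s\<^sup>2) \<le> 2" by (simp add: exp_minus divide_simps)
qed

lemma flat'_le_4: "flat' t \<le> 4"
  using power_gaussian_le(2)[of "1 / t"] by (auto simp: flat'_eq)

lemma square_times_flat'_le_2: "t\<^sup>2 * flat' t \<le> 2"
proof (cases "t > 0")
  case True
  then have "t\<^sup>2 * flat' t = 2 * (1 / t * exp (- (1 / t)\<^sup>2))"
    by (simp add: flat'_eq power2_eq_square power3_eq_cube)
  moreover have "1 / t * exp (- (1 / t)\<^sup>2) \<le> 1" using power_gaussian_le(1)[of "1 / t"] True by simp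
  ultimately show ?thesis by linarith
qed (simp add: flat'_eq)

lemma square_times_flat'_tendsto_0: "((\<lambda>t. t\<^sup>2 * flat' t) \<longlongrightarrow> 0) at_top"
proof (rule tendsto_sandwich)
  show "eventually (\<lambda>t. 0 \<le> t\<^sup>2 * flat' t) at_top"
    by (simp add: flat'_nonneg)
  show "eventually (\<lambda>t. t\<^sup>2 * flat' t \<le> 2 / t) at_top"
    using eventually_gt_at_top[of 0]
  proof eventually_elim
    case (elim t)
    then have "t\<^sup>2 * flat' t = 2 / t * exp (- (1 / t)\<^sup>2)"
      by (simp add: flat'_eq power2_eq_square power3_eq_cube)
    also have "\<dots> \<le> 2 / t * 1" using elim by (intro mult_left_mono) auto
    finally show ?case by simp
  qed
  show "((\<lambda>t. 2 / t) \<longlongrightarrow> (0::real)) at_top"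
    by (rule real_tendsto_divide_at_top[OF tendsto_const filterlim_ident])
qed simp

lemma flat_tendsto_1: "(flat \<longlongrightarrow> 1) at_top"
proof -
  have "((\<lambda>t. exp (- (1 / t)\<^sup>2)) \<longlongrightarrow> exp (- (0::real)\<^sup>2)) at_top"
    by (intro tendsto_intros real_tendsto_divide_at_top[OF tendsto_const filterlim_ident])
  then have "((\<lambda>t. exp (- (1 / t)\<^sup>2)) \<longlongrightarrow> (1::real)) at_top" by simp
  then show ?thesis
    by (rule Lim_transform_eventually)
       (use eventually_gt_at_top[of 0] in eventually_elim, simp add: flat_eq)
qed

lemma flat_Lipschitz: "\<bar>flat s - flat t\<bar> \<le> 4 * \<bar>s - t\<bar>"
proof -
  have "norm (flat s - flat t) \<le> 4 * norm (s - t)"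
  proof (rule field_differentiable_bound[where S = UNIV])
    show "(flat has_field_derivative flat' z) (at z within UNIV)" for z
      using flat_has_derivative[of z] by simp
    show "norm (flat' z) \<le> 4" for z
      using flat'_nonneg[of z] flat'_le_4[of z] by simp
  qed simp_all
  then show ?thesis by simp
qed

lemma isCont_flat: "isCont flat t" and isCont_flat': "isCont flat' t"
  using flat_has_derivative DERIV_isCont flat_poly_has_derivative
  unfolding flat'_def by blast+

lemma flat_measurable: "flat \<in> borel_measurable borel" and flat'_measurable: "flat' \<in> borel_measurable borel"
  by (intro borel_measurable_continuous_onI continuous_at_imp_continuous_on ballI isCont_flat isCont_flat')+

section \<open>Test functions\<close>

text \<open>Test functions and weak gradients are defined through the Frechet derivative in basis
  directions; collecting these numbers into a vector makes gradients elements of an L2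
  space.\<close>

definition tgrad :: "('a::euclidean_space \<Rightarrow> real) \<Rightarrow> 'a \<Rightarrow> 'a" where
  "tgrad \<phi> x = (\<Sum>i\<in>Basis. frechet_derivative \<phi> (at x) i *\<^sub>R i)"

lemma tgrad_inner_Basis: "i \<in> Basis \<Longrightarrow> tgrad \<phi> x \<bullet> i = frechet_derivative \<phi> (at x) i"
  by (simp add: tgrad_def inner_sum_left inner_Basis if_distrib sum.delta cong: if_cong)

lemma frechet_derivative_eq_tgrad:
  assumes "\<phi> differentiable (at x)"
  shows "frechet_derivative \<phi> (at x) h = tgrad \<phi> x \<bullet> h"
proof -
  have l: "linear (frechet_derivative \<phi> (at x))"
    using assms by (rule linear_frechet_derivative)
  have "frechet_derivative \<phi> (at x) h = frechet_derivative \<phi> (at x) (\<Sum>i\<in>Basis. (h \<bullet> i) *\<^sub>R i)"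
    by (simp add: euclidean_representation)
  also have "\<dots> = (\<Sum>i\<in>Basis. (h \<bullet> i) * frechet_derivative \<phi> (at x) i)"
    by (simp add: linear_sum[OF l] linear_scale[OF l])
  also have "\<dots> = tgrad \<phi> x \<bullet> h"
    by (simp add: tgrad_def inner_sum_left inner_sum_right inner_commute[of _ h] mult.commute)
  finally show ?thesis .
qed

lemma has_derivative_tgrad:
  assumes "\<phi> differentiable (at x)"
  shows "(\<phi> has_derivative (\<lambda>h. tgrad \<phi> x \<bullet> h)) (at x)"
proof -
  have "frechet_derivative \<phi> (at x) = (\<lambda>h. tgrad \<phi> x \<bullet> h)"
    using frechet_derivative_eq_tgrad[OF assms] by blast
  with assms show ?thesis by (simp add: frechet_derivative_works)
qed

lemma tgrad_eqI:
  assumes "(\<phi> has_derivative (\<lambda>h. g \<bullet> h)) (at x)"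
  shows "tgrad \<phi> x = g"
proof (rule euclidean_eqI)
  fix i :: 'a assume "i \<in> Basis"
  then show "tgrad \<phi> x \<bullet> i = g \<bullet> i"
    using frechet_derivative_at[OF assms] by (metis tgrad_inner_Basis)
qed

lemma tgrad_add_scaled:
  assumes "\<phi> differentiable (at x)" "\<psi> differentiable (at x)"
  shows "tgrad (\<lambda>x. \<phi> x + c * \<psi> x) x = tgrad \<phi> x + c *\<^sub>R tgrad \<psi> x"
proof (rule tgrad_eqI)
  have "((\<lambda>x. \<phi> x + c * \<psi> x) has_derivative (\<lambda>h. tgrad \<phi> x \<bullet> h + c * (tgrad \<psi> x \<bullet> h))) (at x)"
    by (intro has_derivative_add has_derivative_mult_right has_derivative_tgrad assms)
  then show "((\<lambda>x. \<phi> x + c * \<psi> x) has_derivative (\<lambda>h. (tgrad \<phi> x + c *\<^sub>R tgrad \<psi> x) \<bullet> h)) (at x)"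
    by (simp add: inner_add_left)
qed

lemma tgrad_mult:
  assumes "\<phi> differentiable (at x)" "\<psi> differentiable (at x)"
  shows "tgrad (\<lambda>x. \<phi> x * \<psi> x) x = \<phi> x *\<^sub>R tgrad \<psi> x + \<psi> x *\<^sub>R tgrad \<phi> x"
proof (rule tgrad_eqI)
  have "((\<lambda>x. \<phi> x * \<psi> x) has_derivative (\<lambda>h. \<phi> x * (tgrad \<psi> x \<bullet> h) + (tgrad \<phi> x \<bullet> h) * \<psi> x)) (at x)"
    by (intro has_derivative_mult has_derivative_tgrad assms)
  then show "((\<lambda>x. \<phi> x * \<psi> x) has_derivative (\<lambda>h. (\<phi> x *\<^sub>R tgrad \<psi> x + \<psi> x *\<^sub>R tgrad \<phi> x) \<bullet> h)) (at x)"
    by (simp add: inner_add_left mult.commute)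
qed

lemma tgrad_compose:
  assumes "(F has_real_derivative D) (at (\<phi> x))" "\<phi> differentiable (at x)"
  shows "(\<lambda>x. F (\<phi> x)) differentiable (at x)" "tgrad (\<lambda>x. F (\<phi> x)) x = D *\<^sub>R tgrad \<phi> x"
proof -
  note d = frechet_derivative_compose_real(1)[OF assms, unfolded frechet_derivative_eq_tgrad[OF assms(2)]]
  show "(\<lambda>x. F (\<phi> x)) differentiable (at x)"
    using d by (rule differentiableI)
  show "tgrad (\<lambda>x. F (\<phi> x)) x = D *\<^sub>R tgrad \<phi> x"
    using d by (intro tgrad_eqI) simp
qed

lemma C_k_imp_C1:
  fixes \<phi> :: "'a::euclidean_space \<Rightarrow> real"
  assumes "\<forall>k. C_k k \<phi>"
  shows "\<phi> differentiable (at x)" "continuous_on UNIV \<phi>" "continuous_on UNIV (tgrad \<phi>)"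
proof -
  have *: "C_k (Suc 0) \<phi>" "C_k 0 \<phi>" using assms by blast+
  then show "\<phi> differentiable (at x)" "continuous_on UNIV \<phi>" by simp_all
  show "continuous_on UNIV (tgrad \<phi>)"
    unfolding tgrad_def using * by (auto intro!: continuous_intros)
qed

lemma test_functions_C1:
  assumes "\<phi> \<in> test_functions \<Omega>"
  shows "\<phi> differentiable (at x)" "continuous_on UNIV \<phi>" "continuous_on UNIV (tgrad \<phi>)"
proof -
  have "\<forall>k. C_k k \<phi>" using assms unfolding test_functions_def by blast
  from C_k_imp_C1[OF this] show "\<phi> differentiable (at x)" "continuous_on UNIV \<phi>" "continuous_on UNIV (tgrad \<phi>)" .
qed

text \<open>Any compact set between the nonzero set and \<Omega> is a witness, because it also
  contains the closure; supports of sums and compositions then never have to be computed.\<close>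

lemma test_functionsI:
  assumes "\<And>k. C_k k \<phi>" "{x. \<phi> x \<noteq> 0} \<subseteq> K" "compact K" "K \<subseteq> \<Omega>"
  shows "\<phi> \<in> test_functions \<Omega>"
proof -
  have "closure {x. \<phi> x \<noteq> 0} \<subseteq> K"
    using assms by (intro closure_minimal compact_imp_closed)
  moreover from this have "compact (closure {x. \<phi> x \<noteq> 0})"
    using compact_Int_closed[OF assms(3) closed_closure] by (metis inf.absorb_iff2)
  ultimately show ?thesis
    using assms by (auto simp: test_functions_def)
qed

lemma test_functionsE:
  assumes "\<phi> \<in> test_functions \<Omega>"
  obtains K where "\<forall>k. C_k k \<phi>" "{x. \<phi> x \<noteq> 0} \<subseteq> K" "compact K" "K \<subseteq> \<Omega>"
proof -
  note * = assms[unfolded test_functions_def mem_Collect_eq]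
  show ?thesis
    by (rule that[OF conjunct1[OF *] closure_subset conjunct1[OF conjunct2[OF *]] conjunct2[OF conjunct2[OF *]]])
qed

lemma test_functions_add_scaled:
  assumes "\<phi> \<in> test_functions \<Omega>" "\<psi> \<in> test_functions \<Omega>"
  shows "(\<lambda>x. \<phi> x + c * \<psi> x) \<in> test_functions \<Omega>"
proof -
  obtain K where K: "\<forall>k. C_k k \<phi>" "{x. \<phi> x \<noteq> 0} \<subseteq> K" "compact K" "K \<subseteq> \<Omega>"
    using assms(1) by (rule test_functionsE)
  obtain L where L: "\<forall>k. C_k k \<psi>" "{x. \<psi> x \<noteq> 0} \<subseteq> L" "compact L" "L \<subseteq> \<Omega>"
    using assms(2) by (rule test_functionsE)
  show ?thesis
  proof (rule test_functionsI[where K = "K \<union> L"])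
    show "C_k k (\<lambda>x. \<phi> x + c * \<psi> x)" for k
      by (intro C_k_add C_k_mult C_k_const K(1)[rule_format] L(1)[rule_format])
    have "{x. \<phi> x + c * \<psi> x \<noteq> 0} \<subseteq> {x. \<phi> x \<noteq> 0} \<union> {x. \<psi> x \<noteq> 0}" by auto
    with K L show "{x. \<phi> x + c * \<psi> x \<noteq> 0} \<subseteq> K \<union> L" by blast
  qed (use K L in auto)
qed

lemma test_functions_mult_smooth:
  assumes "\<And>k. C_k k g" "\<phi> \<in> test_functions \<Omega>"
  shows "(\<lambda>x. g x * \<phi> x) \<in> test_functions \<Omega>"
proof -
  obtain K where K: "\<forall>k. C_k k \<phi>" "{x. \<phi> x \<noteq> 0} \<subseteq> K" "compact K" "K \<subseteq> \<Omega>"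
    using assms(2) by (rule test_functionsE)
  show ?thesis
    by (rule test_functionsI[where K = K]) (use K assms(1) in \<open>auto intro: C_k_mult\<close>)
qed

text \<open>What keeps the support inside the same compact set is that \<open>flat\<close> vanishes
  at 0.\<close>

lemma test_functions_flat:
  assumes "\<phi> \<in> test_functions \<Omega>"
  shows "(\<lambda>x. flat (c * \<phi> x)) \<in> test_functions \<Omega>"
proof -
  obtain K where K: "\<forall>k. C_k k \<phi>" "{x. \<phi> x \<noteq> 0} \<subseteq> K" "compact K" "K \<subseteq> \<Omega>"
    using assms by (rule test_functionsE)
  show ?thesis
  proof (rule test_functionsI[where K = K])
    show "C_k k (\<lambda>x. flat (c * \<phi> x))" for k
      by (intro C_k_flat C_k_mult C_k_const K(1)[rule_format])
    show "{x. flat (c * \<phi> x) \<noteq> 0} \<subseteq> K"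
      using K(2) by (auto simp: flat_nonpos_eq)
  qed (use K in auto)
qed

lemma zero_test_function: "(\<lambda>_. 0) \<in> test_functions \<Omega>"
  by (rule test_functionsI[where K = "{}", OF C_k_const]) simp_all

lemma tgrad_eq_0_outside:
  assumes "{x. \<phi> x \<noteq> 0} \<subseteq> K" "closed K" "x \<notin> K"
  shows "tgrad \<phi> x = 0"
proof (rule tgrad_eqI)
  have "((\<lambda>_. 0) has_derivative (\<lambda>h. 0)) (at x)" by simp
  then have "(\<phi> has_derivative (\<lambda>h. 0)) (at x)"
    by (rule has_derivative_transform_within_open[where s = "- K"]) (use assms in auto)
  then show "(\<phi> has_derivative (\<lambda>h. 0 \<bullet> h)) (at x)" by simp
qed

section \<open>Gradients of compactly supported functions have integral zero\<close>

lemma abs_diff_le_tgrad_bound: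
  fixes \<phi> :: "'a::euclidean_space \<Rightarrow> real"
  assumes d: "\<And>x. \<phi> differentiable (at x)" and B: "\<And>x. norm (tgrad \<phi> x) \<le> B"
  shows "\<bar>\<phi> x - \<phi> y\<bar> \<le> B * norm (x - y)"
proof -
  have "norm (\<phi> x - \<phi> y) \<le> B * norm (x - y)"
  proof (rule differentiable_bound[where S = UNIV and f' = "\<lambda>x h. tgrad \<phi> x \<bullet> h"])
    fix x :: 'a
    show "(\<phi> has_derivative (\<lambda>h. tgrad \<phi> x \<bullet> h)) (at x within UNIV)"
      using has_derivative_tgrad[OF d] by simp
    show "onorm (\<lambda>h. tgrad \<phi> x \<bullet> h) \<le> B"
    proof (rule onorm_le)
      fix h
      have "norm (tgrad \<phi> x \<bullet> h) \<le> norm (tgrad \<phi> x) * norm h"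
        by (simp add: Cauchy_Schwarz_ineq2)
      also have "\<dots> \<le> B * norm h" by (intro mult_right_mono B) simp
      finally show "norm (tgrad \<phi> x \<bullet> h) \<le> B * norm h" .
    qed
  qed auto
  then show ?thesis by simp
qed

text \<open>A directional derivative is the limit of the difference quotients \<open>s n\<close>.
  Each of them integrates to zero by translation invariance of Lebesgue measure, and dominated
  convergence passes to the limit, so neither iterated integrals nor boundary terms enter. One
  continuous derivative is enough, which later admits compositions with an antiderivative of
  \<open>flat\<close>.\<close>

lemma integral_tgrad_lborel_eq_0:
  fixes \<phi> :: "'a::euclidean_space \<Rightarrow> real"
  assumes d: "\<And>x. \<phi> differentiable (at x)" and c: "continuous_on UNIV (tgrad \<phi>)"
    and K: "{x. \<phi> x \<noteq> 0} \<subseteq> K" "compact K"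
  shows "(\<integral>x. tgrad \<phi> x \<bullet> e \<partial>lborel) = 0"
proof -
  have cont: "continuous_on UNIV \<phi>"
    using d by (auto intro!: continuous_at_imp_continuous_on differentiable_imp_continuous_within)
  obtain R where R: "0 < R" "K \<subseteq> ball 0 R"
    using compact_imp_bounded[OF K(2)] bounded_subset_ballD by blast
  have out: "x \<notin> K \<Longrightarrow> tgrad \<phi> x = 0" for x
    using tgrad_eq_0_outside[OF K(1) compact_imp_closed[OF K(2)]] .
  have "bounded (tgrad \<phi> ` K)"
    using c K(2) by (meson compact_continuous_image compact_imp_bounded continuous_on_subset subset_UNIV)
  then obtain B where B: "0 < B" "\<And>x. x \<in> K \<Longrightarrow> norm (tgrad \<phi> x) \<le> B"
    by (auto simp: bounded_pos)
  have B': "norm (tgrad \<phi> x) \<le> B" for x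
    using B out[of x] by (cases "x \<in> K") auto
  have bm: "\<phi> \<in> borel_measurable borel"
    using cont by (rule borel_measurable_continuous_onI)
  define s where "s n x = (\<phi> (x + (1 / Suc n) *\<^sub>R e) - \<phi> x) * Suc n" for n x
  \<comment> \<open>The shift in \<open>s n\<close> has length at most |e|, so the ball of this
    radius contains the support of every difference quotient.\<close>
  define r where "r = R + norm e"
  have bound: "norm (s n x) \<le> indicator (cball 0 r) x * (B * norm e)" for n x
  proof (cases "x \<in> cball 0 r")
    case True
    have "\<bar>\<phi> (x + (1 / Suc n) *\<^sub>R e) - \<phi> x\<bar> \<le> B * norm (x + (1 / Suc n) *\<^sub>R e - x)"
      by (rule abs_diff_le_tgrad_bound[OF d B'])
    then have "\<bar>\<phi> (x + (1 / Suc n) *\<^sub>R e) - \<phi> x\<bar> * Suc n \<le> B * norm ((1 / Suc n) *\<^sub>R e) * Suc n"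
      by (intro mult_right_mono) auto
    with True show ?thesis by (simp add: s_def abs_mult)
  next
    case False
    then have "norm x > R + norm e" by (simp add: r_def)
    moreover have "norm ((1 / Suc n) *\<^sub>R e) \<le> norm e"
      by (simp add: divide_simps algebra_simps)
    moreover have "norm x - norm ((1 / Suc n) *\<^sub>R e) \<le> norm (x + (1 / Suc n) *\<^sub>R e)"
      by (rule norm_diff_ineq)
    ultimately have "x + (1 / Suc n) *\<^sub>R e \<notin> ball 0 R" "x \<notin> ball 0 R"
      by auto (smt (verit) norm_ge_zero)+
    then have "\<phi> (x + (1 / Suc n) *\<^sub>R e) = 0" "\<phi> x = 0" using K R by blast+
    then show ?thesis using B by (simp add: s_def)
  qed
  have lim: "(\<lambda>n. s n x) \<longlonglongrightarrow> tgrad \<phi> x \<bullet> e" for x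
  proof -
    have "((\<lambda>t. x + t *\<^sub>R e) has_derivative (\<lambda>t. t *\<^sub>R e)) (at 0)"
      by (auto intro!: derivative_eq_intros)
    from has_derivative_compose[OF this, of \<phi> "\<lambda>h. tgrad \<phi> x \<bullet> h"]
    have "((\<lambda>t. \<phi> (x + t *\<^sub>R e)) has_real_derivative (tgrad \<phi> x \<bullet> e)) (at 0)"
      using has_derivative_tgrad[OF d] by (simp add: has_field_derivative_def mult_commute_abs)
    then have "((\<lambda>t. (\<phi> (x + t *\<^sub>R e) - \<phi> x) / t) \<longlongrightarrow> tgrad \<phi> x \<bullet> e) (at 0)"
      by (simp add: has_field_derivative_iff)
    moreover have "filterlim (\<lambda>n. 1 / real (Suc n)) (at 0) sequentially"
      unfolding filterlim_at using LIMSEQ_inverse_real_of_nat by (auto simp: inverse_eq_divide)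
    ultimately show ?thesis
      unfolding s_def by (auto dest: filterlim_compose)
  qed
  have int_cb: "integrable lborel (\<lambda>x::'a. indicator (cball 0 r) x * (B * norm e))"
    using emeasure_bounded_finite[OF bounded_cball, of "0::'a" r]
    by (intro integrable_mult_left integrable_real_indicator) auto
  have sm: "s n \<in> borel_measurable lborel" for n
    unfolding s_def measurable_lborel1
    by (intro borel_measurable_times borel_measurable_diff measurable_compose[OF _ bm]) auto
  have "(\<lambda>n. integral\<^sup>L lborel (s n)) \<longlonglongrightarrow> (\<integral>x. tgrad \<phi> x \<bullet> e \<partial>lborel)"
  proof (rule integral_dominated_convergence[OF _ sm int_cb])
    show "(\<lambda>x. tgrad \<phi> x \<bullet> e) \<in> borel_measurable lborel"
    proof -
      have "continuous_on UNIV (\<lambda>x. tgrad \<phi> x \<bullet> e)"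
        using c by (intro continuous_on_inner continuous_on_const)
      then show ?thesis by (simp add: borel_measurable_continuous_onI)
    qed
  qed (use lim bound in auto)
  \<comment> \<open>Translation invariance of \<open>lborel\<close>: both terms of the quotient have
    the same integral.\<close>
  moreover have "integral\<^sup>L lborel (s n) = 0" for n
  proof -
    have "integrable lborel (\<lambda>x. indicator K x *\<^sub>R \<phi> x)"
      using cont K(2) by (intro borel_integrable_compact) (auto intro: continuous_on_subset)
    moreover have "(\<lambda>x. indicator K x *\<^sub>R \<phi> x) = \<phi>"
      using K(1) by (auto simp: fun_eq_iff indicator_def)
    ultimately have int: "integrable lborel \<phi>" by simp
    have "integrable (distr lborel borel ((+) c)) \<phi>" for c :: 'a
      using int by (simp add: lborel_distr_plus)
    then have int2: "integrable lborel (\<lambda>x. \<phi> (c + x))" for c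
      by (rule integrable_distr_eq[THEN iffD1, rotated 2]) (use bm in auto)
    have "(\<integral>x. \<phi> (c + x) \<partial>lborel) = (\<integral>x. \<phi> x \<partial>(distr lborel borel ((+) c)))" for c
      by (rule integral_distr[symmetric]) (use bm in auto)
    then have "(\<integral>x. \<phi> (c + x) \<partial>lborel) = (\<integral>x. \<phi> x \<partial>lborel)" for c
      by (simp add: lborel_distr_plus)
    moreover have "s n = (\<lambda>x. (\<phi> ((1 / Suc n) *\<^sub>R e + x) - \<phi> x) * Suc n)"
      by (simp only: s_def fun_eq_iff add.commute simp_thms)
    ultimately show ?thesis
      using int int2 by simp
  qed
  ultimately show ?thesis by (simp add: LIMSEQ_const_iff)
qed

section \<open>Square-integrable functions on a bounded open set\<close>

lemma power2_tendsto_0_imp: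
  fixes f :: "'b \<Rightarrow> real"
  assumes "((\<lambda>n. (f n)\<^sup>2) \<longlongrightarrow> 0) F" shows "(f \<longlongrightarrow> 0) F"
  using tendsto_real_sqrt[OF assms] by (simp add: tendsto_rabs_zero_iff)

lemma power2_norm_diff_scaleR:
  "(norm (a - t *\<^sub>R b :: 'b::real_inner))\<^sup>2 = (norm a)\<^sup>2 - 2 * t * (a \<bullet> b) + t\<^sup>2 * (norm b)\<^sup>2"
  unfolding power2_norm_eq_inner
  by (simp add: inner_diff_left inner_diff_right inner_commute[of b a] power2_eq_square algebra_simps)

lemma norm_add_square_le: "(norm (a + b :: 'b::real_normed_vector))\<^sup>2 \<le> 2 * (norm a)\<^sup>2 + 2 * (norm b)\<^sup>2"
proof -
  have "(norm (a + b))\<^sup>2 \<le> (norm a + norm b)\<^sup>2"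
    by (rule power_mono[OF norm_triangle_ineq norm_ge_zero])
  also have "\<dots> \<le> 2 * (norm a)\<^sup>2 + 2 * (norm b)\<^sup>2"
    using zero_le_power2[of "norm a - norm b"] by (simp add: power2_eq_square algebra_simps)
  finally show ?thesis .
qed

locale bounded_open =
  fixes \<Omega> :: "'a::euclidean_space set"
  assumes open_Omega: "open \<Omega>" and bounded_Omega: "bounded \<Omega>"
begin

abbreviation M :: "'a measure" where "M \<equiv> lebesgue_on \<Omega>"

abbreviation sqnorm :: "('a \<Rightarrow> 'b::real_normed_vector) \<Rightarrow> real" where
  "sqnorm f \<equiv> \<integral>x. (norm (f x))\<^sup>2 \<partial>M"

lemma Omega_lmeasurable: "\<Omega> \<in> lmeasurable"
  using open_Omega bounded_Omega by (rule lmeasurable_open[rotated])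

lemma Omega_sets [simp, intro]: "\<Omega> \<in> sets lebesgue"
  using Omega_lmeasurable by (rule fmeasurableD)

sublocale finite_measure M
  by (rule finite_measure_lebesgue_on[OF Omega_lmeasurable])

lemma continuous_measurable:
  "continuous_on UNIV f \<Longrightarrow> (f :: 'a \<Rightarrow> 'b::euclidean_space) \<in> borel_measurable M"
  by (intro continuous_imp_measurable_on_sets_lebesgue) (auto intro: continuous_on_subset)

lemma continuous_bounded:
  assumes "continuous_on UNIV (f :: 'a \<Rightarrow> 'b::euclidean_space)"
  obtains B where "0 \<le> B" "\<forall>x\<in>\<Omega>. norm (f x) \<le> B"
proof -
  have "compact (f ` closure \<Omega>)"
    using assms bounded_Omega by (intro compact_continuous_image)
      (auto intro: continuous_on_subset simp: compact_eq_bounded_closed)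
  then have "bounded (f ` \<Omega>)"
    using bounded_subset compact_imp_bounded closure_subset by (metis image_mono)
  then obtain B where "\<And>x. x \<in> \<Omega> \<Longrightarrow> norm (f x) \<le> B"
    unfolding bounded_iff by blast
  then show ?thesis by (intro that[of "max B 0"]) (auto simp: le_max_iff_disj)
qed

lemma L2I: "f \<in> borel_measurable M \<Longrightarrow> integrable M (\<lambda>x. (norm (f x))\<^sup>2) \<Longrightarrow> f \<in> L2 \<Omega>"
  by (simp add: L2_def)

lemma L2D:
  assumes "f \<in> L2 \<Omega>"
  shows L2_measurable: "f \<in> borel_measurable M"
    and L2_square_integrable: "integrable M (\<lambda>x. (norm (f x))\<^sup>2)"
  using assms by (auto simp: L2_def)

lemma L2_bound:
  assumes "g \<in> borel_measurable M" "f \<in> L2 \<Omega>" "AE x in M. norm (g x) \<le> C * norm (f x)"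
  shows "g \<in> L2 \<Omega>"
proof (rule L2I[OF assms(1)], rule Bochner_Integration.integrable_bound)
  show "integrable M (\<lambda>x. C\<^sup>2 * (norm (f x))\<^sup>2)"
    using L2D[OF assms(2)] by simp
  show "(\<lambda>x. (norm (g x))\<^sup>2) \<in> borel_measurable M"
    using assms(1) by measurable
  show "AE x in M. norm ((norm (g x))\<^sup>2) \<le> norm (C\<^sup>2 * (norm (f x))\<^sup>2)"
    using assms(3)
  proof eventually_elim
    case (elim x)
    from power_mono[OF this norm_ge_zero, of 2] show ?case by (simp add: power_mult_distrib)
  qed
qed

lemma bounded_L2:
  assumes "f \<in> borel_measurable M" "\<And>x. x \<in> \<Omega> \<Longrightarrow> norm (f x) \<le> C"
  shows "f \<in> L2 \<Omega>"
proof (rule L2_bound[OF assms(1), where f = "\<lambda>_. 1 :: real" and C = C])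
  show "AE x in M. norm (f x) \<le> C * norm (1::real)"
    using assms(2) by (intro AE_I2) auto
qed (auto intro: L2I)

lemma continuous_L2:
  assumes "continuous_on UNIV f" shows "f \<in> L2 \<Omega>"
proof -
  obtain B where "0 \<le> B" "\<forall>x\<in>\<Omega>. norm (f x) \<le> B"
    using continuous_bounded[OF assms] .
  then show ?thesis by (intro bounded_L2[OF continuous_measurable[OF assms]]) blast
qed

lemma L2_mult_bounded:
  assumes "f \<in> L2 \<Omega>" "h \<in> borel_measurable M" "AE x in M. \<bar>h x\<bar> \<le> C"
  shows "(\<lambda>x. h x *\<^sub>R f x) \<in> L2 \<Omega>"
proof (rule L2_bound[OF _ assms(1), where C = C])
  show "(\<lambda>x. h x *\<^sub>R f x) \<in> borel_measurable M"
    using assms(2) L2D(1)[OF assms(1)] by measurable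
  show "AE x in M. norm (h x *\<^sub>R f x) \<le> C * norm (f x)"
    using assms(3) by eventually_elim (auto intro: mult_right_mono)
qed

lemma L2_norm: "f \<in> L2 \<Omega> \<Longrightarrow> (\<lambda>x. norm (f x)) \<in> L2 \<Omega>"
  by (rule L2_bound[where C = 1]) (auto dest: L2_measurable)

lemma L2_scaleR: "f \<in> L2 \<Omega> \<Longrightarrow> (\<lambda>x. c *\<^sub>R f x) \<in> L2 \<Omega>"
  by (rule L2_mult_bounded[where C = "\<bar>c\<bar>"]) auto

lemma L2_add:
  assumes "f \<in> L2 \<Omega>" "g \<in> L2 \<Omega>"
  shows "(\<lambda>x. f x + g x) \<in> L2 \<Omega>"
proof (rule L2I, goal_cases)
  case 1 show ?case using assms[THEN L2D(1)] by measurable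
next
  case 2
  show ?case
  proof (rule Bochner_Integration.integrable_bound)
    show "integrable M (\<lambda>x. 2 * (norm (f x))\<^sup>2 + 2 * (norm (g x))\<^sup>2)"
      using assms[THEN L2D(2)] by simp
    show "(\<lambda>x. (norm (f x + g x))\<^sup>2) \<in> borel_measurable M"
      using assms[THEN L2D(1)] by measurable
    show "AE x in M. norm ((norm (f x + g x))\<^sup>2) \<le> norm (2 * (norm (f x))\<^sup>2 + 2 * (norm (g x))\<^sup>2)"
      by (intro AE_I2) (simp add: norm_add_square_le)
  qed
qed

lemma L2_diff: "f \<in> L2 \<Omega> \<Longrightarrow> g \<in> L2 \<Omega> \<Longrightarrow> (\<lambda>x. f x - g x) \<in> L2 \<Omega>"
  using L2_add[OF _ L2_scaleR[of g "-1"]] by simp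

lemma L2_inner_const: "f \<in> L2 \<Omega> \<Longrightarrow> (\<lambda>x. f x \<bullet> e) \<in> L2 \<Omega>"
proof (rule L2_bound[where C = "norm e" and f = f])
  assume f: "f \<in> L2 \<Omega>"
  show "(\<lambda>x. f x \<bullet> e) \<in> borel_measurable M"
    by (intro borel_measurable_inner L2_measurable[OF f] borel_measurable_const)
  have "norm (f x \<bullet> e) \<le> norm e * norm (f x)" for x
    using Cauchy_Schwarz_ineq2[of "f x" e] by (simp add: mult.commute)
  then show "AE x in M. norm (f x \<bullet> e) \<le> norm e * norm (f x)" by (intro AE_I2)
qed

lemma L2_scaleR_const: "f \<in> L2 \<Omega> \<Longrightarrow> (\<lambda>x. f x *\<^sub>R e) \<in> L2 \<Omega>"
proof (rule L2_bound[where C = "norm e" and f = f])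
  assume f: "f \<in> L2 \<Omega>"
  show "(\<lambda>x. f x *\<^sub>R e) \<in> borel_measurable M"
    by (intro borel_measurable_scaleR L2_measurable[OF f] borel_measurable_const)
qed simp_all

lemma L2_inner_integrable:
  assumes "f \<in> L2 \<Omega>" "g \<in> L2 \<Omega>"
  shows "integrable M (\<lambda>x. f x \<bullet> g x)"
proof (rule Bochner_Integration.integrable_bound)
  show "integrable M (\<lambda>x. (norm (f x))\<^sup>2 + (norm (g x))\<^sup>2)"
    using assms[THEN L2D(2)] by simp
  show "(\<lambda>x. f x \<bullet> g x) \<in> borel_measurable M"
    using assms[THEN L2D(1)] by measurable
  have "\<bar>a \<bullet> b\<bar> \<le> (norm a)\<^sup>2 + (norm b)\<^sup>2" for a b :: 'b
    using Cauchy_Schwarz_ineq2[of a b] zero_le_power2[of "norm a - norm b"]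
      mult_nonneg_nonneg[OF norm_ge_zero[of a] norm_ge_zero[of b]]
    unfolding power2_diff by linarith
  then show "AE x in M. norm (f x \<bullet> g x) \<le> norm ((norm (f x))\<^sup>2 + (norm (g x))\<^sup>2)"
    by (intro AE_I2) simp
qed

lemma L2_mult_integrable: "f \<in> L2 \<Omega> \<Longrightarrow> g \<in> L2 \<Omega> \<Longrightarrow> integrable M (\<lambda>x. f x * g x :: real)"
  using L2_inner_integrable[of f g] by simp

lemma L2_integrable:
  assumes "f \<in> L2 \<Omega>" shows "integrable M f"
proof (rule Bochner_Integration.integrable_bound[OF _ L2D(1)[OF assms]])
  show "integrable M (\<lambda>x. norm (f x) * 1)"
    by (rule L2_mult_integrable[OF L2_norm[OF assms]]) (auto intro: continuous_L2)
qed simp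

text \<open>Discriminant argument for the nonnegative quadratic in t that expands the squared norm
  of f - t g. The squared form of the inequality is the one that the limit lemmas use.\<close>

lemma L2_Cauchy_Schwarz:
  assumes "f \<in> L2 \<Omega>" "g \<in> L2 \<Omega>"
  shows "(\<integral>x. f x \<bullet> g x \<partial>M)\<^sup>2 \<le> (sqnorm f) * (sqnorm g)"
proof -
  define A B C where "A = (sqnorm f)" "B = (\<integral>x. f x \<bullet> g x \<partial>M)"
    "C = (sqnorm g)"
  note ABC = this
  have q: "0 \<le> A - 2 * t * B + t\<^sup>2 * C" for t
  proof -
    have "0 \<le> (sqnorm (\<lambda>x. f x - t *\<^sub>R g x))" by simp
    also have "(\<lambda>x. (norm (f x - t *\<^sub>R g x))\<^sup>2) =
        (\<lambda>x. (norm (f x))\<^sup>2 - 2 * t * (f x \<bullet> g x) + t\<^sup>2 * (norm (g x))\<^sup>2)"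
      by (simp add: power2_norm_diff_scaleR)
    also have "(\<integral>x. \<dots> x \<partial>M) = A - 2 * t * B + t\<^sup>2 * C"
      using assms[THEN L2D(2)] L2_inner_integrable[OF assms] by (simp add: ABC)
    finally show ?thesis .
  qed
  have "0 \<le> A" "0 \<le> C" by (simp_all add: ABC)
  have "B\<^sup>2 \<le> A * C"
  proof (cases "C = 0")
    case True
    have "B = 0"
    proof (rule ccontr)
      assume "B \<noteq> 0"
      \<comment> \<open>With C = 0 the quadratic is affine in t; at this t it equals A - (A + 1) =
        -1.\<close>
      then show False using q[of "(A + 1) / (2 * B)"] True by (simp add: field_simps)
    qed
    then show ?thesis using True by simp
  next
    case False
    then have "0 < C" using \<open>0 \<le> C\<close> by simp
    \<comment> \<open>The quadratic is minimal at t = B / C.\<close>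
    then show ?thesis using q[of "B / C"] by (simp add: field_simps power2_eq_square)
  qed
  then show ?thesis by (simp add: ABC)
qed

text \<open>Membership is part of the definition because the Bochner integral of a non-integrable
  function is 0, so that convergence of the integrals alone would say nothing.\<close>

definition L2_lim :: "(nat \<Rightarrow> 'a \<Rightarrow> 'b::euclidean_space) \<Rightarrow> ('a \<Rightarrow> 'b) \<Rightarrow> bool" where
  "L2_lim f g \<longleftrightarrow> (\<forall>n. f n \<in> L2 \<Omega>) \<and> g \<in> L2 \<Omega> \<and>
    (\<lambda>n. sqnorm (\<lambda>x. f n x - g x)) \<longlonglongrightarrow> 0"

lemma L2_limD:
  assumes "L2_lim f g"
  shows "f n \<in> L2 \<Omega>" "g \<in> L2 \<Omega>" "(\<lambda>n. sqnorm (\<lambda>x. f n x - g x)) \<longlonglongrightarrow> 0"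
  using assms by (auto simp: L2_lim_def)

lemma L2_lim_const: "f \<in> L2 \<Omega> \<Longrightarrow> L2_lim (\<lambda>_. f) f"
  by (simp add: L2_lim_def)

lemma L2_lim_subseq:
  assumes "L2_lim f g" "strict_mono r" shows "L2_lim (\<lambda>n. f (r n)) g"
  using L2_limD[OF assms(1)] LIMSEQ_subseq_LIMSEQ[OF L2_limD(3)[OF assms(1)] assms(2)]
  by (simp add: L2_lim_def o_def)

lemma L2_lim_dominated:
  assumes "\<And>n. h n \<in> L2 \<Omega>" "k \<in> L2 \<Omega>"
    and "(\<lambda>n. \<integral>x. s n x \<partial>M) \<longlonglongrightarrow> 0" "\<And>n. integrable M (s n)"
    and "\<And>n. AE x in M. (norm (h n x - k x))\<^sup>2 \<le> s n x"
  shows "L2_lim h k"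
  unfolding L2_lim_def
proof (intro conjI allI assms(1,2))
  show "(\<lambda>n. sqnorm (\<lambda>x. h n x - k x)) \<longlonglongrightarrow> 0"
  proof (rule tendsto_sandwich[OF _ _ tendsto_const assms(3)])
    show "\<forall>\<^sub>F n in sequentially. (sqnorm (\<lambda>x. h n x - k x)) \<le> (\<integral>x. s n x \<partial>M)"
      by (intro always_eventually allI
          integral_mono_AE[OF L2D(2)[OF L2_diff[OF assms(1,2)]] assms(4,5)])
  qed auto
qed

lemma L2_lim_bound:
  assumes "L2_lim f g" "\<And>n. h n \<in> L2 \<Omega>" "k \<in> L2 \<Omega>"
    and "\<And>n. AE x in M. norm (h n x - k x) \<le> C * norm (f n x - g x)"
  shows "L2_lim h k"
proof (rule L2_lim_dominated[where s = "\<lambda>n x. C\<^sup>2 * (norm (f n x - g x))\<^sup>2", OF assms(2,3)])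
  show "(\<lambda>n. \<integral>x. C\<^sup>2 * (norm (f n x - g x))\<^sup>2 \<partial>M) \<longlonglongrightarrow> 0"
    using tendsto_mult_right_zero[OF L2_limD(3)[OF assms(1)]] by simp
  show "integrable M (\<lambda>x. C\<^sup>2 * (norm (f n x - g x))\<^sup>2)" for n
    using L2_limD[OF assms(1)] by (intro integrable_mult_right L2D(2) L2_diff)
  show "AE x in M. (norm (h n x - k x))\<^sup>2 \<le> C\<^sup>2 * (norm (f n x - g x))\<^sup>2" for n
    using assms(4)[of n]
  proof eventually_elim
    case (elim x)
    from power_mono[OF this norm_ge_zero, of 2] show ?case by (simp add: power_mult_distrib)
  qed
qed

lemma L2_lim_mult_bounded:
  assumes "L2_lim f g" "h \<in> borel_measurable M" "AE x in M. \<bar>h x\<bar> \<le> C"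
  shows "L2_lim (\<lambda>n x. h x *\<^sub>R f n x) (\<lambda>x. h x *\<^sub>R g x)"
proof (rule L2_lim_bound[OF assms(1), where C = C])
  show "AE x in M. norm (h x *\<^sub>R f n x - h x *\<^sub>R g x) \<le> C * norm (f n x - g x)" for n
    using assms(3)
    by eventually_elim (auto simp flip: scaleR_diff_right intro: mult_right_mono)
qed (use assms L2_limD[OF assms(1)] in \<open>auto intro: L2_mult_bounded\<close>)

lemma L2_lim_scaleR: "L2_lim f g \<Longrightarrow> L2_lim (\<lambda>n x. c *\<^sub>R f n x) (\<lambda>x. c *\<^sub>R g x)"
  by (rule L2_lim_mult_bounded[where C = "\<bar>c\<bar>"]) auto

lemma L2_lim_add:
  assumes "L2_lim f g" "L2_lim h k"
  shows "L2_lim (\<lambda>n x. f n x + h n x) (\<lambda>x. g x + k x)"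
proof (rule L2_lim_dominated[where s = "\<lambda>n x. 2 * (norm (f n x - g x))\<^sup>2 + 2 * (norm (h n x - k x))\<^sup>2"])
  have i: "integrable M (\<lambda>x. (norm (f n x - g x))\<^sup>2)" "integrable M (\<lambda>x. (norm (h n x - k x))\<^sup>2)" for n
    using L2_limD[OF assms(1)] L2_limD[OF assms(2)] by (intro L2D(2) L2_diff; simp)+
  have "(\<lambda>n. 2 * (sqnorm (\<lambda>x. f n x - g x)) + 2 * (sqnorm (\<lambda>x. h n x - k x))) \<longlonglongrightarrow> 2 * 0 + 2 * 0"
    by (intro tendsto_intros L2_limD(3) assms)
  then show "(\<lambda>n. \<integral>x. 2 * (norm (f n x - g x))\<^sup>2 + 2 * (norm (h n x - k x))\<^sup>2 \<partial>M) \<longlonglongrightarrow> 0"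
    using i by simp
  show "integrable M (\<lambda>x. 2 * (norm (f n x - g x))\<^sup>2 + 2 * (norm (h n x - k x))\<^sup>2)" for n
    using i by simp
  show "AE x in M. (norm (f n x + h n x - (g x + k x)))\<^sup>2 \<le> 2 * (norm (f n x - g x))\<^sup>2 + 2 * (norm (h n x - k x))\<^sup>2" for n
    using norm_add_square_le[of "f n x - g x" "h n x - k x" for x]
    by (intro AE_I2) (simp only: add_diff_add)
qed (use L2_limD[OF assms(1)] L2_limD[OF assms(2)] in \<open>auto intro: L2_add\<close>)

lemma L2_lim_inner_const: "L2_lim f g \<Longrightarrow> L2_lim (\<lambda>n x. f n x \<bullet> e) (\<lambda>x. g x \<bullet> e)"
proof (rule L2_lim_bound[where C = "norm e" and f = f and g = g])
  have "norm (f n x \<bullet> e - g x \<bullet> e) \<le> norm e * norm (f n x - g x)" for n x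
    using Cauchy_Schwarz_ineq2[of "f n x - g x" e] by (simp add: inner_diff_left mult.commute)
  then show "AE x in M. norm (f n x \<bullet> e - g x \<bullet> e) \<le> norm e * norm (f n x - g x)" for n
    by (intro AE_I2)
qed (auto dest: L2_limD intro: L2_inner_const)

lemma L2_lim_scaleR_const: "L2_lim f g \<Longrightarrow> L2_lim (\<lambda>n x. f n x *\<^sub>R e) (\<lambda>x. g x *\<^sub>R e)"
proof (rule L2_lim_bound[where C = "norm e" and f = f and g = g])
  show "AE x in M. norm (f n x *\<^sub>R e - g x *\<^sub>R e) \<le> norm e * norm (f n x - g x)" for n
    by (intro AE_I2) (simp flip: scaleR_diff_left)
qed (auto dest: L2_limD intro: L2_scaleR_const)

lemma L2_lim_inner_0:
  assumes "L2_lim f g" "h \<in> L2 \<Omega>"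
  shows "(\<lambda>n. \<integral>x. f n x \<bullet> h x \<partial>M) \<longlonglongrightarrow> (\<integral>x. g x \<bullet> h x \<partial>M)"
proof -
  define d where "d n = (sqnorm (\<lambda>x. f n x - g x))" for n
  have "((\<integral>x. f n x \<bullet> h x \<partial>M) - (\<integral>x. g x \<bullet> h x \<partial>M))\<^sup>2 \<le> d n * (sqnorm h)" for n
    using L2_Cauchy_Schwarz[OF L2_diff[OF L2_limD(1,2)[OF assms(1)]] assms(2), of n]
      L2_inner_integrable[OF L2_limD(1)[OF assms(1)] assms(2)]
      L2_inner_integrable[OF L2_limD(2)[OF assms(1)] assms(2)]
    by (simp add: inner_diff_left d_def)
  then have "\<forall>\<^sub>F n in sequentially. norm (((\<integral>x. f n x \<bullet> h x \<partial>M) - (\<integral>x. g x \<bullet> h x \<partial>M))\<^sup>2)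
      \<le> d n * (sqnorm h)"
    by (simp only: real_norm_def abs_power2 eventually_True)
  moreover have "(\<lambda>n. d n * (sqnorm h)) \<longlonglongrightarrow> 0"
    using L2_limD(3)[OF assms(1)] unfolding d_def by (rule tendsto_mult_left_zero)
  ultimately have "(\<lambda>n. ((\<integral>x. f n x \<bullet> h x \<partial>M) - (\<integral>x. g x \<bullet> h x \<partial>M))\<^sup>2) \<longlonglongrightarrow> 0"
    by (rule Lim_null_comparison)
  then have "(\<lambda>n. (\<integral>x. f n x \<bullet> h x \<partial>M) - (\<integral>x. g x \<bullet> h x \<partial>M)) \<longlonglongrightarrow> 0"
    by (rule power2_tendsto_0_imp)
  then show ?thesis by (simp add: LIM_zero_iff)
qed

text \<open>Both factors vary with n, so the product of the two differences is expanded: its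
  integral vanishes in the limit by Cauchy-Schwarz, and each mixed term has one factor
  fixed.\<close>

lemma L2_lim_inner:
  assumes "L2_lim f g" "L2_lim h k"
  shows "(\<lambda>n. \<integral>x. f n x \<bullet> h n x \<partial>M) \<longlonglongrightarrow> (\<integral>x. g x \<bullet> k x \<partial>M)"
proof -
  note fg = L2_limD[OF assms(1)] and hk = L2_limD[OF assms(2)]
  let ?d = "\<lambda>n. \<integral>x. (f n x - g x) \<bullet> (h n x - k x) \<partial>M"
  have "\<forall>\<^sub>F n in sequentially. norm ((?d n)\<^sup>2) \<le>
      (sqnorm (\<lambda>x. f n x - g x)) * (sqnorm (\<lambda>x. h n x - k x))"
    using L2_Cauchy_Schwarz[OF L2_diff[OF fg(1,2)] L2_diff[OF hk(1,2)]]
    by (simp only: real_norm_def abs_power2 eventually_True)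
  then have "(\<lambda>n. (?d n)\<^sup>2) \<longlonglongrightarrow> 0"
    by (rule Lim_null_comparison) (rule tendsto_mult_zero[OF fg(3) hk(3)])
  then have "?d \<longlonglongrightarrow> 0" by (rule power2_tendsto_0_imp)
  from tendsto_diff[OF tendsto_add[OF tendsto_add[OF this L2_lim_inner_0[OF assms(1) hk(2)]]
        L2_lim_inner_0[OF assms(2) fg(2)]] tendsto_const[of "\<integral>x. g x \<bullet> k x \<partial>M"]]
  have "(\<lambda>n. ?d n + (\<integral>x. f n x \<bullet> k x \<partial>M) + (\<integral>x. h n x \<bullet> g x \<partial>M) - (\<integral>x. g x \<bullet> k x \<partial>M))
      \<longlonglongrightarrow> (\<integral>x. g x \<bullet> k x \<partial>M)"
    by (simp add: inner_commute[of "k _"])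
  moreover have "?d n + (\<integral>x. f n x \<bullet> k x \<partial>M) + (\<integral>x. h n x \<bullet> g x \<partial>M) - (\<integral>x. g x \<bullet> k x \<partial>M) =
      (\<integral>x. f n x \<bullet> h n x \<partial>M)" for n
    using L2_inner_integrable[OF fg(1) hk(1)] L2_inner_integrable[OF fg(1) hk(2)]
      L2_inner_integrable[OF fg(2) hk(1)] L2_inner_integrable[OF fg(2) hk(2)]
    by (simp add: inner_diff_left inner_diff_right inner_commute[of "h _ _" "g _"])
  ultimately show ?thesis by simp
qed

lemma L2_lim_mult:
  "L2_lim f g \<Longrightarrow> L2_lim h k \<Longrightarrow> (\<lambda>n. \<integral>x. f n x * h n x \<partial>M) \<longlonglongrightarrow> (\<integral>x. g x * k x \<partial>M :: real)"
  using L2_lim_inner[of f g h k] by simp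

text \<open>The squared distances tend to 0 in L1, which yields an almost everywhere convergent
  subsequence. The chain rule needs it to pass to the limit inside \<open>flat'\<close>.\<close>

lemma L2_lim_AE_subseq:
  assumes "L2_lim f g"
  obtains r where "strict_mono r" "AE x in M. (\<lambda>n. f (r n) x) \<longlonglongrightarrow> g x"
proof -
  have "\<exists>r. strict_mono r \<and> (AE x in M. (\<lambda>n. (norm (f (r n) x - g x))\<^sup>2) \<longlonglongrightarrow> 0)"
  proof (rule tendsto_L1_AE_subseq)
    show "integrable M (\<lambda>x. (norm (f n x - g x))\<^sup>2)" for n
      by (rule L2D(2)[OF L2_diff[OF L2_limD(1,2)[OF assms]]])
    show "(\<lambda>n. \<integral>x. norm ((norm (f n x - g x))\<^sup>2) \<partial>M) \<longlonglongrightarrow> 0"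
      using L2_limD(3)[OF assms] by (simp only: real_norm_def abs_power2)
  qed
  then obtain r where r: "strict_mono r" "AE x in M. (\<lambda>n. (norm (f (r n) x - g x))\<^sup>2) \<longlonglongrightarrow> 0"
    by (elim exE conjE)
  have "AE x in M. (\<lambda>n. f (r n) x) \<longlonglongrightarrow> g x"
    using r(2)
  proof eventually_elim
    case (elim x)
    then have "(\<lambda>n. norm (f (r n) x - g x)) \<longlonglongrightarrow> 0"
      by (rule power2_tendsto_0_imp)
    then show ?case by (simp add: tendsto_norm_zero_iff LIM_zero_iff)
  qed
  with r(1) show ?thesis by (rule that)
qed

end

section \<open>Completeness of the space of square-integrable functions\<close>

lemma geometric_increments_convergent:
  fixes a :: "nat \<Rightarrow> 'b::banach"
  assumes "\<And>k. 4 ^ k * (norm (a (Suc k) - a k))\<^sup>2 \<le> C"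
  shows "convergent a"
proof -
  have C: "0 \<le> C" using order_trans[OF _ assms[of 0]] by simp
  \<comment> \<open>The weight 4^k on the squares becomes 2^k on the increments, which are therefore
    dominated by a geometric series.\<close>
  have "norm (a (Suc k) - a k) \<le> sqrt C * (1 / 2) ^ k" for k
  proof -
    have "((2::real) ^ k)\<^sup>2 = 4 ^ k"
      by (simp add: power2_eq_square flip: power_mult_distrib)
    then have "(2 ^ k * norm (a (Suc k) - a k))\<^sup>2 \<le> C"
      using assms[of k] by (simp add: power_mult_distrib)
    then have "2 ^ k * norm (a (Suc k) - a k) \<le> sqrt C"
      by (rule real_le_rsqrt)
    then show ?thesis by (simp add: power_divide divide_simps mult.commute)
  qed
  moreover have "summable (\<lambda>k. sqrt C * (1 / 2) ^ k)"
    by (rule summable_mult[OF summable_geometric]) simp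
  ultimately have "summable (\<lambda>k. a (Suc k) - a k)"
    by (rule summable_comparison_test'[rotated])
  then have "convergent (\<lambda>n. \<Sum>k<n. a (Suc k) - a k)"
    by (simp add: summable_iff_convergent)
  then have "convergent (\<lambda>n. (\<Sum>k<n. a (Suc k) - a k) + a 0)"
    by (rule convergent_add[OF _ convergent_const])
  then show ?thesis by (simp add: sum_lessThan_telescope)
qed

context bounded_open
begin

lemma nn_integral_norm_power2:
  "f \<in> L2 \<Omega> \<Longrightarrow> (\<integral>\<^sup>+x. ennreal ((norm (f x))\<^sup>2) \<partial>M) = ennreal (sqnorm f)"
  by (rule nn_integral_eq_integral[OF L2D(2)]) simp_all

lemma L2_nn_integralI:
  assumes "f \<in> borel_measurable M" "(\<integral>\<^sup>+x. ennreal ((norm (f x))\<^sup>2) \<partial>M) \<le> ennreal C"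
  shows "f \<in> L2 \<Omega>"
proof (rule L2I[OF assms(1)], rule integrableI_bounded)
  show "(\<lambda>x. (norm (f x))\<^sup>2) \<in> borel_measurable M"
    using assms(1) by measurable
  show "(\<integral>\<^sup>+x. ennreal (norm ((norm (f x))\<^sup>2)) \<partial>M) < \<infinity>"
    using le_less_trans[OF assms(2) ennreal_less_top] by simp
qed

text \<open>Riesz-Fischer. A rapidly Cauchy subsequence converges almost everywhere to some
  \<open>g\<close>; Fatou's lemma then bounds the distance from every late \<open>f n\<close> to
  \<open>g\<close>, so the whole sequence converges.\<close>

lemma L2_complete:
  fixes f :: "nat \<Rightarrow> 'a \<Rightarrow> 'b::euclidean_space"
  assumes f: "\<And>n. f n \<in> L2 \<Omega>"
    and Cauchy: "\<And>e. 0 < e \<Longrightarrow> \<exists>N. \<forall>m\<ge>N. \<forall>n\<ge>N. (sqnorm (\<lambda>x. f m x - f n x)) < e"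
  obtains g where "L2_lim f g"
proof -
  \<comment> \<open>The rate 8^(-k) leaves the summable (1/2)^k after multiplication by the weight
    4^k in \<open>d\<close>.\<close>
  have "\<forall>k. \<exists>N. \<forall>m\<ge>N. \<forall>n\<ge>N. (sqnorm (\<lambda>x. f m x - f n x)) < (1 / 8) ^ k"
    by (intro allI Cauchy) simp
  then obtain N where N: "\<And>k m n. N k \<le> m \<Longrightarrow> N k \<le> n \<Longrightarrow> (sqnorm (\<lambda>x. f m x - f n x)) < (1 / 8) ^ k"
    by metis
  \<comment> \<open>The sum makes both \<open>r k\<close> and \<open>r (Suc k)\<close> at least
    \<open>N k\<close> without arranging \<open>N\<close> to be monotone; the summand
    \<open>k\<close> drives \<open>r\<close> to infinity.\<close>
  define r where "r k = k + (\<Sum>i\<le>k. N i)" for k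
  have r_ge: "N k \<le> r k" "k \<le> r k" for k
    using member_le_sum[of k "{..k}" N] by (auto simp: r_def)
  have r_Suc: "N k \<le> r (Suc k)" for k
    using r_ge(1)[of k] by (simp add: r_def)
  have fm: "f n \<in> borel_measurable M" for n by (rule L2_measurable[OF f])
  define d where "d k x = 4 ^ k * (norm (f (r (Suc k)) x - f (r k) x))\<^sup>2" for k x
  have d_meas: "(\<lambda>x. ennreal (d k x)) \<in> borel_measurable M" for k
    unfolding d_def using fm by measurable
  have d_int: "(\<integral>\<^sup>+x. ennreal (d k x) \<partial>M) \<le> ennreal ((1 / 2) ^ k)" for k
  proof -
    have i: "integrable M (\<lambda>x. (norm (f (r (Suc k)) x - f (r k) x))\<^sup>2)"
      by (rule L2D(2)[OF L2_diff[OF f f]])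
    have "(\<integral>\<^sup>+x. ennreal (d k x) \<partial>M) = ennreal (\<integral>x. d k x \<partial>M)"
      unfolding d_def using i by (intro nn_integral_eq_integral) simp_all
    also have "(\<integral>x. d k x \<partial>M) = 4 ^ k * (sqnorm (\<lambda>x. f (r (Suc k)) x - f (r k) x))"
      by (simp add: d_def)
    also have "\<dots> \<le> 4 ^ k * (1 / 8) ^ k"
      using N[OF r_Suc r_ge(1), of k] by (intro mult_left_mono) auto
    also have "\<dots> = (1 / 2) ^ k" by (simp flip: power_mult_distrib)
    finally show ?thesis by (simp add: ennreal_leI)
  qed
  have "(\<integral>\<^sup>+x. (\<Sum>k. ennreal (d k x)) \<partial>M) = (\<Sum>k. \<integral>\<^sup>+x. ennreal (d k x) \<partial>M)"
    by (rule nn_integral_suminf[OF d_meas])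
  also have "\<dots> \<le> (\<Sum>k. ennreal ((1 / 2) ^ k))"
    by (rule suminf_le[OF d_int summableI summableI])
  also have "\<dots> = ennreal (\<Sum>k. (1 / 2) ^ k)"
    by (rule suminf_ennreal2[OF _ summable_geometric]) simp_all
  finally have "(\<integral>\<^sup>+x. (\<Sum>k. ennreal (d k x)) \<partial>M) \<noteq> \<infinity>"
    using ennreal_less_top le_less_trans by (metis infinity_ennreal_def less_irrefl)
  then have "AE x in M. (\<Sum>k. ennreal (d k x)) \<noteq> \<infinity>"
    by (rule nn_integral_PInf_AE[OF borel_measurable_suminf_order[OF d_meas]])
  then have conv: "AE x in M. convergent (\<lambda>k. f (r k) x)"
  proof eventually_elim
    case (elim x)
    then obtain C where C: "0 \<le> C" "(\<Sum>k. ennreal (d k x)) = ennreal C"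
      by (cases "(\<Sum>k. ennreal (d k x))") auto
    have "d k x \<le> C" for k
    proof -
      have "ennreal (d k x) \<le> (\<Sum>k. ennreal (d k x))"
        using sum_le_suminf[of "\<lambda>k. ennreal (d k x)" "{k}"] by (simp add: summableI)
      then show ?thesis using C by (simp add: ennreal_le_iff)
    qed
    then show ?case
      unfolding d_def by (rule geometric_increments_convergent)
  qed
  define g where "g x = lim (\<lambda>k. f (r k) x)" for x
  have gm: "g \<in> borel_measurable M"
    unfolding g_def using fm by (rule borel_measurable_lim_metric)
  have lim: "AE x in M. (\<lambda>k. f (r k) x) \<longlonglongrightarrow> g x"
    using conv by eventually_elim (simp add: g_def convergent_LIMSEQ_iff)
  have bound: "(\<integral>\<^sup>+x. ennreal ((norm (f n x - g x))\<^sup>2) \<partial>M) \<le> ennreal e"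
    if nM: "\<And>m k. N' \<le> m \<Longrightarrow> N' \<le> k \<Longrightarrow> (sqnorm (\<lambda>x. f m x - f k x)) < e" "N' \<le> n" for n e N'
  proof -
    have "(\<integral>\<^sup>+x. ennreal ((norm (f n x - g x))\<^sup>2) \<partial>M) =
        (\<integral>\<^sup>+x. liminf (\<lambda>k. ennreal ((norm (f n x - f (r k) x))\<^sup>2)) \<partial>M)"
    proof (rule nn_integral_cong_AE)
      show "AE x in M. ennreal ((norm (f n x - g x))\<^sup>2) = liminf (\<lambda>k. ennreal ((norm (f n x - f (r k) x))\<^sup>2))"
        using lim
      proof eventually_elim
        case (elim x)
        have "(\<lambda>k. ennreal ((norm (f n x - f (r k) x))\<^sup>2)) \<longlonglongrightarrow> ennreal ((norm (f n x - g x))\<^sup>2)"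
          by (intro tendsto_ennrealI tendsto_power tendsto_norm tendsto_diff tendsto_const elim)
        then show ?case
          by (intro lim_imp_Liminf[symmetric]) simp_all
      qed
    qed
    also have "\<dots> \<le> liminf (\<lambda>k. \<integral>\<^sup>+x. ennreal ((norm (f n x - f (r k) x))\<^sup>2) \<partial>M)"
      using fm by (intro nn_integral_liminf) measurable
    also have "\<dots> \<le> liminf (\<lambda>k. ennreal e)"
    proof (rule Liminf_mono)
      show "\<forall>\<^sub>F k in sequentially. (\<integral>\<^sup>+x. ennreal ((norm (f n x - f (r k) x))\<^sup>2) \<partial>M) \<le> ennreal e"
        using eventually_ge_at_top[of N']
      proof eventually_elim
        case (elim k)
        then have "(sqnorm (\<lambda>x. f n x - f (r k) x)) < e"
          using nM r_ge(2)[of k] by (meson order_trans)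
        then show ?case
          by (simp add: nn_integral_norm_power2[OF L2_diff[OF f f]] ennreal_leI)
      qed
    qed
    also have "\<dots> = ennreal e" by (simp add: Liminf_const)
    finally show ?thesis .
  qed
  have fg: "\<exists>N. \<forall>n\<ge>N. (\<lambda>x. f n x - g x) \<in> L2 \<Omega> \<and> (sqnorm (\<lambda>x. f n x - g x)) \<le> e" if "0 < e" for e
  proof -
    obtain N' where N': "\<forall>m\<ge>N'. \<forall>n\<ge>N'. (sqnorm (\<lambda>x. f m x - f n x)) < e"
      using Cauchy[OF \<open>0 < e\<close>] ..
    have "(\<lambda>x. f n x - g x) \<in> L2 \<Omega> \<and> (sqnorm (\<lambda>x. f n x - g x)) \<le> e" if "N' \<le> n" for n
    proof
      have b: "(\<integral>\<^sup>+x. ennreal ((norm (f n x - g x))\<^sup>2) \<partial>M) \<le> ennreal e"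
        by (rule bound[of N']) (use N' that in auto)
      show L: "(\<lambda>x. f n x - g x) \<in> L2 \<Omega>"
        by (rule L2_nn_integralI[OF _ b]) (intro borel_measurable_diff fm gm)
      show "(sqnorm (\<lambda>x. f n x - g x)) \<le> e"
        using b \<open>0 < e\<close> by (simp add: nn_integral_norm_power2[OF L] ennreal_le_iff)
    qed
    then show ?thesis by blast
  qed
  obtain n where "(\<lambda>x. f n x - g x) \<in> L2 \<Omega>" using fg[of 1] by auto
  \<comment> \<open>\<open>g\<close> is recovered as f n - (f n - g), a difference of two
    square-integrable functions.\<close>
  from L2_diff[OF f this, of n] have g: "g \<in> L2 \<Omega>" by simp
  have "(\<lambda>n. sqnorm (\<lambda>x. f n x - g x)) \<longlonglongrightarrow> 0"
  proof (rule LIMSEQ_I)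
    fix e :: real assume "0 < e"
    then obtain N' where "\<forall>n\<ge>N'. (sqnorm (\<lambda>x. f n x - g x)) \<le> e / 2"
      using fg[of "e / 2"] by auto
    then have "\<forall>n\<ge>N'. (sqnorm (\<lambda>x. f n x - g x)) < e"
      using \<open>0 < e\<close> by fastforce
    then show "\<exists>N. \<forall>n\<ge>N. norm ((sqnorm (\<lambda>x. f n x - g x)) - 0) < e"
      by auto
  qed
  then have "L2_lim f g" using f g by (simp add: L2_lim_def)
  then show ?thesis by (rule that)
qed

end

section \<open>Weak gradients\<close>

lemma integrable_on_subset:
  fixes f :: "'a::euclidean_space \<Rightarrow> 'b::euclidean_space"
  assumes "integrable (lebesgue_on S) f" "S \<in> sets lebesgue" "T \<in> sets lebesgue" "T \<subseteq> S"
  shows "integrable (lebesgue_on T) f"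
proof -
  have "set_integrable lebesgue S f"
    using assms(1,2) by (simp add: set_integrable_def integrable_restrict_space)
  then have "set_integrable lebesgue T f"
    using assms(3,4) by (rule set_integrable_subset)
  then show ?thesis
    using assms(3) by (simp add: set_integrable_def integrable_restrict_space)
qed

text \<open>A product of one-dimensional smooth cutoffs that get steeper as n grows. Testing with it
  produces integrals over boxes without any mollification.\<close>

definition box_bump :: "'a::euclidean_space \<Rightarrow> 'a \<Rightarrow> nat \<Rightarrow> 'a \<Rightarrow> real" where
  "box_bump a b n x = (\<Prod>i\<in>Basis. flat (real n * (x \<bullet> i - a \<bullet> i)) * flat (real n * (b \<bullet> i - x \<bullet> i)))"

lemma box_bump_outside:
  assumes "x \<notin> box a b" shows "box_bump a b n x = 0"
proof -
  obtain i where i: "i \<in> Basis" "x \<bullet> i \<le> a \<bullet> i \<or> b \<bullet> i \<le> x \<bullet> i"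
    using assms by (auto simp: mem_box not_less)
  then have "flat (real n * (x \<bullet> i - a \<bullet> i)) * flat (real n * (b \<bullet> i - x \<bullet> i)) = 0"
    by (auto simp: flat_nonpos_eq mult_nonneg_nonpos)
  with i(1) show ?thesis
    unfolding box_bump_def by (intro prod_zero) auto
qed

lemma box_bump_bounds: "0 \<le> box_bump a b n x" "box_bump a b n x \<le> 1"
  unfolding box_bump_def
  by (auto intro!: prod_nonneg prod_le_1 mult_nonneg_nonneg mult_le_one flat_nonneg flat_le_1)

lemma box_bump_tendsto:
  fixes x :: "'a::euclidean_space"
  shows "(\<lambda>n. box_bump a b n x) \<longlonglongrightarrow> indicator (box a b) x"
proof (cases "x \<in> box a b")
  case True
  have fl: "(\<lambda>n. flat (real n * c)) \<longlonglongrightarrow> 1" if "0 < c" for c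
    by (rule filterlim_compose[OF flat_tendsto_1])
       (rule filterlim_at_top_mult_tendsto_pos[OF tendsto_const that filterlim_real_sequentially])
  have "(\<lambda>n. box_bump a b n x) \<longlonglongrightarrow> (\<Prod>i\<in>(Basis :: 'a set). 1 * 1)"
    unfolding box_bump_def
    by (intro tendsto_prod tendsto_mult fl) (use True in \<open>auto simp: mem_box\<close>)
  then show ?thesis using True by simp
next
  case False
  then show ?thesis by (simp add: box_bump_outside)
qed

lemma box_bump_smooth: "C_k k (box_bump a b n)"
proof -
  have l: "C_k k (\<lambda>x. real n * (x \<bullet> i - a \<bullet> i))" for i
  proof -
    have "C_k k (\<lambda>x. real n * (x \<bullet> i + - (a \<bullet> i)))"
      by (intro C_k_mult C_k_add C_k_const C_k_linear bounded_linear_inner_left)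
    then show ?thesis by simp
  qed
  have r: "C_k k (\<lambda>x. real n * (b \<bullet> i - x \<bullet> i))" for i
  proof -
    have "C_k k (\<lambda>x. real n * (b \<bullet> i + (-1) * (x \<bullet> i)))"
      by (intro C_k_mult C_k_add C_k_const C_k_linear bounded_linear_inner_left)
    then show ?thesis by simp
  qed
  have "C_k k (\<lambda>x. box_bump a b n x)"
    unfolding box_bump_def by (intro C_k_prod C_k_mult C_k_flat l r finite_Basis)
  then show ?thesis .
qed

text \<open>Lebesgue differentiation: off a null set, f x is the limit of the averages over small
  cubes with lower corner x, and all these averages are 0.\<close>

lemma negligible_nonzero_cbox:
  fixes f :: "'a::euclidean_space \<Rightarrow> real"
  assumes f: "integrable (lebesgue_on (cbox a b)) f"
    and 0: "\<And>c d. cbox c d \<subseteq> cbox a b \<Longrightarrow> integral (cbox c d) f = 0"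
  shows "negligible {x \<in> cbox a b. f x \<noteq> 0}"
proof -
  \<comment> \<open>Extension by zero, since the differentiation theorem wants integrability on
    every box of the space.\<close>
  define F where "F x = (if x \<in> cbox a b then f x else 0)" for x
  have "integrable lebesgue F"
    unfolding F_def using f by (simp add: Lebesgue_Measure.integrable_restrict_UNIV)
  then have "F absolutely_integrable_on UNIV"
    by (simp add: set_integrable_def)
  then have "F integrable_on UNIV" by (rule set_lebesgue_integral_eq_integral(1))
  then have "F integrable_on cbox c d" for c d
    by (rule integrable_on_subcbox) simp
  from integrable_ccontinuous_explicit[OF this]
  have "\<exists>N. negligible N \<and> (\<forall>x e. x \<notin> N \<longrightarrow> 0 < e \<longrightarrow> (\<exists>d>0. \<forall>h. 0 < h \<and> h < d \<longrightarrow>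
      norm (integral (cbox x (x + h *\<^sub>R One)) F /\<^sub>R h ^ DIM('a) - F x) < e))"
    by metis
  then obtain N where N: "negligible N" "\<forall>x e. x \<notin> N \<longrightarrow> 0 < e \<longrightarrow> (\<exists>d>0. \<forall>h. 0 < h \<and> h < d \<longrightarrow>
      norm (integral (cbox x (x + h *\<^sub>R One)) F /\<^sub>R h ^ DIM('a) - F x) < e)"
    by blast
  have "f x = 0" if x: "x \<in> box a b" "x \<notin> N" for x
  proof (rule ccontr)
    assume "f x \<noteq> 0"
    then have "0 < \<bar>f x\<bar>" by simp
    with N(2) x(2) obtain d where d: "d > 0" "\<And>h. 0 < h \<Longrightarrow> h < d \<Longrightarrow>
        norm (integral (cbox x (x + h *\<^sub>R One)) F /\<^sub>R h ^ DIM('a) - F x) < \<bar>f x\<bar>"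
      by metis
    have "((\<lambda>h. x + h *\<^sub>R One) \<longlongrightarrow> x + 0 *\<^sub>R One) (at_right 0)"
      by (intro tendsto_intros)
    then have "\<forall>\<^sub>F h in at_right 0. x + h *\<^sub>R One \<in> box a b"
      by (rule topological_tendstoD) (use x in auto)
    moreover have "\<forall>\<^sub>F h in at_right 0. h < d"
      using d(1) eventually_at_right_field by blast
    moreover have "\<forall>\<^sub>F h in at_right 0. (0::real) < h"
      by (simp add: eventually_at_right_less)
    ultimately have "\<forall>\<^sub>F h in at_right 0. x + h *\<^sub>R One \<in> box a b \<and> h < d \<and> 0 < h"
      by (simp add: eventually_conj)
    then obtain h where h: "x + h *\<^sub>R One \<in> box a b" "h < d" "0 < h"
      using eventually_happens'[OF trivial_limit_at_right_real] by blast
    have sub: "cbox x (x + h *\<^sub>R One) \<subseteq> cbox a b"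
    proof
      fix y assume "y \<in> cbox x (x + h *\<^sub>R One)"
      then show "y \<in> cbox a b"
        using x(1) h(1) unfolding mem_box by (meson order_trans less_imp_le)
    qed
    have "integral (cbox x (x + h *\<^sub>R One)) F = integral (cbox x (x + h *\<^sub>R One)) f"
      by (rule Henstock_Kurzweil_Integration.integral_cong) (use sub in \<open>auto simp: F_def\<close>)
    also have "\<dots> = 0" by (rule 0[OF sub])
    finally have "norm (F x) < \<bar>f x\<bar>" using d(2)[OF h(3,2)] by simp
    moreover have "F x = f x" using x(1) box_subset_cbox by (auto simp: F_def)
    ultimately show False by simp
  qed
  \<comment> \<open>The argument covers the interior points; the faces of the box are
    negligible.\<close>
  then have "{x \<in> cbox a b. f x \<noteq> 0} \<subseteq> N \<union> (cbox a b - box a b)" by auto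
  then show ?thesis
    using N(1) negligible_frontier_interval negligible_Un negligible_subset by blast
qed

context bounded_open
begin

lemma integral_tgrad_eq_0:
  assumes d: "\<And>x. \<phi> differentiable (at x)" and c: "continuous_on UNIV (tgrad \<phi>)"
    and K: "{x. \<phi> x \<noteq> 0} \<subseteq> K" "compact K" "K \<subseteq> \<Omega>"
  shows "(\<integral>x. tgrad \<phi> x \<bullet> e \<partial>M) = 0"
proof -
  have "tgrad \<phi> x = 0" if "x \<notin> \<Omega>" for x
    using tgrad_eq_0_outside[OF K(1) compact_imp_closed[OF K(2)]] K(3) that by blast
  then have "(\<lambda>x. tgrad \<phi> x \<bullet> e) = (\<lambda>x. if x \<in> \<Omega> then tgrad \<phi> x \<bullet> e else 0)"
    by (simp add: fun_eq_iff)
  then have "(\<integral>x. tgrad \<phi> x \<bullet> e \<partial>M) = (\<integral>x. tgrad \<phi> x \<bullet> e \<partial>lebesgue)"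
    using Lebesgue_Measure.integral_restrict_UNIV[OF Omega_sets, of "\<lambda>x. tgrad \<phi> x \<bullet> e"] by simp
  also have "\<dots> = (\<integral>x. tgrad \<phi> x \<bullet> e \<partial>lborel)"
  proof (rule integral_completion)
    have "continuous_on UNIV (\<lambda>x. tgrad \<phi> x \<bullet> e)"
      using c by (intro continuous_on_inner continuous_on_const)
    then show "(\<lambda>x. tgrad \<phi> x \<bullet> e) \<in> borel_measurable lborel"
      by (simp add: borel_measurable_continuous_onI)
  qed
  also have "\<dots> = 0" by (rule integral_tgrad_lborel_eq_0[OF d c K(1,2)])
  finally show ?thesis .
qed

lemma test_functions_L2:
  assumes "\<phi> \<in> test_functions \<Omega>"
  shows "\<phi> \<in> L2 \<Omega>" "tgrad \<phi> \<in> L2 \<Omega>"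
  using test_functions_C1(2,3)[OF assms] by (auto intro: continuous_L2)

text \<open>The product of \<open>\<phi>\<close> with a smooth \<open>g\<close> inherits the compact
  support of \<open>\<phi>\<close>, so its gradient integrates to zero. Hence \<open>g\<close> may
  be a coordinate function, which is how the Poincare inequality arises.\<close>

lemma test_functions_integral_by_parts:
  assumes "\<phi> \<in> test_functions \<Omega>" "\<And>k. C_k k g"
  shows "(\<integral>x. \<phi> x * (tgrad g x \<bullet> e) \<partial>M) = - (\<integral>x. (tgrad \<phi> x \<bullet> e) * g x \<partial>M)"
proof -
  have m: "(\<lambda>x. g x * \<phi> x) \<in> test_functions \<Omega>"
    by (rule test_functions_mult_smooth[OF assms(2,1)])
  then obtain K where K: "\<forall>k. C_k k (\<lambda>x. g x * \<phi> x)" "{x. g x * \<phi> x \<noteq> 0} \<subseteq> K" "compact K" "K \<subseteq> \<Omega>"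
    by (rule test_functionsE)
  have g: "\<forall>k. C_k k g" using assms(2) by (rule allI)
  note g1 = C_k_imp_C1[OF g]
  note \<phi>L = test_functions_L2[OF assms(1)]
  note gL = continuous_L2[OF g1(2)] continuous_L2[OF g1(3)]
  have tg: "tgrad (\<lambda>x. g x * \<phi> x) x \<bullet> e = (tgrad \<phi> x \<bullet> e) * g x + \<phi> x * (tgrad g x \<bullet> e)" for x
    unfolding tgrad_mult[OF g1(1) test_functions_C1(1)[OF assms(1)]] inner_add_left inner_scaleR_left
    by (simp only: mult.commute)
  have "0 = (\<integral>x. tgrad (\<lambda>x. g x * \<phi> x) x \<bullet> e \<partial>M)"
    by (rule integral_tgrad_eq_0[OF test_functions_C1(1)[OF m] test_functions_C1(3)[OF m] K(2-4), symmetric])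
  also have "\<dots> = (\<integral>x. (tgrad \<phi> x \<bullet> e) * g x + \<phi> x * (tgrad g x \<bullet> e) \<partial>M)"
    by (simp only: tg)
  also have "\<dots> = (\<integral>x. (tgrad \<phi> x \<bullet> e) * g x \<partial>M) + (\<integral>x. \<phi> x * (tgrad g x \<bullet> e) \<partial>M)"
    by (intro Bochner_Integration.integral_add L2_mult_integrable L2_inner_const \<phi>L gL)
  finally show ?thesis by simp
qed

lemma L2_imp_L1loc:
  assumes "f \<in> L2 \<Omega>" shows "f \<in> L1loc \<Omega>"
  unfolding L1loc_def
proof (intro CollectI allI impI)
  fix K assume K: "compact K" "K \<subseteq> \<Omega>"
  show "integrable (lebesgue_on K) f"
    by (rule integrable_on_subset[OF L2_integrable[OF assms] Omega_sets _ K(2)])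
       (use K(1) in \<open>simp add: fmeasurableD lmeasurable_compact\<close>)
qed

text \<open>A function in \<open>L1loc\<close> may fail to be integrable over \<Omega>. A continuous
  weight that vanishes off a compact subset repairs this, so that the integrals defining weak
  gradients may be split.\<close>

lemma integrable_compact_support:
  fixes f :: "'a \<Rightarrow> 'b::euclidean_space"
  assumes "f \<in> L1loc \<Omega>" "continuous_on UNIV w"
    and K: "\<And>x. x \<notin> K \<Longrightarrow> w x = 0" "compact K" "K \<subseteq> \<Omega>"
  shows "integrable M (\<lambda>x. w x *\<^sub>R f x)"
proof -
  have Ks: "K \<in> sets lebesgue"
    using K(2) by (simp add: fmeasurableD lmeasurable_compact)
  have fK: "integrable (lebesgue_on K) f"
    using assms(1) K(2,3) unfolding L1loc_def by blast
  have wm: "w \<in> borel_measurable (lebesgue_on K)"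
    using assms(2) Ks by (intro continuous_imp_measurable_on_sets_lebesgue) (auto intro: continuous_on_subset)
  obtain B where B: "\<forall>x\<in>\<Omega>. norm (w x) \<le> B"
    using continuous_bounded[OF assms(2)] .
  have "integrable (lebesgue_on K) (\<lambda>x. w x *\<^sub>R f x)"
  proof (rule Bochner_Integration.integrable_bound)
    show "integrable (lebesgue_on K) (\<lambda>x. B * norm (f x))"
      using fK by (intro integrable_mult_right integrable_norm)
    show "(\<lambda>x. w x *\<^sub>R f x) \<in> borel_measurable (lebesgue_on K)"
      using wm borel_measurable_integrable[OF fK] by (rule borel_measurable_scaleR)
    show "AE x in lebesgue_on K. norm (w x *\<^sub>R f x) \<le> norm (B * norm (f x))"
    proof (rule AE_I2)
      fix x assume "x \<in> space (lebesgue_on K)"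
      then have "x \<in> \<Omega>" using K(3) by auto
      then have "\<bar>w x\<bar> \<le> \<bar>B\<bar>" using B by fastforce
      then show "norm (w x *\<^sub>R f x) \<le> norm (B * norm (f x))"
        by (auto simp: abs_mult intro: mult_right_mono)
    qed
  qed
  then have "integrable lebesgue (\<lambda>x. if x \<in> K then w x *\<^sub>R f x else 0)"
    by (simp add: Lebesgue_Measure.integrable_restrict_UNIV[OF Ks])
  moreover have "(\<lambda>x. if x \<in> K then w x *\<^sub>R f x else 0) = (\<lambda>x. if x \<in> \<Omega> then w x *\<^sub>R f x else 0)"
    using K(1,3) by (auto simp: fun_eq_iff)
  ultimately show ?thesis
    by (simp add: Lebesgue_Measure.integrable_restrict_UNIV[OF Omega_sets])
qed

subsection \<open>The fundamental lemma of the calculus of variations\<close>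

lemma box_bump_test_function:
  assumes "cbox a b \<subseteq> \<Omega>" shows "box_bump a b n \<in> test_functions \<Omega>"
proof (rule test_functionsI[OF box_bump_smooth _ compact_cbox assms])
  have "x \<in> box a b" if "box_bump a b n x \<noteq> 0" for x
    using box_bump_outside that by blast
  then show "{x. box_bump a b n x \<noteq> 0} \<subseteq> cbox a b"
    using box_subset_cbox by blast
qed

text \<open>The bumps on the box are test functions bounded by 1 and converge to the indicator of
  the open box, whose boundary is null; |f| is integrable on the closed box and dominates.\<close>

lemma integral_box_eq_0:
  assumes f: "f \<in> L1loc \<Omega>" and t: "\<And>\<phi>. \<phi> \<in> test_functions \<Omega> \<Longrightarrow> (\<integral>x. \<phi> x * f x \<partial>M) = (0::real)"
    and C: "cbox a b \<subseteq> \<Omega>"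
  shows "integral (cbox a b) f = 0"
proof -
  have Cs: "cbox a b \<in> sets lebesgue" by simp
  have fC: "integrable (lebesgue_on (cbox a b)) f"
    using f C compact_cbox unfolding L1loc_def by blast
  have bm: "box_bump a b n \<in> borel_measurable (lebesgue_on (cbox a b))" for n
    using test_functions_C1(2)[OF box_bump_test_function[OF C]] Cs
    by (intro continuous_imp_measurable_on_sets_lebesgue) (auto intro: continuous_on_subset)
  have "(\<integral>x. box_bump a b n x * f x \<partial>lebesgue_on (cbox a b)) = 0" for n
  proof -
    have "(\<integral>x. box_bump a b n x * f x \<partial>lebesgue_on (cbox a b)) =
        (\<integral>x. (if x \<in> cbox a b then box_bump a b n x * f x else 0) \<partial>M)"
      by (rule Lebesgue_Measure.integral_restrict[OF C Cs Omega_sets, symmetric])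
    also have "(\<lambda>x. if x \<in> cbox a b then box_bump a b n x * f x else 0) = (\<lambda>x. box_bump a b n x * f x)"
    proof
      fix x
      show "(if x \<in> cbox a b then box_bump a b n x * f x else 0) = box_bump a b n x * f x"
        using box_bump_outside[of x a b n] box_subset_cbox[of a b] by (cases "x \<in> cbox a b") auto
    qed
    finally show ?thesis by (simp add: t[OF box_bump_test_function[OF C]])
  qed
  moreover have "(\<lambda>n. \<integral>x. box_bump a b n x * f x \<partial>lebesgue_on (cbox a b))
      \<longlonglongrightarrow> (\<integral>x. indicator (box a b) x * f x \<partial>lebesgue_on (cbox a b))"
  proof (rule integral_dominated_convergence[where w = "\<lambda>x. norm (f x)"])
    have "indicator (box a b) \<in> borel_measurable (lebesgue_on (cbox a b))"
      using box_subset_cbox[of a b] by (intro borel_measurable_indicator) (simp add: sets_restrict_space_iff)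
    then show "(\<lambda>x. indicator (box a b) x * f x) \<in> borel_measurable (lebesgue_on (cbox a b))"
      using borel_measurable_integrable[OF fC] by (rule borel_measurable_times)
    show "(\<lambda>x. box_bump a b n x * f x) \<in> borel_measurable (lebesgue_on (cbox a b))" for n
      using bm borel_measurable_integrable[OF fC] by (rule borel_measurable_times)
    show "integrable (lebesgue_on (cbox a b)) (\<lambda>x. norm (f x))"
      using fC by (rule integrable_norm)
    show "AE x in lebesgue_on (cbox a b). (\<lambda>n. box_bump a b n x * f x) \<longlonglongrightarrow> indicator (box a b) x * f x"
      by (intro AE_I2 tendsto_mult box_bump_tendsto tendsto_const)
    have "norm (box_bump a b n x * f x) \<le> norm (f x)" for n x
      using mult_right_mono[OF box_bump_bounds(2)[of a b n x], of "\<bar>f x\<bar>"] box_bump_bounds(1)[of a b n x]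
      by (simp add: abs_mult)
    then show "AE x in lebesgue_on (cbox a b). norm (box_bump a b n x * f x) \<le> norm (f x)" for n
      by (intro AE_I2)
  qed
  ultimately have "(\<integral>x. indicator (box a b) x * f x \<partial>lebesgue_on (cbox a b)) = 0"
    by (simp add: LIMSEQ_const_iff)
  moreover have "(\<integral>x. indicator (box a b) x * f x \<partial>lebesgue_on (cbox a b)) = (\<integral>x. f x \<partial>lebesgue_on (box a b))"
  proof -
    have "(\<lambda>x. indicator (box a b) x * f x) = (\<lambda>x. if x \<in> box a b then f x else 0)"
      by (simp add: fun_eq_iff indicator_def)
    then show ?thesis
      using Lebesgue_Measure.integral_restrict[OF box_subset_cbox[of a b] _ Cs, of f] by simp
  qed
  moreover have "(\<integral>x. f x \<partial>lebesgue_on (box a b)) = integral (box a b) f"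
    by (rule lebesgue_integral_eq_integral[OF integrable_on_subset[OF fC Cs _ box_subset_cbox]]) simp_all
  moreover have "integral (cbox a b) f = integral (box a b) f"
  proof (rule integral_spike_set)
    show "negligible {x \<in> cbox a b - box a b. f x \<noteq> 0}"
      by (rule negligible_subset[OF negligible_frontier_interval[of a b]]) auto
    show "negligible {x \<in> box a b - cbox a b. f x \<noteq> 0}"
      using box_subset_cbox[of a b] by (intro negligible_subset[OF negligible_empty]) auto
  qed
  ultimately show ?thesis by simp
qed

text \<open>\<Omega> is a countable union of closed boxes, and on each of them the integrals over
  all subboxes vanish.\<close>

lemma AE_eq_0_if_test_integrals_eq_0:
  assumes f: "f \<in> L1loc \<Omega>" and t: "\<And>\<phi>. \<phi> \<in> test_functions \<Omega> \<Longrightarrow> (\<integral>x. \<phi> x * f x \<partial>M) = (0::real)"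
  shows "AE x in M. f x = 0"
proof -
  obtain \<D> where D: "countable \<D>" "\<D> \<subseteq> Pow \<Omega>" "\<And>X. X \<in> \<D> \<Longrightarrow> \<exists>a b. X = cbox a b" "\<Union>\<D> = \<Omega>"
    using open_countable_Union_open_cbox[OF open_Omega] by metis
  have "negligible {x \<in> X. f x \<noteq> 0}" if "X \<in> \<D>" for X
  proof -
    obtain a b where X: "X = cbox a b" using D(3)[OF \<open>X \<in> \<D>\<close>] by blast
    then have C: "cbox a b \<subseteq> \<Omega>" using D(2) \<open>X \<in> \<D>\<close> by blast
    then have "integrable (lebesgue_on (cbox a b)) f"
      using f compact_cbox unfolding L1loc_def by blast
    then show ?thesis
      unfolding X
      by (rule negligible_nonzero_cbox) (use C integral_box_eq_0[OF f t] in blast)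
  qed
  then have "negligible (\<Union>X\<in>\<D>. {x \<in> X. f x \<noteq> 0})"
    using D(1) by (intro negligible_countable_Union) auto
  moreover have "{x \<in> \<Omega>. f x \<noteq> 0} \<subseteq> (\<Union>X\<in>\<D>. {x \<in> X. f x \<noteq> 0})"
    using D(4) by blast
  ultimately have "{x \<in> \<Omega>. f x \<noteq> 0} \<in> null_sets lebesgue"
    using negligible_subset negligible_iff_null_sets by blast
  then have "AE x in lebesgue. x \<in> \<Omega> \<longrightarrow> f x = 0"
    by (rule AE_I') auto
  then show ?thesis by (simp add: AE_restrict_space_iff)
qed

section \<open>Almost everywhere representatives and uniqueness of weak gradients\<close>

lemma measurable_AE_cong:
  fixes f g :: "'a \<Rightarrow> 'b::euclidean_space"
  assumes ae: "AE x in M. f x = g x" and g: "g \<in> borel_measurable M"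
  shows "f \<in> borel_measurable M"
proof -
  have "AE x in lebesgue. x \<in> \<Omega> \<longrightarrow> f x = g x"
    using ae by (simp add: AE_restrict_space_iff)
  \<comment> \<open>Lebesgue measure is complete, so a change on a negligible set preserves
    measurability. The representative chosen by \<open>wgrad\<close> calls for this.\<close>
  then have N: "negligible {x. \<not> (x \<in> \<Omega> \<longrightarrow> f x = g x)}"
    by (simp add: completion.AE_iff_null_sets negligible_iff_null_sets)
  have "g measurable_on \<Omega>"
    using g by (simp add: measurable_on_iff_borel_measurable)
  then have "f measurable_on \<Omega>"
    by (rule measurable_on_spike[OF _ N]) auto
  then show ?thesis by (simp add: measurable_on_iff_borel_measurable)
qed

lemma L2_AE_cong:
  assumes "AE x in M. f x = g x" "g \<in> L2 \<Omega>" shows "f \<in> L2 \<Omega>"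
proof (rule L2_bound[OF measurable_AE_cong[OF assms(1) L2_measurable[OF assms(2)]] assms(2)])
  show "AE x in M. norm (f x) \<le> 1 * norm (g x)"
    using assms(1) by eventually_elim simp
qed

text \<open>The fundamental lemma is applied to each component of the difference. Letting
  \<open>u\<close> and \<open>v\<close> agree only almost everywhere makes the lemma serve twice:
  for independence of the chosen representative, and for a vanishing gradient when the function is
  zero almost everywhere.\<close>

lemma has_weak_gradient_AE_unique:
  assumes u: "has_weak_gradient \<Omega> u g" and v: "has_weak_gradient \<Omega> v h"
    and uv: "AE x in M. u x = v x"
  shows "AE x in M. g x = h x"
proof -
  have L: "u \<in> L1loc \<Omega>" "v \<in> L1loc \<Omega>" "g \<in> L1loc \<Omega>" "h \<in> L1loc \<Omega>"
    using u v unfolding has_weak_gradient_def by blast+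
  have "AE x in M. g x \<bullet> i - h x \<bullet> i = 0" if i: "i \<in> Basis" for i
  proof (rule AE_eq_0_if_test_integrals_eq_0)
    show "(\<lambda>x. g x \<bullet> i - h x \<bullet> i) \<in> L1loc \<Omega>"
      using L(3,4) unfolding L1loc_def
      by (auto intro!: Bochner_Integration.integrable_diff integrable_inner_left)
    fix \<phi> assume \<phi>: "\<phi> \<in> test_functions \<Omega>"
    then obtain K where K: "\<forall>k. C_k k \<phi>" "{x. \<phi> x \<noteq> 0} \<subseteq> K" "compact K" "K \<subseteq> \<Omega>"
      by (rule test_functionsE)
    note c = test_functions_C1(2,3)[OF \<phi>]
    have ci: "continuous_on UNIV (\<lambda>x. tgrad \<phi> x \<bullet> i)"
      by (intro continuous_on_inner c continuous_on_const)
    have K1: "x \<notin> K \<Longrightarrow> \<phi> x = 0" for x using K(2) by blast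
    have K2: "x \<notin> K \<Longrightarrow> tgrad \<phi> x \<bullet> i = 0" for x
      using tgrad_eq_0_outside[OF K(2) compact_imp_closed[OF K(3)]] by simp
    note ug = integrable_compact_support[OF L(1) ci K2 K(3,4)]
      integrable_compact_support[OF L(2) ci K2 K(3,4)]
    have gi: "integrable M (\<lambda>x. (g x \<bullet> i) * \<phi> x)" "integrable M (\<lambda>x. (h x \<bullet> i) * \<phi> x)"
      using integrable_inner_left[OF integrable_compact_support[OF L(3) c(1) K1 K(3,4)], of i]
        integrable_inner_left[OF integrable_compact_support[OF L(4) c(1) K1 K(3,4)], of i]
      by (simp_all add: mult.commute)
    have "(\<integral>x. (g x \<bullet> i) * \<phi> x \<partial>M) = - (\<integral>x. u x * (tgrad \<phi> x \<bullet> i) \<partial>M)"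
      using u \<phi> i by (simp add: has_weak_gradient_def tgrad_inner_Basis)
    also have "(\<integral>x. u x * (tgrad \<phi> x \<bullet> i) \<partial>M) = (\<integral>x. v x * (tgrad \<phi> x \<bullet> i) \<partial>M)"
    proof (rule integral_cong_AE)
      show "AE x in M. u x * (tgrad \<phi> x \<bullet> i) = v x * (tgrad \<phi> x \<bullet> i)"
        using uv by eventually_elim simp
    qed (use ug[THEN borel_measurable_integrable] in \<open>simp_all add: mult.commute\<close>)
    also have "- (\<integral>x. v x * (tgrad \<phi> x \<bullet> i) \<partial>M) = (\<integral>x. (h x \<bullet> i) * \<phi> x \<partial>M)"
      using v \<phi> i by (simp add: has_weak_gradient_def tgrad_inner_Basis)
    finally have eq: "(\<integral>x. (g x \<bullet> i) * \<phi> x \<partial>M) = (\<integral>x. (h x \<bullet> i) * \<phi> x \<partial>M)" .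
    have "(\<integral>x. \<phi> x * (g x \<bullet> i - h x \<bullet> i) \<partial>M) = (\<integral>x. (g x \<bullet> i) * \<phi> x - (h x \<bullet> i) * \<phi> x \<partial>M)"
      by (rule Bochner_Integration.integral_cong) (simp_all add: algebra_simps)
    also have "\<dots> = 0"
      using eq by (simp add: Bochner_Integration.integral_diff[OF gi])
    finally show "(\<integral>x. \<phi> x * (g x \<bullet> i - h x \<bullet> i) \<partial>M) = 0" .
  qed
  then have "AE x in M. \<forall>i\<in>Basis. g x \<bullet> i - h x \<bullet> i = 0"
    by (simp add: AE_finite_all[OF finite_Basis])
  then show ?thesis
    by eventually_elim (auto intro: euclidean_eqI)
qed

lemma has_weak_gradient_wgrad: "has_weak_gradient \<Omega> u g \<Longrightarrow> has_weak_gradient \<Omega> u (wgrad \<Omega> u)"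
  unfolding wgrad_def by (rule someI[where P = "has_weak_gradient \<Omega> u"])

lemma wgrad_AE_eq: "has_weak_gradient \<Omega> u g \<Longrightarrow> AE x in M. wgrad \<Omega> u x = g x"
  by (rule has_weak_gradient_AE_unique[OF has_weak_gradient_wgrad]) (assumption | simp)+

text \<open>Stands for \<open>u \<in> H1_0 \<Omega>\<close> together with an explicit gradient \<open>g\<close>, because \<open>wgrad \<Omega> u\<close> is
  only an unspecified representative.\<close>

definition H10_grad :: "('a \<Rightarrow> real) \<Rightarrow> ('a \<Rightarrow> 'a) \<Rightarrow> bool" where
  "H10_grad u g \<longleftrightarrow> (\<exists>\<phi>. (\<forall>n. \<phi> n \<in> test_functions \<Omega>) \<and> L2_lim \<phi> u \<and> L2_lim (\<lambda>n. tgrad (\<phi> n)) g)"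

lemma H10_gradE:
  assumes "H10_grad u g"
  obtains \<phi> where "\<forall>n. \<phi> n \<in> test_functions \<Omega>" "L2_lim \<phi> u" "L2_lim (\<lambda>n. tgrad (\<phi> n)) g"
  using assms unfolding H10_grad_def by (elim exE conjE)

lemma H10_gradI:
  "\<lbrakk>\<forall>n. \<phi> n \<in> test_functions \<Omega>; L2_lim \<phi> u; L2_lim (\<lambda>n. tgrad (\<phi> n)) g\<rbrakk> \<Longrightarrow> H10_grad u g"
  unfolding H10_grad_def by (intro exI[of _ \<phi>] conjI)

lemma H10_grad_L2:
  assumes "H10_grad u g" shows "u \<in> L2 \<Omega>" "g \<in> L2 \<Omega>"
  using H10_gradE[OF assms] L2_limD(2) by metis+

lemma H10_grad_test: "\<phi> \<in> test_functions \<Omega> \<Longrightarrow> H10_grad \<phi> (tgrad \<phi>)"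
  by (rule H10_gradI[of "\<lambda>_. \<phi>"]) (simp_all add: L2_lim_const test_functions_L2)

text \<open>The boundary term disappears because of \<open>u\<close> alone: its approximants have
  compact support, and their identity passes to the L2 limit for any smooth
  \<open>\<psi>\<close>.\<close>

lemma H10_grad_integral_by_parts_smooth:
  assumes "H10_grad u g" "\<And>k. C_k k \<psi>"
  shows "(\<integral>x. u x * (tgrad \<psi> x \<bullet> e) \<partial>M) = - (\<integral>x. (g x \<bullet> e) * \<psi> x \<partial>M)"
proof -
  obtain \<phi> where \<phi>: "\<forall>n. \<phi> n \<in> test_functions \<Omega>" "L2_lim \<phi> u" "L2_lim (\<lambda>n. tgrad (\<phi> n)) g"
    using assms(1) by (rule H10_gradE)
  have \<psi>: "\<forall>k. C_k k \<psi>" using assms(2) by (rule allI)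
  have "(\<lambda>n. \<integral>x. \<phi> n x * (tgrad \<psi> x \<bullet> e) \<partial>M) \<longlonglongrightarrow> (\<integral>x. u x * (tgrad \<psi> x \<bullet> e) \<partial>M)"
    by (intro L2_lim_mult \<phi> L2_lim_const L2_inner_const continuous_L2 C_k_imp_C1(3)[OF \<psi>])
  moreover have "(\<lambda>n. - (\<integral>x. (tgrad (\<phi> n) x \<bullet> e) * \<psi> x \<partial>M)) \<longlonglongrightarrow> - (\<integral>x. (g x \<bullet> e) * \<psi> x \<partial>M)"
    by (intro tendsto_minus L2_lim_mult L2_lim_inner_const \<phi> L2_lim_const continuous_L2 C_k_imp_C1(2)[OF \<psi>])
  moreover have "(\<integral>x. \<phi> n x * (tgrad \<psi> x \<bullet> e) \<partial>M) = - (\<integral>x. (tgrad (\<phi> n) x \<bullet> e) * \<psi> x \<partial>M)" for n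
    by (rule test_functions_integral_by_parts[OF \<phi>(1)[rule_format] assms(2)])
  ultimately show ?thesis by (simp add: LIMSEQ_unique)
qed

lemma H10_grad_has_weak_gradient:
  assumes "H10_grad u g" shows "has_weak_gradient \<Omega> u g"
  unfolding has_weak_gradient_def
proof (intro conjI ballI)
  show "u \<in> L1loc \<Omega>" "g \<in> L1loc \<Omega>"
    by (rule L2_imp_L1loc[OF H10_grad_L2(1)[OF assms]], rule L2_imp_L1loc[OF H10_grad_L2(2)[OF assms]])
  fix \<psi> i assume \<psi>: "\<psi> \<in> test_functions \<Omega>" and i: "i \<in> (Basis :: 'a set)"
  obtain K where "\<forall>k. C_k k \<psi>" "{x. \<psi> x \<noteq> 0} \<subseteq> K" "compact K" "K \<subseteq> \<Omega>"
    using \<psi> by (rule test_functionsE)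
  then have "(\<integral>x. u x * (tgrad \<psi> x \<bullet> i) \<partial>M) = - (\<integral>x. (g x \<bullet> i) * \<psi> x \<partial>M)"
    by (intro H10_grad_integral_by_parts_smooth[OF assms]) blast
  then show "(\<integral>x. u x * frechet_derivative \<psi> (at x) i \<partial>M) = - (\<integral>x. (g x \<bullet> i) * \<psi> x \<partial>M)"
    by (simp add: tgrad_inner_Basis[OF i])
qed

lemma H10_grad_wgrad_AE: "H10_grad u g \<Longrightarrow> AE x in M. wgrad \<Omega> u x = g x"
  by (rule wgrad_AE_eq[OF H10_grad_has_weak_gradient])

lemma H10_grad_unique:
  "H10_grad u g \<Longrightarrow> H10_grad v h \<Longrightarrow> AE x in M. u x = v x \<Longrightarrow> AE x in M. g x = h x"
  by (rule has_weak_gradient_AE_unique[OF H10_grad_has_weak_gradient H10_grad_has_weak_gradient])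

lemma H10_grad_add_scaled:
  assumes "H10_grad u g" "H10_grad v h"
  shows "H10_grad (\<lambda>x. u x + c * v x) (\<lambda>x. g x + c *\<^sub>R h x)"
proof -
  obtain \<phi> where \<phi>: "\<forall>n. \<phi> n \<in> test_functions \<Omega>" "L2_lim \<phi> u" "L2_lim (\<lambda>n. tgrad (\<phi> n)) g"
    using assms(1) by (rule H10_gradE)
  obtain \<psi> where \<psi>: "\<forall>n. \<psi> n \<in> test_functions \<Omega>" "L2_lim \<psi> v" "L2_lim (\<lambda>n. tgrad (\<psi> n)) h"
    using assms(2) by (rule H10_gradE)
  show ?thesis
  proof (rule H10_gradI[where \<phi> = "\<lambda>n x. \<phi> n x + c * \<psi> n x"])
    show "\<forall>n. (\<lambda>x. \<phi> n x + c * \<psi> n x) \<in> test_functions \<Omega>"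
      using \<phi>(1) \<psi>(1) by (simp add: test_functions_add_scaled)
    show "L2_lim (\<lambda>n x. \<phi> n x + c * \<psi> n x) (\<lambda>x. u x + c * v x)"
      using L2_lim_add[OF \<phi>(2) L2_lim_scaleR[OF \<psi>(2)]] by simp
    have "tgrad (\<lambda>x. \<phi> n x + c * \<psi> n x) = (\<lambda>x. tgrad (\<phi> n) x + c *\<^sub>R tgrad (\<psi> n) x)" for n
      by (rule ext, rule tgrad_add_scaled)
         (rule test_functions_C1(1)[OF \<phi>(1)[rule_format]] test_functions_C1(1)[OF \<psi>(1)[rule_format]])+
    then show "L2_lim (\<lambda>n. tgrad (\<lambda>x. \<phi> n x + c * \<psi> n x)) (\<lambda>x. g x + c *\<^sub>R h x)"
      using L2_lim_add[OF \<phi>(3) L2_lim_scaleR[OF \<psi>(3)]] by simp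
  qed
qed

lemma H10_grad_diff:
  "H10_grad u g \<Longrightarrow> H10_grad v h \<Longrightarrow> H10_grad (\<lambda>x. u x - v x) (\<lambda>x. g x - h x)"
  using H10_grad_add_scaled[of u g v h "-1"] by simp

lemma H10_grad_zero: "H10_grad (\<lambda>_. 0) (\<lambda>_. 0)"
proof -
  have "tgrad (\<lambda>_. 0 :: real) = (\<lambda>_. 0 :: 'a)"
    by (rule ext, rule tgrad_eqI) simp
  then show ?thesis using H10_grad_test[OF zero_test_function] by simp
qed

text \<open>Meant for a \<open>u\<close> in \<open>H1\<close> that is not yet known to be a limit
  with convergent gradients, so linearity is checked on the defining identities.\<close>

lemma has_weak_gradient_test_diff:
  assumes \<phi>: "\<phi> \<in> test_functions \<Omega>" and u: "u \<in> L2 \<Omega>" and g: "g \<in> L2 \<Omega>"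
    and w: "has_weak_gradient \<Omega> u g"
  shows "has_weak_gradient \<Omega> (\<lambda>x. \<phi> x - u x) (\<lambda>x. tgrad \<phi> x - g x)"
  unfolding has_weak_gradient_def
proof (intro conjI ballI)
  note \<phi>L = test_functions_L2[OF \<phi>]
  show "(\<lambda>x. \<phi> x - u x) \<in> L1loc \<Omega>" "(\<lambda>x. tgrad \<phi> x - g x) \<in> L1loc \<Omega>"
    by (intro L2_imp_L1loc L2_diff \<phi>L u g)+
  fix \<psi> i assume \<psi>: "\<psi> \<in> test_functions \<Omega>" and i: "i \<in> (Basis :: 'a set)"
  note \<psi>L = test_functions_L2[OF \<psi>]
  have 1: "(\<integral>x. \<phi> x * (tgrad \<psi> x \<bullet> i) \<partial>M) = - (\<integral>x. (tgrad \<phi> x \<bullet> i) * \<psi> x \<partial>M)"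
    using H10_grad_has_weak_gradient[OF H10_grad_test[OF \<phi>]] \<psi> i
    by (simp add: has_weak_gradient_def tgrad_inner_Basis)
  have 2: "(\<integral>x. u x * (tgrad \<psi> x \<bullet> i) \<partial>M) = - (\<integral>x. (g x \<bullet> i) * \<psi> x \<partial>M)"
    using w \<psi> i by (simp add: has_weak_gradient_def tgrad_inner_Basis)
  have "(\<integral>x. (\<phi> x - u x) * (tgrad \<psi> x \<bullet> i) \<partial>M) =
      (\<integral>x. \<phi> x * (tgrad \<psi> x \<bullet> i) \<partial>M) - (\<integral>x. u x * (tgrad \<psi> x \<bullet> i) \<partial>M)"
    unfolding left_diff_distrib
    by (intro Bochner_Integration.integral_diff L2_mult_integrable L2_inner_const \<phi>L \<psi>L u)
  moreover have "(\<integral>x. ((tgrad \<phi> x - g x) \<bullet> i) * \<psi> x \<partial>M) =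
      (\<integral>x. (tgrad \<phi> x \<bullet> i) * \<psi> x \<partial>M) - (\<integral>x. (g x \<bullet> i) * \<psi> x \<partial>M)"
    unfolding inner_diff_left left_diff_distrib
    by (intro Bochner_Integration.integral_diff L2_mult_integrable L2_inner_const \<phi>L \<psi>L g)
  ultimately show "(\<integral>x. (\<phi> x - u x) * frechet_derivative \<psi> (at x) i \<partial>M) =
      - (\<integral>x. ((tgrad \<phi> x - g x) \<bullet> i) * \<psi> x \<partial>M)"
    using 1 2 by (simp add: tgrad_inner_Basis[OF i])
qed

text \<open>\<open>H1_norm\<close> is defined through the unspecified \<open>wgrad\<close> of the
  difference; uniqueness of weak gradients replaces it by the explicit one, and the norm splits into
  two L2 distances.\<close>

lemma H1_norm_test_diff:
  assumes "\<phi> \<in> test_functions \<Omega>" "u \<in> L2 \<Omega>" "g \<in> L2 \<Omega>" "has_weak_gradient \<Omega> u g"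
  shows "(H1_norm \<Omega> (\<lambda>x. \<phi> x - u x))\<^sup>2 =
    (sqnorm (\<lambda>x. \<phi> x - u x)) + (sqnorm (\<lambda>x. tgrad \<phi> x - g x))"
proof -
  let ?w = "wgrad \<Omega> (\<lambda>x. \<phi> x - u x)"
  note hw = has_weak_gradient_test_diff[OF assms]
  have ae: "AE x in M. ?w x = tgrad \<phi> x - g x"
    by (rule wgrad_AE_eq[OF hw])
  note \<phi>L = test_functions_L2[OF assms(1)]
  have i1: "integrable M (\<lambda>x. (norm (\<phi> x - u x))\<^sup>2)"
    by (rule L2_square_integrable[OF L2_diff[OF \<phi>L(1) assms(2)]])
  have gL: "(\<lambda>x. tgrad \<phi> x - g x) \<in> L2 \<Omega>"
    by (rule L2_diff[OF \<phi>L(2) assms(3)])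
  note i2 = L2_square_integrable[OF gL]
  have wL: "?w \<in> L2 \<Omega>"
    by (rule L2_AE_cong[OF ae gL])
  have "0 \<le> (\<integral>x. (\<phi> x - u x)\<^sup>2 + (norm (?w x))\<^sup>2 \<partial>M)" by simp
  then have "(H1_norm \<Omega> (\<lambda>x. \<phi> x - u x))\<^sup>2 = (\<integral>x. (norm (\<phi> x - u x))\<^sup>2 + (norm (?w x))\<^sup>2 \<partial>M)"
    unfolding H1_norm_def by simp
  also have "\<dots> = (sqnorm (\<lambda>x. \<phi> x - u x)) + (sqnorm ?w)"
    by (rule Bochner_Integration.integral_add[OF i1 L2_square_integrable[OF wL]])
  also have "(sqnorm ?w) = (sqnorm (\<lambda>x. tgrad \<phi> x - g x))"
  proof (rule integral_cong_AE)
    show "AE x in M. (norm (?w x))\<^sup>2 = (norm (tgrad \<phi> x - g x))\<^sup>2"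
      using ae by eventually_elim simp
  qed (rule borel_measurable_integrable[OF L2_square_integrable[OF wL]], rule borel_measurable_integrable[OF i2])
  finally show ?thesis .
qed

text \<open>The bridge between the norm closure that defines \<open>H1_0\<close> and pairs of L2
  limits. Forwards, each of the two L2 distances is bounded by the squared norm; backwards, they add
  up to it.\<close>

lemma H1_0_iff: "u \<in> H1_0 \<Omega> \<longleftrightarrow> (\<exists>g. H10_grad u g)"
proof
  assume "u \<in> H1_0 \<Omega>"
  then have "u \<in> H1 \<Omega>" and ex: "\<exists>\<phi>. (\<forall>n. \<phi> n \<in> test_functions \<Omega>) \<and>
      (\<lambda>n. H1_norm \<Omega> (\<lambda>x. \<phi> n x - u x)) \<longlonglongrightarrow> 0"
    by (simp_all add: H1_0_def)
  then obtain g where u: "u \<in> L2 \<Omega>" and g: "g \<in> L2 \<Omega>" "has_weak_gradient \<Omega> u g"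
    by (auto simp: H1_def)
  from ex obtain \<phi> where \<phi>: "\<forall>n. \<phi> n \<in> test_functions \<Omega>"
      "(\<lambda>n. H1_norm \<Omega> (\<lambda>x. \<phi> n x - u x)) \<longlonglongrightarrow> 0"
    by (elim exE conjE)
  note eq = H1_norm_test_diff[OF \<phi>(1)[rule_format] u g]
  have lim: "(\<lambda>n. (H1_norm \<Omega> (\<lambda>x. \<phi> n x - u x))\<^sup>2) \<longlonglongrightarrow> 0"
    using tendsto_power[OF \<phi>(2), of 2] by simp
  have "(\<lambda>n. sqnorm (\<lambda>x. \<phi> n x - u x)) \<longlonglongrightarrow> 0"
    by (rule Lim_null_comparison[OF always_eventually lim]) (simp add: eq)
  moreover have "(\<lambda>n. sqnorm (\<lambda>x. tgrad (\<phi> n) x - g x)) \<longlonglongrightarrow> 0"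
    by (rule Lim_null_comparison[OF always_eventually lim]) (simp add: eq)
  ultimately have "L2_lim \<phi> u" "L2_lim (\<lambda>n. tgrad (\<phi> n)) g"
    using \<phi>(1) u g(1) by (simp_all add: L2_lim_def test_functions_L2)
  with \<phi>(1) show "\<exists>g. H10_grad u g"
    by (intro exI[of _ g] H10_gradI)
next
  assume "\<exists>g. H10_grad u g"
  then obtain g where g: "H10_grad u g" ..
  note gL = H10_grad_L2[OF g] and gw = H10_grad_has_weak_gradient[OF g]
  obtain \<phi> where \<phi>: "\<forall>n. \<phi> n \<in> test_functions \<Omega>" "L2_lim \<phi> u" "L2_lim (\<lambda>n. tgrad (\<phi> n)) g"
    using g by (rule H10_gradE)
  have "(\<lambda>n. (sqnorm (\<lambda>x. \<phi> n x - u x)) + (sqnorm (\<lambda>x. tgrad (\<phi> n) x - g x))) \<longlonglongrightarrow> 0 + 0"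
    by (intro tendsto_add L2_limD \<phi>)
  then have "(\<lambda>n. (H1_norm \<Omega> (\<lambda>x. \<phi> n x - u x))\<^sup>2) \<longlonglongrightarrow> 0"
    by (simp add: H1_norm_test_diff[OF \<phi>(1)[rule_format] gL gw])
  then have "(\<lambda>n. H1_norm \<Omega> (\<lambda>x. \<phi> n x - u x)) \<longlonglongrightarrow> 0"
    by (rule power2_tendsto_0_imp)
  then show "u \<in> H1_0 \<Omega>"
    using \<phi>(1) gL gw unfolding H1_0_def H1_def by blast
qed

lemma H10_grad_wgrad:
  assumes "u \<in> H1_0 \<Omega>" shows "H10_grad u (wgrad \<Omega> u)"
proof -
  obtain g where g: "H10_grad u g" using assms H1_0_iff by blast
  obtain \<phi> where \<phi>: "\<forall>n. \<phi> n \<in> test_functions \<Omega>" "L2_lim \<phi> u" "L2_lim (\<lambda>n. tgrad (\<phi> n)) g"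
    using g by (rule H10_gradE)
  have ae: "AE x in M. wgrad \<Omega> u x = g x" by (rule H10_grad_wgrad_AE[OF g])
  have "L2_lim (\<lambda>n. tgrad (\<phi> n)) (wgrad \<Omega> u)"
  proof (rule L2_lim_bound[OF \<phi>(3), where C = 1])
    show "wgrad \<Omega> u \<in> L2 \<Omega>" by (rule L2_AE_cong[OF ae H10_grad_L2(2)[OF g]])
    show "AE x in M. norm (tgrad (\<phi> n) x - wgrad \<Omega> u x) \<le> 1 * norm (tgrad (\<phi> n) x - g x)" for n
      using ae by eventually_elim simp
  qed (rule L2_limD[OF \<phi>(3)])
  then show ?thesis by (rule H10_gradI[OF \<phi>(1,2)])
qed

subsection \<open>Poincare inequality and integration by parts\<close>

text \<open>The coordinate x \<bullet> i has derivative 1 in direction \<open>i\<close>, so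
  integration by parts turns the integral of \<phi>^2 into -2 times that of \<phi> times x \<bullet>
  i times the partial derivative. Cauchy-Schwarz with |x \<bullet> i| \<le> R gives A^2 \<le> 4 R^2
  A D, the origin of the constant. Only one partial derivative enters, as the comparison of two
  drifts requires.\<close>

lemma test_functions_Poincare:
  assumes \<phi>: "\<phi> \<in> test_functions \<Omega>" and i: "i \<in> Basis" and R: "\<And>x. x \<in> \<Omega> \<Longrightarrow> \<bar>x \<bullet> i\<bar> \<le> R"
  shows "(\<integral>x. (\<phi> x)\<^sup>2 \<partial>M) \<le> 4 * R\<^sup>2 * (\<integral>x. (tgrad \<phi> x \<bullet> i)\<^sup>2 \<partial>M)"
proof -
  obtain K where "\<forall>k. C_k k \<phi>" "{x. \<phi> x \<noteq> 0} \<subseteq> K" "compact K" "K \<subseteq> \<Omega>"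
    using \<phi> by (rule test_functionsE)
  then have \<phi>k: "C_k k \<phi>" for k by blast
  note \<phi>L = test_functions_L2[OF \<phi>] and d = test_functions_C1(1)[OF \<phi>]
  define A where "A = (\<integral>x. (\<phi> x)\<^sup>2 \<partial>M)"
  define D where "D = (\<integral>x. (tgrad \<phi> x \<bullet> i)\<^sup>2 \<partial>M)"
  have xL: "(\<lambda>x. (x \<bullet> i) * (tgrad \<phi> x \<bullet> i)) \<in> L2 \<Omega>"
    using test_functions_C1(3)[OF \<phi>] by (intro continuous_L2 continuous_intros)
  have tg: "tgrad (\<lambda>x. x \<bullet> i) x = i" for x
    by (rule tgrad_eqI) (auto intro!: derivative_eq_intros simp: inner_commute)
  have "(\<integral>x. \<phi> x * \<phi> x * (tgrad (\<lambda>x. x \<bullet> i) x \<bullet> i) \<partial>M) = - (\<integral>x. (tgrad (\<lambda>x. \<phi> x * \<phi> x) x \<bullet> i) * (x \<bullet> i) \<partial>M)"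
    by (rule test_functions_integral_by_parts[OF test_functions_mult_smooth[OF \<phi>k \<phi>]])
       (intro C_k_linear bounded_linear_inner_left)
  moreover have "(tgrad (\<lambda>x. \<phi> x * \<phi> x) x \<bullet> i) * (x \<bullet> i) = 2 * (\<phi> x * ((x \<bullet> i) * (tgrad \<phi> x \<bullet> i)))" for x
    by (simp add: tgrad_mult[OF d d] inner_add_left algebra_simps)
  ultimately have "A = - 2 * (\<integral>x. \<phi> x * ((x \<bullet> i) * (tgrad \<phi> x \<bullet> i)) \<partial>M)"
    using i by (simp add: tg A_def power2_eq_square)
  note A_eq = this
  have "(\<integral>x. ((x \<bullet> i) * (tgrad \<phi> x \<bullet> i))\<^sup>2 \<partial>M) \<le> (\<integral>x. R\<^sup>2 * (tgrad \<phi> x \<bullet> i)\<^sup>2 \<partial>M)"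
  proof (rule integral_mono)
    show "integrable M (\<lambda>x. ((x \<bullet> i) * (tgrad \<phi> x \<bullet> i))\<^sup>2)"
      using L2_square_integrable[OF xL] by simp
    show "integrable M (\<lambda>x. R\<^sup>2 * (tgrad \<phi> x \<bullet> i)\<^sup>2)"
      using L2_square_integrable[OF L2_inner_const[OF \<phi>L(2), of i]] by simp
    fix x assume "x \<in> space M"
    then have "\<bar>x \<bullet> i\<bar>\<^sup>2 \<le> R\<^sup>2" by (intro power_mono R) auto
    then show "((x \<bullet> i) * (tgrad \<phi> x \<bullet> i))\<^sup>2 \<le> R\<^sup>2 * (tgrad \<phi> x \<bullet> i)\<^sup>2"
      by (simp add: power_mult_distrib mult_right_mono)
  qed
  then have up: "(\<integral>x. ((x \<bullet> i) * (tgrad \<phi> x \<bullet> i))\<^sup>2 \<partial>M) \<le> R\<^sup>2 * D"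
    by (simp add: D_def)
  have A0: "0 \<le> A" by (simp add: A_def)
  from A_eq have "A\<^sup>2 = 4 * (\<integral>x. \<phi> x * ((x \<bullet> i) * (tgrad \<phi> x \<bullet> i)) \<partial>M)\<^sup>2"
    by (simp add: power2_eq_square)
  also have "\<dots> \<le> 4 * (A * (\<integral>x. ((x \<bullet> i) * (tgrad \<phi> x \<bullet> i))\<^sup>2 \<partial>M))"
    using L2_Cauchy_Schwarz[OF \<phi>L(1) xL] by (simp add: A_def)
  also have "\<dots> \<le> 4 * (A * (R\<^sup>2 * D))"
    using up A0 by (intro mult_left_mono) auto
  finally have "A * A \<le> A * (4 * R\<^sup>2 * D)"
    by (simp add: power2_eq_square mult_ac)
  moreover have "0 \<le> A" "0 \<le> 4 * R\<^sup>2 * D" by (simp_all add: A_def D_def)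
  ultimately have "A \<le> 4 * R\<^sup>2 * D"
    by (cases "A = 0") (auto dest: mult_left_le_imp_le)
  then show ?thesis by (simp add: A_def D_def)
qed

lemma H10_Poincare_directional:
  "\<exists>C>0. \<forall>u g i. H10_grad u g \<longrightarrow> i \<in> Basis \<longrightarrow> (\<integral>x. (u x)\<^sup>2 \<partial>M) \<le> C * (\<integral>x. (g x \<bullet> i)\<^sup>2 \<partial>M)"
proof -
  obtain R where R: "0 < R" "\<forall>x\<in>\<Omega>. norm x \<le> R"
    using bounded_Omega by (auto simp: bounded_pos)
  have Ri: "\<bar>x \<bullet> i\<bar> \<le> R" if "x \<in> \<Omega>" "i \<in> Basis" for x i
    using R(2) that Basis_le_norm order_trans by blast
  have "(\<integral>x. (u x)\<^sup>2 \<partial>M) \<le> 4 * R\<^sup>2 * (\<integral>x. (g x \<bullet> i)\<^sup>2 \<partial>M)"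
    if u: "H10_grad u g" and i: "i \<in> Basis" for u g i
  proof -
    obtain \<phi> where \<phi>: "\<forall>n. \<phi> n \<in> test_functions \<Omega>" "L2_lim \<phi> u" "L2_lim (\<lambda>n. tgrad (\<phi> n)) g"
      using u by (rule H10_gradE)
    have 1: "(\<lambda>n. \<integral>x. (\<phi> n x)\<^sup>2 \<partial>M) \<longlonglongrightarrow> (\<integral>x. (u x)\<^sup>2 \<partial>M)"
      using L2_lim_mult[OF \<phi>(2) \<phi>(2)] by (simp add: power2_eq_square)
    have 2: "(\<lambda>n. 4 * R\<^sup>2 * (\<integral>x. (tgrad (\<phi> n) x \<bullet> i)\<^sup>2 \<partial>M)) \<longlonglongrightarrow> 4 * R\<^sup>2 * (\<integral>x. (g x \<bullet> i)\<^sup>2 \<partial>M)"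
      using L2_lim_mult[OF L2_lim_inner_const[OF \<phi>(3)] L2_lim_inner_const[OF \<phi>(3)], of i i]
      by (intro tendsto_mult tendsto_const) (simp add: power2_eq_square)
    have "(\<integral>x. (\<phi> n x)\<^sup>2 \<partial>M) \<le> 4 * R\<^sup>2 * (\<integral>x. (tgrad (\<phi> n) x \<bullet> i)\<^sup>2 \<partial>M)" for n
      by (rule test_functions_Poincare[OF \<phi>(1)[rule_format] i Ri[OF _ i]])
    then show ?thesis by (intro LIMSEQ_le[OF 1 2]) blast
  qed
  then show ?thesis using R(1) by (intro exI[of _ "4 * R\<^sup>2"]) simp
qed

lemma H10_Poincare:
  "\<exists>C>0. \<forall>u g. H10_grad u g \<longrightarrow> (\<integral>x. (u x)\<^sup>2 \<partial>M) \<le> C * (sqnorm g)"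
proof -
  obtain C where C: "C > 0" "\<forall>u g i. H10_grad u g \<longrightarrow> i \<in> Basis \<longrightarrow>
      (\<integral>x. (u x)\<^sup>2 \<partial>M) \<le> C * (\<integral>x. (g x \<bullet> i)\<^sup>2 \<partial>M)"
    using H10_Poincare_directional by blast
  have "(\<integral>x. (u x)\<^sup>2 \<partial>M) \<le> C * (sqnorm g)" if u: "H10_grad u g" for u g
  proof -
    obtain i :: 'a where i: "i \<in> Basis" using nonempty_Basis by blast
    note gL = H10_grad_L2(2)[OF u]
    have "(\<integral>x. (g x \<bullet> i)\<^sup>2 \<partial>M) \<le> (sqnorm g)"
    proof (rule integral_mono[OF _ L2_square_integrable[OF gL]])
      show "integrable M (\<lambda>x. (g x \<bullet> i)\<^sup>2)"
        using L2_square_integrable[OF L2_inner_const[OF gL, of i]] by simp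
      show "(g x \<bullet> i)\<^sup>2 \<le> (norm (g x))\<^sup>2" for x
        using power_mono[OF Basis_le_norm[OF i, of "g x"], of 2] by simp
    qed
    then have "C * (\<integral>x. (g x \<bullet> i)\<^sup>2 \<partial>M) \<le> C * (sqnorm g)"
      using C(1) by (intro mult_left_mono) auto
    moreover have "(\<integral>x. (u x)\<^sup>2 \<partial>M) \<le> C * (\<integral>x. (g x \<bullet> i)\<^sup>2 \<partial>M)" using C(2) u i by blast
    ultimately show ?thesis by simp
  qed
  then show ?thesis using C(1) by blast
qed

lemma L2_AE_eq_0_iff:
  fixes f :: "'a \<Rightarrow> 'b::euclidean_space"
  assumes "f \<in> L2 \<Omega>"
  shows "(sqnorm f) = 0 \<longleftrightarrow> (AE x in M. f x = 0)"
  using integral_nonneg_eq_0_iff_AE[OF L2_square_integrable[OF assms]] by simp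

lemma H10_AE_eq_0:
  assumes "H10_grad u g" "(sqnorm g) \<le> 0"
  shows "AE x in M. u x = 0"
proof -
  obtain C where C: "C > 0" "\<forall>u g. H10_grad u g \<longrightarrow> (\<integral>x. (u x)\<^sup>2 \<partial>M) \<le> C * (sqnorm g)"
    using H10_Poincare by blast
  have "(\<integral>x. (u x)\<^sup>2 \<partial>M) \<le> C * (sqnorm g)" using C(2) assms(1) by blast
  also have "\<dots> \<le> C * 0" using C(1) assms(2) by (intro mult_left_mono) auto
  finally have "(sqnorm u) = 0" by (simp add: order_antisym)
  then show ?thesis using L2_AE_eq_0_iff[OF H10_grad_L2(1)[OF assms(1)]] by simp
qed

lemma H10_grad_integral_by_parts:
  assumes u: "H10_grad u g" and v: "H10_grad v h"
  shows "(\<integral>x. u x * (h x \<bullet> e) \<partial>M) = - (\<integral>x. (g x \<bullet> e) * v x \<partial>M)"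
proof -
  obtain \<phi> where \<phi>: "\<forall>n. \<phi> n \<in> test_functions \<Omega>" "L2_lim \<phi> v" "L2_lim (\<lambda>n. tgrad (\<phi> n)) h"
    using v by (rule H10_gradE)
  have "(\<lambda>n. \<integral>x. u x * (tgrad (\<phi> n) x \<bullet> e) \<partial>M) \<longlonglongrightarrow> (\<integral>x. u x * (h x \<bullet> e) \<partial>M)"
    by (intro L2_lim_mult L2_lim_const L2_lim_inner_const \<phi> H10_grad_L2(1)[OF u])
  moreover have "(\<lambda>n. - (\<integral>x. (g x \<bullet> e) * \<phi> n x \<partial>M)) \<longlonglongrightarrow> - (\<integral>x. (g x \<bullet> e) * v x \<partial>M)"
    by (intro tendsto_minus L2_lim_mult L2_lim_const L2_inner_const \<phi> H10_grad_L2(2)[OF u])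
  moreover have "(\<integral>x. u x * (tgrad (\<phi> n) x \<bullet> e) \<partial>M) = - (\<integral>x. (g x \<bullet> e) * \<phi> n x \<partial>M)" for n
  proof (rule H10_grad_integral_by_parts_smooth[OF u])
    show "C_k k (\<phi> n)" for k
      using \<phi>(1) unfolding test_functions_def by blast
  qed
  ultimately show ?thesis by (simp add: LIMSEQ_unique)
qed

text \<open>Integration by parts with both factors equal shows that the integral is its own
  negative. This removes a constant drift from energy identities.\<close>

lemma H10_grad_integral_self_eq_0:
  assumes "H10_grad u g" shows "(\<integral>x. u x * (g x \<bullet> e) \<partial>M) = 0"
  using H10_grad_integral_by_parts[OF assms assms, of e] by (simp add: mult.commute)

subsection \<open>Chain rule for the flat function\<close>

lemma test_functions_flat_tgrad:
  assumes "\<phi> \<in> test_functions \<Omega>"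
  shows "tgrad (\<lambda>x. flat (c * \<phi> x)) x = (c * flat' (c * \<phi> x)) *\<^sub>R tgrad \<phi> x"
proof (rule tgrad_compose(2)[where F = "\<lambda>t. flat (c * t)", OF _ test_functions_C1(1)[OF assms]])
  have "((\<lambda>t. c * t) has_real_derivative c) (at (\<phi> x))"
    using DERIV_cmult_Id by blast
  from DERIV_chain2[OF flat_has_derivative this]
  show "((\<lambda>t. flat (c * t)) has_real_derivative c * flat' (c * \<phi> x)) (at (\<phi> x))"
    by (simp add: mult.commute)
qed

lemma L2_lim_flat:
  assumes "L2_lim f u" shows "L2_lim (\<lambda>n x. flat (c * f n x)) (\<lambda>x. flat (c * u x))"
proof (rule L2_lim_bound[OF assms, where C = "4 * \<bar>c\<bar>"])
  have "(\<lambda>x. flat (c * h x)) \<in> L2 \<Omega>" if h: "h \<in> L2 \<Omega>" for h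
  proof (rule bounded_L2[where C = 1])
    show "(\<lambda>x. flat (c * h x)) \<in> borel_measurable M"
      by (rule measurable_compose[OF _ flat_measurable]) (use L2_measurable[OF h] in measurable)
    show "norm (flat (c * h x)) \<le> 1" for x
      using flat_nonneg flat_le_1 by simp
  qed
  then show "(\<lambda>x. flat (c * f n x)) \<in> L2 \<Omega>" "(\<lambda>x. flat (c * u x)) \<in> L2 \<Omega>" for n
    using L2_limD(1,2)[OF assms] by blast+
  have "norm (flat (c * f n x) - flat (c * u x)) \<le> 4 * \<bar>c\<bar> * norm (f n x - u x)" for n x
    using flat_Lipschitz[of "c * f n x" "c * u x"] by (simp add: abs_mult mult.assoc flip: right_diff_distrib)
  then show "AE x in M. norm (flat (c * f n x) - flat (c * u x)) \<le> 4 * \<bar>c\<bar> * norm (f n x - u x)" for n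
    by (intro AE_I2)
qed

text \<open>The gradient of the approximants is split: \<open>p\<close> carries the L2-small error
  of the gradients against a bounded factor, and \<open>q\<close> keeps the limit gradient while the
  factor varies. A Lipschitz estimate for the factor does not control \<open>q\<close>, since the
  gradient is only square integrable; dominated convergence along an almost everywhere convergent
  subsequence does.\<close>

lemma H10_grad_flat:
  assumes u: "H10_grad u g"
  shows "H10_grad (\<lambda>x. flat (c * u x)) (\<lambda>x. (c * flat' (c * u x)) *\<^sub>R g x)"
proof -
  obtain \<phi>0 where \<phi>0: "\<forall>n. \<phi>0 n \<in> test_functions \<Omega>" "L2_lim \<phi>0 u" "L2_lim (\<lambda>n. tgrad (\<phi>0 n)) g"
    using u by (rule H10_gradE)
  obtain r where r: "strict_mono r" "AE x in M. (\<lambda>n. \<phi>0 (r n) x) \<longlonglongrightarrow> u x"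
    using L2_lim_AE_subseq[OF \<phi>0(2)] .
  define \<phi> where "\<phi> n = \<phi>0 (r n)" for n
  have \<phi>: "\<forall>n. \<phi> n \<in> test_functions \<Omega>" "L2_lim \<phi> u" "L2_lim (\<lambda>n. tgrad (\<phi> n)) g"
    using \<phi>0(1) L2_lim_subseq[OF \<phi>0(2) r(1)] L2_lim_subseq[OF \<phi>0(3) r(1)] by (simp_all add: \<phi>_def[abs_def])
  note uL = H10_grad_L2(1)[OF u] and gL = H10_grad_L2(2)[OF u]
  have bnd: "\<bar>c * flat' t\<bar> \<le> 4 * \<bar>c\<bar>" for t
    using mult_left_mono[OF flat'_le_4[of t], of "\<bar>c\<bar>"] flat'_nonneg[of t] by (simp add: abs_mult)
  have meas: "(\<lambda>x. c * flat' (c * h x)) \<in> borel_measurable M" if "h \<in> L2 \<Omega>" for h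
  proof -
    have "(\<lambda>x. flat' (c * h x)) \<in> borel_measurable M"
      by (rule measurable_compose[OF _ flat'_measurable]) (use L2_measurable[OF that] in measurable)
    then show ?thesis by measurable
  qed
  have mL: "(\<lambda>x. (c * flat' (c * h x)) *\<^sub>R k x) \<in> L2 \<Omega>" if "h \<in> L2 \<Omega>" "k \<in> L2 \<Omega>" for h and k :: "'a \<Rightarrow> 'a"
    by (rule L2_mult_bounded[OF that(2) meas[OF that(1)] AE_I2[OF bnd]])
  define p where "p n x = (c * flat' (c * \<phi> n x)) *\<^sub>R (tgrad (\<phi> n) x - g x)" for n x
  define q where "q n x = (c * flat' (c * \<phi> n x)) *\<^sub>R g x" for n x
  have p: "L2_lim p (\<lambda>_. 0)"
  proof (rule L2_lim_bound[OF \<phi>(3), where C = "4 * \<bar>c\<bar>"])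
    show "p n \<in> L2 \<Omega>" for n
      unfolding p_def by (rule mL[OF L2_limD(1)[OF \<phi>(2)] L2_diff[OF L2_limD(1)[OF \<phi>(3)] gL]])
    show "(\<lambda>_. 0) \<in> L2 \<Omega>" by (rule continuous_L2) simp
    show "AE x in M. norm (p n x - 0) \<le> 4 * \<bar>c\<bar> * norm (tgrad (\<phi> n) x - g x)" for n
      unfolding p_def using bnd by (intro AE_I2) (simp del: abs_mult add: mult_right_mono)
  qed
  have q: "L2_lim q (\<lambda>x. (c * flat' (c * u x)) *\<^sub>R g x)"
    unfolding L2_lim_def
  proof (intro conjI allI)
    show qL: "q n \<in> L2 \<Omega>" for n
      unfolding q_def by (rule mL[OF L2_limD(1)[OF \<phi>(2)] gL])
    show cL: "(\<lambda>x. (c * flat' (c * u x)) *\<^sub>R g x) \<in> L2 \<Omega>" by (rule mL[OF uL gL])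
    have "(\<lambda>n. sqnorm (\<lambda>x. q n x - (c * flat' (c * u x)) *\<^sub>R g x)) \<longlonglongrightarrow> (\<integral>x. 0 \<partial>M)"
    \<comment> \<open>Two factors of size at most 4 |c| differ by at most 8 |c|.\<close>
    proof (rule integral_dominated_convergence[where w = "\<lambda>x. (8 * \<bar>c\<bar>)\<^sup>2 * (norm (g x))\<^sup>2"])
      show "(\<lambda>x. (norm (q n x - (c * flat' (c * u x)) *\<^sub>R g x))\<^sup>2) \<in> borel_measurable M" for n
        by (rule borel_measurable_integrable[OF L2_square_integrable[OF L2_diff[OF qL cL]]])
      show "integrable M (\<lambda>x. (8 * \<bar>c\<bar>)\<^sup>2 * (norm (g x))\<^sup>2)"
        by (rule integrable_mult_right[OF L2_square_integrable[OF gL]])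
      show "AE x in M. (\<lambda>n. (norm (q n x - (c * flat' (c * u x)) *\<^sub>R g x))\<^sup>2) \<longlonglongrightarrow> 0"
        using r(2)
      proof eventually_elim
        case (elim x)
        then have "(\<lambda>n. c * \<phi> n x) \<longlonglongrightarrow> c * u x"
          unfolding \<phi>_def by (rule tendsto_mult[OF tendsto_const])
        from isCont_tendsto_compose[OF isCont_flat' this]
        have "(\<lambda>n. q n x) \<longlonglongrightarrow> (c * flat' (c * u x)) *\<^sub>R g x"
          unfolding q_def by (intro tendsto_scaleR tendsto_mult tendsto_const)
        then have "(\<lambda>n. norm (q n x - (c * flat' (c * u x)) *\<^sub>R g x)) \<longlonglongrightarrow> 0"
          by (simp add: tendsto_norm_zero_iff LIM_zero_iff)
        from tendsto_power[OF this, of 2] show ?case by simp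
      qed
      have "(norm (q n x - (c * flat' (c * u x)) *\<^sub>R g x))\<^sup>2 \<le> (8 * \<bar>c\<bar>)\<^sup>2 * (norm (g x))\<^sup>2" for n x
      proof -
        have "norm (q n x - (c * flat' (c * u x)) *\<^sub>R g x) = \<bar>c * flat' (c * \<phi> n x) - c * flat' (c * u x)\<bar> * norm (g x)"
          unfolding q_def by (simp flip: scaleR_diff_left)
        also have "\<dots> \<le> (8 * \<bar>c\<bar>) * norm (g x)"
          using bnd[of "c * \<phi> n x"] bnd[of "c * u x"] by (intro mult_right_mono norm_ge_zero) linarith
        finally show ?thesis
          unfolding power_mult_distrib[symmetric] by (rule power_mono) simp
      qed
      then show "AE x in M. norm ((norm (q n x - (c * flat' (c * u x)) *\<^sub>R g x))\<^sup>2) \<le> (8 * \<bar>c\<bar>)\<^sup>2 * (norm (g x))\<^sup>2" for n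
        by (intro AE_I2) simp
    qed simp
    then show "(\<lambda>n. sqnorm (\<lambda>x. q n x - (c * flat' (c * u x)) *\<^sub>R g x)) \<longlonglongrightarrow> 0" by simp
  qed
  show ?thesis
  proof (rule H10_gradI[where \<phi> = "\<lambda>n x. flat (c * \<phi> n x)"])
    show "\<forall>n. (\<lambda>x. flat (c * \<phi> n x)) \<in> test_functions \<Omega>"
      using \<phi>(1) by (simp add: test_functions_flat)
    show "L2_lim (\<lambda>n x. flat (c * \<phi> n x)) (\<lambda>x. flat (c * u x))"
      by (rule L2_lim_flat[OF \<phi>(2)])
    have "tgrad (\<lambda>x. flat (c * \<phi> n x)) = (\<lambda>x. p n x + q n x)" for n
      unfolding p_def q_def
      by (simp add: fun_eq_iff test_functions_flat_tgrad[OF \<phi>(1)[rule_format]] flip: scaleR_right_distrib)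
    then show "L2_lim (\<lambda>n. tgrad (\<lambda>x. flat (c * \<phi> n x))) (\<lambda>x. (c * flat' (c * u x)) *\<^sub>R g x)"
      using L2_lim_add[OF p q] by simp
  qed
qed

text \<open>The integrand is the directional derivative of an antiderivative of \<open>flat\<close>
  composed with \<open>u\<close>. The identity is proved for test functions and carried over by L2
  limits, so the antiderivative is never applied to \<open>u\<close> itself.\<close>

lemma H10_integral_flat_grad_eq_0:
  assumes u: "H10_grad u g"
  shows "(\<integral>x. flat (u x) * (g x \<bullet> e) \<partial>M) = 0"
proof -
  obtain \<phi> where \<phi>: "\<forall>n. \<phi> n \<in> test_functions \<Omega>" "L2_lim \<phi> u" "L2_lim (\<lambda>n. tgrad (\<phi> n)) g"
    using u by (rule H10_gradE)
  have "\<exists>F. \<forall>x. (F has_vector_derivative flat x) (at x)"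
    using einterval_antiderivative[of "-\<infinity>" "\<infinity>" flat] isCont_flat by auto
  then obtain F where F: "(F has_real_derivative flat t) (at t)" for t
    by (auto simp: has_real_derivative_iff_has_vector_derivative)
  have "(\<integral>x. flat (\<phi> n x) * (tgrad (\<phi> n) x \<bullet> e) \<partial>M) = 0" for n
  proof -
    note t = \<phi>(1)[rule_format, of n]
    note d = test_functions_C1(1)[OF t]
    obtain K where K: "\<forall>k. C_k k (\<phi> n)" "{x. \<phi> n x \<noteq> 0} \<subseteq> K" "compact K" "K \<subseteq> \<Omega>"
      using t by (rule test_functionsE)
    \<comment> \<open>Normalising the antiderivative to vanish at 0 keeps the support of the
      composition inside \<open>K\<close>.\<close>
    have D: "((\<lambda>t. F t - F 0) has_real_derivative flat s) (at s)" for s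
      using DERIV_diff[OF F[of s] DERIV_const[of "F 0"]] by simp
    note tc = tgrad_compose[OF D d]
    have "(\<integral>x. tgrad (\<lambda>x. F (\<phi> n x) - F 0) x \<bullet> e \<partial>M) = 0"
    proof (rule integral_tgrad_eq_0[OF tc(1) _ _ K(3,4)])
      have "continuous_on UNIV flat" using isCont_flat by (simp add: continuous_at_imp_continuous_on)
      then show "continuous_on UNIV (tgrad (\<lambda>x. F (\<phi> n x) - F 0))"
        unfolding tc(2)
        by (intro continuous_on_scaleR test_functions_C1(3)[OF t])
           (rule continuous_on_compose2[OF _ test_functions_C1(2)[OF t]], auto)
      show "{x. F (\<phi> n x) - F 0 \<noteq> 0} \<subseteq> K" using K(2) by auto
    qed
    then show ?thesis by (simp add: tc(2))
  qed
  moreover have "(\<lambda>n. \<integral>x. flat (\<phi> n x) * (tgrad (\<phi> n) x \<bullet> e) \<partial>M) \<longlonglongrightarrow> (\<integral>x. flat (u x) * (g x \<bullet> e) \<partial>M)"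
    using L2_lim_flat[OF \<phi>(2), of 1] by (intro L2_lim_mult L2_lim_inner_const \<phi>) simp
  ultimately show ?thesis by (simp add: LIMSEQ_const_iff)
qed

end

section \<open>The Kolmogorov--Fokker--Planck equation with constant drift\<close>

text \<open>The sequence minimises \<open>a \<phi> \<phi> - 2 * l \<phi>\<close> over \<open>V\<close>.\<close>

lemma Riesz_minimizing_sequence:
  fixes V :: "('b \<Rightarrow> real) set" and a :: "('b \<Rightarrow> real) \<Rightarrow> ('b \<Rightarrow> real) \<Rightarrow> real" and C :: real
  assumes ne: "V \<noteq> {}"
    and lin: "\<And>\<phi> \<psi> c. \<phi> \<in> V \<Longrightarrow> \<psi> \<in> V \<Longrightarrow> (\<lambda>x. \<phi> x + c * \<psi> x) \<in> V"
    and a_lin: "\<And>\<phi> \<psi> \<eta> c. \<phi> \<in> V \<Longrightarrow> \<psi> \<in> V \<Longrightarrow> \<eta> \<in> V \<Longrightarrow>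
      a (\<lambda>x. \<phi> x + c * \<psi> x) \<eta> = a \<phi> \<eta> + c * a \<psi> \<eta>"
    and a_sym: "\<And>\<phi> \<psi>. \<phi> \<in> V \<Longrightarrow> \<psi> \<in> V \<Longrightarrow> a \<phi> \<psi> = a \<psi> \<phi>"
    and a_nonneg: "\<And>\<phi>. \<phi> \<in> V \<Longrightarrow> 0 \<le> a \<phi> \<phi>"
    and l_lin: "\<And>\<phi> \<psi> c. \<phi> \<in> V \<Longrightarrow> \<psi> \<in> V \<Longrightarrow> l (\<lambda>x. \<phi> x + c * \<psi> x) = l \<phi> + c * l \<psi>"
    and l_bound: "0 \<le> C" "\<And>\<phi>. \<phi> \<in> V \<Longrightarrow> (l \<phi>)\<^sup>2 \<le> C * a \<phi> \<phi>"
  shows "\<exists>\<phi>. (\<forall>n. \<phi> n \<in> V) \<and>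
    (\<forall>e>0. \<exists>N. \<forall>m\<ge>N. \<forall>n\<ge>N. a (\<lambda>x. \<phi> m x + (-1) * \<phi> n x) (\<lambda>x. \<phi> m x + (-1) * \<phi> n x) < e) \<and>
    (\<forall>\<psi>\<in>V. (\<lambda>n. a (\<phi> n) \<psi>) \<longlonglongrightarrow> l \<psi>)"
proof -
  define J where "J \<phi> = a \<phi> \<phi> - 2 * l \<phi>" for \<phi>
  have J_lin: "J (\<lambda>x. \<phi> x + c * \<psi> x) = J \<phi> + 2 * c * (a \<phi> \<psi> - l \<psi>) + c\<^sup>2 * a \<psi> \<psi>"
    if "\<phi> \<in> V" "\<psi> \<in> V" for \<phi> \<psi> c
  proof -
    let ?w = "\<lambda>x. \<phi> x + c * \<psi> x"
    note w = lin[OF that, of c]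
    have "a ?w ?w = a ?w \<phi> + c * a ?w \<psi>"
      by (simp only: a_lin[OF that w] a_sym[OF that(1) w] a_sym[OF that(2) w])
    also have "\<dots> = a \<phi> \<phi> + c * a \<psi> \<phi> + c * (a \<phi> \<psi> + c * a \<psi> \<psi>)"
      by (simp only: a_lin[OF that that(1)] a_lin[OF that that(2)])
    finally show ?thesis
      by (simp add: J_def l_lin[OF that] a_sym[OF that(2,1)] power2_eq_square algebra_simps)
  qed
  have J_ge: "- C \<le> J \<phi>" if "\<phi> \<in> V" for \<phi>
  proof -
    \<comment> \<open>Boundedness below comes from (2 l)^2 \<le> 4 C a \<le> (a + C)^2.\<close>
    have "(2 * l \<phi>)\<^sup>2 \<le> 4 * (C * a \<phi> \<phi>)"
      using l_bound(2)[OF that] by (simp add: power_mult_distrib)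
    also have "\<dots> \<le> (a \<phi> \<phi> + C)\<^sup>2"
      using zero_le_power2[of "a \<phi> \<phi> - C"] by (simp add: power2_eq_square algebra_simps)
    finally have "2 * l \<phi> \<le> a \<phi> \<phi> + C"
      by (rule power2_le_imp_le) (use a_nonneg[OF that] l_bound(1) in simp)
    then show ?thesis by (simp add: J_def)
  qed
  define I where "I = Inf (J ` V)"
  have bdd: "bdd_below (J ` V)" using J_ge by (intro bdd_belowI[of _ "- C"]) auto
  have I_le: "I \<le> J \<phi>" if "\<phi> \<in> V" for \<phi>
    unfolding I_def using bdd that by (intro cInf_lower) auto
  have "\<exists>\<phi>\<in>V. J \<phi> < I + 1 / Suc n" for n
  proof -
    have "Inf (J ` V) < I + 1 / Suc n" by (simp add: I_def)
    then show ?thesis using cInf_less_iff[of "J ` V" "I + 1 / Suc n"] bdd ne by auto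
  qed
  then obtain \<phi> where \<phi>: "\<And>n. \<phi> n \<in> V" "\<And>n. J (\<phi> n) < I + 1 / Suc n" by metis
  have Cauchy: "a (\<lambda>x. \<phi> m x + (-1) * \<phi> n x) (\<lambda>x. \<phi> m x + (-1) * \<phi> n x) < 2 / Suc m + 2 / Suc n" for m n
  proof -
    let ?d = "\<lambda>x. \<phi> m x + (-1) * \<phi> n x"
    note d = lin[OF \<phi>(1)[of m] \<phi>(1)[of n], of "-1"]
    \<comment> \<open>Moving from \<open>\<phi> n\<close> along \<open>?d\<close>, coefficient 1
      reaches \<open>\<phi> m\<close> and coefficient 1/2 the midpoint. As \<open>J\<close> is at
      least \<open>I\<close> at the midpoint, eliminating the linear term bounds
      \<open>a ?d ?d\<close> by the excesses of both functions over \<open>I\<close>.\<close>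
    have "(\<lambda>x. \<phi> n x + 1 * ?d x) = \<phi> m" by auto
    then have 1: "J (\<phi> m) = J (\<phi> n) + 2 * (a (\<phi> n) ?d - l ?d) + a ?d ?d"
      using J_lin[OF \<phi>(1)[of n] d, of 1] by simp
    have 2: "I \<le> J (\<phi> n) + (a (\<phi> n) ?d - l ?d) + (1 / 2)\<^sup>2 * a ?d ?d"
      using I_le[OF lin[OF \<phi>(1)[of n] d, of "1 / 2"]] J_lin[OF \<phi>(1)[of n] d, of "1 / 2"] by simp
    have "(1 / 2 :: real)\<^sup>2 = 1 / 4" by (simp add: power2_eq_square)
    with 1 2 have "a ?d ?d \<le> 2 * (J (\<phi> m) - I) + 2 * (J (\<phi> n) - I)" by simp
    also have "\<dots> < 2 * (1 / Suc m) + 2 * (1 / Suc n)"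
      using \<phi>(2)[of m] \<phi>(2)[of n] by (intro add_strict_mono mult_strict_left_mono) simp_all
    finally show ?thesis by simp
  qed
  have "\<exists>N. \<forall>m\<ge>N. \<forall>n\<ge>N. a (\<lambda>x. \<phi> m x + (-1) * \<phi> n x) (\<lambda>x. \<phi> m x + (-1) * \<phi> n x) < e" if "0 < e" for e
  proof -
    have "0 < e / 4" using that by simp
    then obtain N where N: "1 / real (Suc N) < e / 4" by (rule nat_approx_posE)
    have s: "2 / real (Suc k) < e / 2" if "N \<le> k" for k
    proof -
      have "1 / real (Suc k) \<le> 1 / real (Suc N)" using that by (intro divide_left_mono) auto
      with N have "2 * (1 / real (Suc k)) < e / 2" by linarith
      then show ?thesis by simp
    qed
    have "a (\<lambda>x. \<phi> m x + (-1) * \<phi> n x) (\<lambda>x. \<phi> m x + (-1) * \<phi> n x) < e" if "N \<le> m" "N \<le> n" for m n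
      using Cauchy[of m n] s[OF that(1)] s[OF that(2)] by linarith
    then show ?thesis by blast
  qed
  moreover have "(\<lambda>n. a (\<phi> n) \<psi>) \<longlonglongrightarrow> l \<psi>" if \<psi>: "\<psi> \<in> V" for \<psi>
  proof -
    \<comment> \<open>The added 1 allows division even if \<open>a \<psi> \<psi>\<close> is 0. The
      step - d / s along \<open>\<psi>\<close> lowers \<open>J\<close> by at least d^2 / s, which
      cannot exceed the excess of \<open>\<phi> n\<close> over the infimum.\<close>
    define s where "s = a \<psi> \<psi> + 1"
    have s: "0 < s" "a \<psi> \<psi> \<le> s" using a_nonneg[OF \<psi>] by (auto simp: s_def)
    have bd: "(a (\<phi> n) \<psi> - l \<psi>)\<^sup>2 \<le> s * (1 / Suc n)" for n
    proof -
      define d where "d = a (\<phi> n) \<psi> - l \<psi>"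
      have "I \<le> J (\<phi> n) + 2 * (- d / s) * d + (- d / s)\<^sup>2 * a \<psi> \<psi>"
        using I_le[OF lin[OF \<phi>(1)[of n] \<psi>, of "- d / s"]] J_lin[OF \<phi>(1)[of n] \<psi>, of "- d / s"]
        by (simp only: d_def)
      moreover have "(- d / s)\<^sup>2 * a \<psi> \<psi> \<le> (- d / s)\<^sup>2 * s" using s by (intro mult_left_mono) auto
      moreover have "2 * (- d / s) * d + (- d / s)\<^sup>2 * s = - (d\<^sup>2 / s)"
        using s by (simp add: power2_eq_square field_simps)
      ultimately have "d\<^sup>2 / s \<le> 1 / Suc n" using \<phi>(2)[of n] by linarith
      then show ?thesis using s by (simp add: d_def field_simps)
    qed
    have "\<forall>\<^sub>F n in sequentially. norm ((a (\<phi> n) \<psi> - l \<psi>)\<^sup>2) \<le> s * (1 / Suc n)"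
      using bd by (simp only: real_norm_def abs_power2 eventually_True)
    moreover have "(\<lambda>n. s * (1 / real (Suc n))) \<longlonglongrightarrow> s * 0"
      by (intro tendsto_mult tendsto_const) (use LIMSEQ_inverse_real_of_nat in \<open>simp add: inverse_eq_divide\<close>)
    ultimately have "(\<lambda>n. (a (\<phi> n) \<psi> - l \<psi>)\<^sup>2) \<longlonglongrightarrow> 0"
      unfolding mult_zero_right by (rule Lim_null_comparison)
    then have "(\<lambda>n. a (\<phi> n) \<psi> - l \<psi>) \<longlonglongrightarrow> 0" by (rule power2_tendsto_0_imp)
    then show ?thesis by (simp add: LIM_zero_iff)
  qed
  ultimately show ?thesis using \<phi>(1) by (intro exI[of _ \<phi>]) blast
qed

context bounded_open
begin

text \<open>Controlling gradients is enough, because the Poincare inequality turns a Cauchy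
  condition on them into one on the functions.\<close>

lemma test_functions_L2_Cauchy:
  fixes \<phi> :: "nat \<Rightarrow> 'a \<Rightarrow> real"
  assumes \<phi>: "\<And>n. \<phi> n \<in> test_functions \<Omega>"
    and Cauchy: "\<And>e. 0 < e \<Longrightarrow> \<exists>N. \<forall>m\<ge>N. \<forall>n\<ge>N. (sqnorm (\<lambda>x. tgrad (\<phi> m) x - tgrad (\<phi> n) x)) < e"
  obtains u g where "L2_lim \<phi> u" "L2_lim (\<lambda>n. tgrad (\<phi> n)) g"
proof -
  obtain C where C: "C > 0" "\<forall>u g. H10_grad u g \<longrightarrow> (\<integral>x. (u x)\<^sup>2 \<partial>M) \<le> C * (sqnorm g)"
    using H10_Poincare by blast
  have P: "(sqnorm (\<lambda>x. \<phi> m x - \<phi> n x)) \<le> C * (sqnorm (\<lambda>x. tgrad (\<phi> m) x - tgrad (\<phi> n) x))" for m n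
    using C(2) H10_grad_diff[OF H10_grad_test[OF \<phi>[of m]] H10_grad_test[OF \<phi>[of n]]] by simp
  have "\<exists>N. \<forall>m\<ge>N. \<forall>n\<ge>N. (sqnorm (\<lambda>x. \<phi> m x - \<phi> n x)) < e" if "0 < e" for e
  proof -
    have "0 < e / C" using that C(1) by simp
    then obtain N where N: "\<forall>m\<ge>N. \<forall>n\<ge>N. (sqnorm (\<lambda>x. tgrad (\<phi> m) x - tgrad (\<phi> n) x)) < e / C"
      using Cauchy by blast
    have "(sqnorm (\<lambda>x. \<phi> m x - \<phi> n x)) < e" if "N \<le> m" "N \<le> n" for m n
    proof -
      have "C * (sqnorm (\<lambda>x. tgrad (\<phi> m) x - tgrad (\<phi> n) x)) < C * (e / C)"
        using N that C(1) by (intro mult_strict_left_mono) auto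
      with P[of m n] show ?thesis using C(1) by simp
    qed
    then show ?thesis by blast
  qed
  from L2_complete[where f = \<phi>, OF test_functions_L2(1)[OF \<phi>] this]
  obtain u where "L2_lim \<phi> u" .
  moreover obtain g where "L2_lim (\<lambda>n. tgrad (\<phi> n)) g"
    using L2_complete[where f = "\<lambda>n. tgrad (\<phi> n)", OF test_functions_L2(2)[OF \<phi>] Cauchy] .
  ultimately show ?thesis by (rule that)
qed

lemma integral_power2_le:
  assumes "f \<in> L2 \<Omega>" shows "(\<integral>x. f x \<partial>M)\<^sup>2 \<le> (sqnorm f) * measure M \<Omega>"
  using L2_Cauchy_Schwarz[OF assms continuous_L2[of "\<lambda>_. 1"]] by simp

text \<open>The weak equation with explicit gradients and with the drift term as an integral of its
  own, so that identities can be added term by term. For bounded measurable drifts it is equivalent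
  to \<open>weak_KFP\<close>.\<close>

definition solves_KFP :: "real \<Rightarrow> ('a \<Rightarrow> 'a) \<Rightarrow> ('a \<Rightarrow> real) \<Rightarrow> ('a \<Rightarrow> 'a) \<Rightarrow> bool" where
  "solves_KFP \<nu> b m g \<longleftrightarrow> H10_grad m g \<and> (\<forall>\<phi> h. H10_grad \<phi> h \<longrightarrow>
    \<nu> * (\<integral>x. g x \<bullet> h x \<partial>M) + (\<integral>x. m x * (b x \<bullet> h x) \<partial>M) = (\<integral>x. \<phi> x \<partial>M))"

text \<open>The substitution \<open>m = exp (- b \<bullet> x / \<nu>) * w\<close> turns \<open>\<nu> * \<nabla>m + m * b\<close> into
  \<open>\<nu> * exp (- b \<bullet> x / \<nu>) * \<nabla>w\<close>, which makes the equation symmetric.\<close>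

lemma KFP_constant_drift_exists:
  assumes "0 < \<nu>"
  shows "\<exists>m g. solves_KFP \<nu> (\<lambda>_. b) m g"
proof -
  obtain R where R: "0 < R" "\<forall>x\<in>\<Omega>. norm x \<le> R"
    using bounded_Omega by (auto simp: bounded_pos)
  define \<rho> where "\<rho> x = exp ((- 1 / \<nu>) * (x \<bullet> b))" for x
  have \<rho>k: "C_k k \<rho>" for k
  proof -
    have "C_k k (\<lambda>x. exp ((- 1 / \<nu>) * (x \<bullet> b)))"
      by (intro C_k_exp C_k_mult C_k_const C_k_linear bounded_linear_inner_left)
    then show ?thesis by (simp only: \<rho>_def[abs_def])
  qed
  have \<rho>1: "\<rho> differentiable (at x)" "continuous_on UNIV \<rho>" for x
    using C_k_imp_C1(1,2)[of \<rho>] \<rho>k by blast+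
  have \<rho>_grad: "tgrad \<rho> x = (- 1 / \<nu>) *\<^sub>R (\<rho> x *\<^sub>R b)" for x
    unfolding \<rho>_def[abs_def]
    by (rule tgrad_eqI) (use assms in \<open>auto intro!: derivative_eq_intros simp: inner_commute\<close>)
  \<comment> \<open>A positive lower bound of the weight on \<Omega>, from x \<bullet> b \<le> R
    |b|; it makes the weighted form coercive.\<close>
  define \<rho>0 where "\<rho>0 = exp (- (R * norm b) / \<nu>)"
  have \<rho>0: "0 < \<rho>0" "\<rho>0 \<le> \<rho> x" if "x \<in> \<Omega>" for x
  proof -
    have "x \<bullet> b \<le> norm x * norm b" by (rule norm_cauchy_schwarz)
    also have "\<dots> \<le> R * norm b" using R(2) that by (intro mult_right_mono) auto
    finally show "\<rho>0 \<le> \<rho> x" using assms by (simp add: \<rho>0_def \<rho>_def divide_right_mono)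
  qed (simp add: \<rho>0_def)
  obtain B where B: "0 \<le> B" "\<forall>x\<in>\<Omega>. norm (\<rho> x) \<le> B"
    using continuous_bounded[OF \<rho>1(2)] .
  have \<rho>m: "\<rho> \<in> borel_measurable M" by (rule continuous_measurable[OF \<rho>1(2)])
  have \<rho>B: "AE x in M. \<bar>\<rho> x\<bar> \<le> B" using B(2) by (intro AE_I2) simp
  define a where "a \<phi> \<psi> = \<nu> * (\<integral>x. (\<rho> x *\<^sub>R tgrad \<phi> x) \<bullet> tgrad \<psi> x \<partial>M)" for \<phi> \<psi>
  have \<rho>L: "(\<lambda>x. \<rho> x *\<^sub>R f x) \<in> L2 \<Omega>" if "f \<in> L2 \<Omega>" for f :: "'a \<Rightarrow> 'a"
    by (rule L2_mult_bounded[OF that \<rho>m \<rho>B])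
  note tL = test_functions_L2 and t1 = test_functions_C1(1)
  have a_ge: "\<nu> * \<rho>0 * (sqnorm (\<lambda>x. tgrad \<phi> x)) \<le> a \<phi> \<phi>" if "\<phi> \<in> test_functions \<Omega>" for \<phi>
  proof -
    have "(\<integral>x. \<rho>0 * (norm (tgrad \<phi> x))\<^sup>2 \<partial>M) \<le> (\<integral>x. (\<rho> x *\<^sub>R tgrad \<phi> x) \<bullet> tgrad \<phi> x \<partial>M)"
    proof (rule integral_mono)
      show "integrable M (\<lambda>x. \<rho>0 * (norm (tgrad \<phi> x))\<^sup>2)"
        by (intro integrable_mult_right L2_square_integrable tL that)
      show "integrable M (\<lambda>x. (\<rho> x *\<^sub>R tgrad \<phi> x) \<bullet> tgrad \<phi> x)"
        by (intro L2_inner_integrable \<rho>L tL that)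
      fix x assume "x \<in> space M"
      then have "\<rho>0 * (norm (tgrad \<phi> x))\<^sup>2 \<le> \<rho> x * (norm (tgrad \<phi> x))\<^sup>2"
        by (intro mult_right_mono \<rho>0) auto
      then show "\<rho>0 * (norm (tgrad \<phi> x))\<^sup>2 \<le> (\<rho> x *\<^sub>R tgrad \<phi> x) \<bullet> tgrad \<phi> x"
        by (simp add: power2_norm_eq_inner)
    qed
    then have "\<rho>0 * (sqnorm (\<lambda>x. tgrad \<phi> x)) \<le> (\<integral>x. (\<rho> x *\<^sub>R tgrad \<phi> x) \<bullet> tgrad \<phi> x \<partial>M)"
      by simp
    then show ?thesis unfolding a_def mult.assoc using assms by (intro mult_left_mono) auto
  qed
  obtain C where C: "C > 0" "\<forall>u g. H10_grad u g \<longrightarrow> (\<integral>x. (u x)\<^sup>2 \<partial>M) \<le> C * (sqnorm g)"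
    using H10_Poincare by blast
  have c0: "0 < \<nu> * \<rho>0" using assms by (simp add: \<rho>0_def)
  \<comment> \<open>Continuity constant of the source: Cauchy-Schwarz contributes the measure of
    \<Omega>, Poincare contributes \<open>C\<close>, and coercivity divides by
    \<open>\<nu> * \<rho>0\<close>.\<close>
  define C' where "C' = measure M \<Omega> * C / (\<nu> * \<rho>0)"
  have C': "0 \<le> C'" using C(1) c0 by (simp add: C'_def)
  \<comment> \<open>Test functions are not complete for the form \<open>a\<close>, so the abstract
    lemma delivers only a Cauchy sequence; its limit is taken in L2 afterwards.\<close>
  have "\<exists>\<phi>. (\<forall>n. \<phi> n \<in> test_functions \<Omega>) \<and>
    (\<forall>e>0. \<exists>N. \<forall>m\<ge>N. \<forall>n\<ge>N. a (\<lambda>x. \<phi> m x + (-1) * \<phi> n x) (\<lambda>x. \<phi> m x + (-1) * \<phi> n x) < e) \<and>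
    (\<forall>\<psi>\<in>test_functions \<Omega>. (\<lambda>n. a (\<phi> n) \<psi>) \<longlonglongrightarrow> (\<integral>x. \<psi> x \<partial>M))"
  proof (rule Riesz_minimizing_sequence[OF _ test_functions_add_scaled _ _ _ _ C'])
    show "test_functions \<Omega> \<noteq> {}" using zero_test_function by blast
  next
    fix \<phi> \<psi> \<eta> c
    assume t: "\<phi> \<in> test_functions \<Omega>" "\<psi> \<in> test_functions \<Omega>" "\<eta> \<in> test_functions \<Omega>"
    have "(\<integral>x. (\<rho> x *\<^sub>R tgrad (\<lambda>x. \<phi> x + c * \<psi> x) x) \<bullet> tgrad \<eta> x \<partial>M) =
        (\<integral>x. (\<rho> x *\<^sub>R tgrad \<phi> x) \<bullet> tgrad \<eta> x + c * ((\<rho> x *\<^sub>R tgrad \<psi> x) \<bullet> tgrad \<eta> x) \<partial>M)"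
      by (simp add: tgrad_add_scaled[OF t1[OF t(1)] t1[OF t(2)]] inner_add_left algebra_simps)
    also have "\<dots> = (\<integral>x. (\<rho> x *\<^sub>R tgrad \<phi> x) \<bullet> tgrad \<eta> x \<partial>M) + c * (\<integral>x. (\<rho> x *\<^sub>R tgrad \<psi> x) \<bullet> tgrad \<eta> x \<partial>M)"
      by (subst Bochner_Integration.integral_add)
         (intro integrable_mult_right L2_inner_integrable \<rho>L tL t | simp)+
    finally show "a (\<lambda>x. \<phi> x + c * \<psi> x) \<eta> = a \<phi> \<eta> + c * a \<psi> \<eta>"
      by (simp add: a_def algebra_simps)
  next
    fix \<phi> \<psi> show "a \<phi> \<psi> = a \<psi> \<phi>" by (simp add: a_def inner_commute)
  next
    fix \<phi> assume t: "\<phi> \<in> test_functions \<Omega>"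
    have "0 \<le> \<nu> * \<rho>0 * (sqnorm (\<lambda>x. tgrad \<phi> x))"
      by (rule mult_nonneg_nonneg[OF less_imp_le[OF c0]]) simp
    with a_ge[OF t] show "0 \<le> a \<phi> \<phi>" by simp
  next
    fix \<phi> \<psi> c assume t: "\<phi> \<in> test_functions \<Omega>" "\<psi> \<in> test_functions \<Omega>"
    show "(\<integral>x. \<phi> x + c * \<psi> x \<partial>M) = (\<integral>x. \<phi> x \<partial>M) + c * (\<integral>x. \<psi> x \<partial>M)"
      using L2_integrable[OF tL(1)[OF t(1)]] L2_integrable[OF tL(1)[OF t(2)]] by simp
  next
    fix \<phi> assume t: "\<phi> \<in> test_functions \<Omega>"
    define D where "D = (sqnorm (\<lambda>x. tgrad \<phi> x))"
    have "(\<integral>x. \<phi> x \<partial>M)\<^sup>2 \<le> (sqnorm \<phi>) * measure M \<Omega>"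
      by (rule integral_power2_le[OF tL(1)[OF t]])
    also have "\<dots> \<le> (C * D) * measure M \<Omega>"
      using C(2) H10_grad_test[OF t] unfolding D_def by (intro mult_right_mono) auto
    also have "\<dots> = C' * (\<nu> * \<rho>0 * D)"
    proof -
      have "C * D * K = K * C / c * (c * D)" if "0 < c" for c K :: real using that by simp
      from this[OF c0] show ?thesis unfolding C'_def .
    qed
    also have "\<dots> \<le> C' * a \<phi> \<phi>"
      using a_ge[OF t] C' unfolding D_def by (intro mult_left_mono) auto
    finally show "(\<integral>x. \<phi> x \<partial>M)\<^sup>2 \<le> C' * a \<phi> \<phi>" .
  qed
  then obtain \<phi> where \<phi>t: "\<And>n. \<phi> n \<in> test_functions \<Omega>"
    and \<phi>c: "\<forall>e>0. \<exists>N. \<forall>m\<ge>N. \<forall>n\<ge>N. a (\<lambda>x. \<phi> m x + (-1) * \<phi> n x) (\<lambda>x. \<phi> m x + (-1) * \<phi> n x) < e"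
    and \<phi>l: "\<forall>\<psi>\<in>test_functions \<Omega>. (\<lambda>n. a (\<phi> n) \<psi>) \<longlonglongrightarrow> (\<integral>x. \<psi> x \<partial>M)"
    by (elim exE conjE) blast
  have "\<exists>N. \<forall>m\<ge>N. \<forall>n\<ge>N. (sqnorm (\<lambda>x. tgrad (\<phi> m) x - tgrad (\<phi> n) x)) < e" if "0 < e" for e
  proof -
    have "0 < \<nu> * \<rho>0 * e" by (rule mult_pos_pos[OF c0 that])
    then obtain N where N: "\<forall>m\<ge>N. \<forall>n\<ge>N. a (\<lambda>x. \<phi> m x + (-1) * \<phi> n x) (\<lambda>x. \<phi> m x + (-1) * \<phi> n x) < \<nu> * \<rho>0 * e"
      using \<phi>c by blast
    have "(sqnorm (\<lambda>x. tgrad (\<phi> m) x - tgrad (\<phi> n) x)) < e" if "N \<le> m" "N \<le> n" for m n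
    proof -
      have "tgrad (\<lambda>x. \<phi> m x + (-1) * \<phi> n x) x = tgrad (\<phi> m) x - tgrad (\<phi> n) x" for x
        using tgrad_add_scaled[OF t1[OF \<phi>t[of m]] t1[OF \<phi>t[of n]], where c = "-1"] by simp
      then have "\<nu> * \<rho>0 * (sqnorm (\<lambda>x. tgrad (\<phi> m) x - tgrad (\<phi> n) x)) < \<nu> * \<rho>0 * e"
        using a_ge[OF test_functions_add_scaled[OF \<phi>t[of m] \<phi>t[of n], of "-1"]] N that
        by (simp only:) (meson le_less_trans)
      then show ?thesis using c0 by (simp only: mult_less_cancel_left_pos)
    qed
    then show ?thesis by blast
  qed
  from test_functions_L2_Cauchy[where \<phi> = \<phi>, OF \<phi>t this]
  obtain w g where w: "L2_lim \<phi> w" and g: "L2_lim (\<lambda>n. tgrad (\<phi> n)) g" .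
  define m where "m x = \<rho> x * w x" for x
  \<comment> \<open>Product rule for \<rho> * w. The second part is written with \<open>m\<close>,
    so that it visibly cancels the drift term of the equation.\<close>
  define gm where "gm x = \<rho> x *\<^sub>R g x + (- 1 / \<nu>) *\<^sub>R (m x *\<^sub>R b)" for x
  have lm: "L2_lim (\<lambda>n x. \<rho> x * \<phi> n x) m"
    using L2_lim_mult_bounded[OF w \<rho>m \<rho>B] by (simp add: m_def[abs_def])
  have lg: "L2_lim (\<lambda>n x. \<rho> x *\<^sub>R tgrad (\<phi> n) x) (\<lambda>x. \<rho> x *\<^sub>R g x)"
    by (rule L2_lim_mult_bounded[OF g \<rho>m \<rho>B])
  have m: "H10_grad m gm"
  proof (rule H10_gradI[where \<phi> = "\<lambda>n x. \<rho> x * \<phi> n x"])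
    show "\<forall>n. (\<lambda>x. \<rho> x * \<phi> n x) \<in> test_functions \<Omega>"
      by (intro allI test_functions_mult_smooth \<rho>k \<phi>t)
    show "L2_lim (\<lambda>n x. \<rho> x * \<phi> n x) m" by (rule lm)
    have "tgrad (\<lambda>x. \<rho> x * \<phi> n x) = (\<lambda>x. \<rho> x *\<^sub>R tgrad (\<phi> n) x + (- 1 / \<nu>) *\<^sub>R ((\<rho> x * \<phi> n x) *\<^sub>R b))" for n
      by (simp add: fun_eq_iff tgrad_mult[OF \<rho>1(1) t1[OF \<phi>t]] \<rho>_grad mult_ac)
    then show "L2_lim (\<lambda>n. tgrad (\<lambda>x. \<rho> x * \<phi> n x)) gm"
      using L2_lim_add[OF lg L2_lim_scaleR[OF L2_lim_scaleR_const[OF lm, of b], of "- 1 / \<nu>"]]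
      by (simp add: gm_def[abs_def])
  qed
  note mL = H10_grad_L2[OF m]
  have eq: "\<nu> * (\<integral>x. gm x \<bullet> h x \<partial>M) + (\<integral>x. m x * (b \<bullet> h x) \<partial>M) = \<nu> * (\<integral>x. (\<rho> x *\<^sub>R g x) \<bullet> h x \<partial>M)"
    if h: "h \<in> L2 \<Omega>" for h
  proof -
    have i: "integrable M (\<lambda>x. (\<rho> x *\<^sub>R g x) \<bullet> h x)"
      by (rule L2_inner_integrable[OF \<rho>L[OF L2_limD(2)[OF g]] h])
    have bh: "(\<lambda>x. b \<bullet> h x) \<in> L2 \<Omega>"
      using L2_inner_const[OF h, of b] by (simp add: inner_commute)
    note j = L2_mult_integrable[OF mL(1) bh]
    have "(\<integral>x. gm x \<bullet> h x \<partial>M) = (\<integral>x. (\<rho> x *\<^sub>R g x) \<bullet> h x + (- 1 / \<nu>) * (m x * (b \<bullet> h x)) \<partial>M)"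
      by (rule Bochner_Integration.integral_cong[OF refl]) (simp only: gm_def inner_add_left inner_scaleR_left)
    also have "\<dots> = (\<integral>x. (\<rho> x *\<^sub>R g x) \<bullet> h x \<partial>M) + (- 1 / \<nu>) * (\<integral>x. m x * (b \<bullet> h x) \<partial>M)"
      using i j by simp
    finally show ?thesis using assms by (simp add: field_simps)
  qed
  have "\<nu> * (\<integral>x. (\<rho> x *\<^sub>R g x) \<bullet> h x \<partial>M) = (\<integral>x. \<psi> x \<partial>M)" if \<psi>: "H10_grad \<psi> h" for \<psi> h
  proof -
    have t: "\<nu> * (\<integral>x. (\<rho> x *\<^sub>R g x) \<bullet> tgrad \<eta> x \<partial>M) = (\<integral>x. \<eta> x \<partial>M)" if \<eta>: "\<eta> \<in> test_functions \<Omega>" for \<eta>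
    proof -
      have "(\<lambda>n. a (\<phi> n) \<eta>) \<longlonglongrightarrow> \<nu> * (\<integral>x. (\<rho> x *\<^sub>R g x) \<bullet> tgrad \<eta> x \<partial>M)"
        unfolding a_def by (intro tendsto_mult tendsto_const L2_lim_inner[OF lg L2_lim_const] tL \<eta>)
      then show ?thesis using \<phi>l \<eta> LIMSEQ_unique by blast
    qed
    obtain \<eta> where \<eta>: "\<forall>n. \<eta> n \<in> test_functions \<Omega>" "L2_lim \<eta> \<psi>" "L2_lim (\<lambda>n. tgrad (\<eta> n)) h"
      using \<psi> by (rule H10_gradE)
    have "(\<lambda>n. \<nu> * (\<integral>x. (\<rho> x *\<^sub>R g x) \<bullet> tgrad (\<eta> n) x \<partial>M)) \<longlonglongrightarrow> \<nu> * (\<integral>x. (\<rho> x *\<^sub>R g x) \<bullet> h x \<partial>M)"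
      by (intro tendsto_mult tendsto_const L2_lim_inner[OF L2_lim_const \<eta>(3)] \<rho>L L2_limD(2)[OF g])
    moreover have "(\<lambda>n. \<integral>x. \<eta> n x * 1 \<partial>M) \<longlonglongrightarrow> (\<integral>x. \<psi> x * 1 \<partial>M)"
      by (intro L2_lim_mult[OF \<eta>(2) L2_lim_const] continuous_L2) simp
    ultimately show ?thesis
      using t[OF \<eta>(1)[rule_format]] by (simp add: LIMSEQ_unique)
  qed
  then have "solves_KFP \<nu> (\<lambda>_. b) m gm"
    unfolding solves_KFP_def using m eq[OF H10_grad_L2(2)] by simp
  then show ?thesis by blast
qed

end

section \<open>Sign and uniqueness\<close>

context bounded_open
begin

section \<open>From the weak formulations to explicit gradients\<close>

lemma L2_inner_bounded:
  assumes "b \<in> borel_measurable M" "AE x in M. norm (b x) \<le> C" "h \<in> L2 \<Omega>"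
  shows "(\<lambda>x. b x \<bullet> h x) \<in> L2 \<Omega>"
proof (rule L2_bound[OF _ assms(3), where C = C])
  show "(\<lambda>x. b x \<bullet> h x) \<in> borel_measurable M"
    using assms(1) L2_measurable[OF assms(3)] by (rule borel_measurable_inner)
  show "AE x in M. norm (b x \<bullet> h x) \<le> C * norm (h x)"
    using assms(2)
  proof eventually_elim
    case (elim x)
    have "norm (b x \<bullet> h x) \<le> norm (b x) * norm (h x)" by (simp add: Cauchy_Schwarz_ineq2)
    also have "\<dots> \<le> C * norm (h x)" using elim by (intro mult_right_mono) auto
    finally show ?case .
  qed
qed

text \<open>Shared by both equations: diffusion and lower-order term are separated while
  \<open>wgrad\<close> is replaced by given gradients. \<open>A\<close> and \<open>B\<close> stand
  for the lower-order term before and after the replacement.\<close>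

lemma integral_wgrad_eq:
  assumes u: "H10_grad u g" and \<phi>: "H10_grad \<phi> h"
    and A: "integrable M A" and B: "integrable M B" and AB: "AE x in M. A x = B x"
  shows "(\<integral>x. \<nu> * (wgrad \<Omega> u x \<bullet> wgrad \<Omega> \<phi> x) + A x \<partial>M) = \<nu> * (\<integral>x. g x \<bullet> h x \<partial>M) + (\<integral>x. B x \<partial>M)"
proof -
  have w: "H10_grad u (wgrad \<Omega> u)" "H10_grad \<phi> (wgrad \<Omega> \<phi>)"
    using u \<phi> H10_grad_wgrad H1_0_iff by blast+
  note i1 = L2_inner_integrable[OF H10_grad_L2(2)[OF w(1)] H10_grad_L2(2)[OF w(2)]]
  note i2 = L2_inner_integrable[OF H10_grad_L2(2)[OF u] H10_grad_L2(2)[OF \<phi>]]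
  have "(\<integral>x. \<nu> * (wgrad \<Omega> u x \<bullet> wgrad \<Omega> \<phi> x) + A x \<partial>M) = (\<integral>x. \<nu> * (g x \<bullet> h x) + B x \<partial>M)"
  proof (rule integral_cong_AE)
    show "AE x in M. \<nu> * (wgrad \<Omega> u x \<bullet> wgrad \<Omega> \<phi> x) + A x = \<nu> * (g x \<bullet> h x) + B x"
      using H10_grad_wgrad_AE[OF u] H10_grad_wgrad_AE[OF \<phi>] AB by eventually_elim simp
  qed (intro borel_measurable_integrable Bochner_Integration.integrable_add integrable_mult_right i1 i2 A B)+
  then show ?thesis using i2 B by simp
qed

lemma ball_H1_0_iff:
  assumes "\<And>\<phi> h. H10_grad \<phi> h \<Longrightarrow> L \<phi> = R \<phi> h"
  shows "(\<forall>\<phi>\<in>H1_0 \<Omega>. L \<phi> = c \<phi>) \<longleftrightarrow> (\<forall>\<phi> h. H10_grad \<phi> h \<longrightarrow> R \<phi> h = c \<phi>)"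
  using assms H1_0_iff by metis

lemma weak_KFP_iff_solves_KFP:
  assumes b: "b \<in> borel_measurable M" "AE x in M. norm (b x) \<le> C" and m: "H10_grad m g"
  shows "weak_KFP \<nu> \<Omega> b m \<longleftrightarrow> solves_KFP \<nu> b m g"
proof -
  have eq: "(\<integral>x. \<nu> * (wgrad \<Omega> m x \<bullet> wgrad \<Omega> \<phi> x) + m x * (b x \<bullet> wgrad \<Omega> \<phi> x) \<partial>M) =
      \<nu> * (\<integral>x. g x \<bullet> h x \<partial>M) + (\<integral>x. m x * (b x \<bullet> h x) \<partial>M)" if \<phi>: "H10_grad \<phi> h" for \<phi> h
  proof (rule integral_wgrad_eq[OF m \<phi>])
    have i: "integrable M (\<lambda>x. m x * (b x \<bullet> q x))" if "H10_grad \<phi> q" for q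
      by (rule L2_mult_integrable[OF H10_grad_L2(1)[OF m] L2_inner_bounded[OF b H10_grad_L2(2)[OF that]]])
    show "integrable M (\<lambda>x. m x * (b x \<bullet> h x))" by (rule i[OF \<phi>])
    show "integrable M (\<lambda>x. m x * (b x \<bullet> wgrad \<Omega> \<phi> x))"
      using \<phi> H1_0_iff by (intro i H10_grad_wgrad) blast
    show "AE x in M. m x * (b x \<bullet> wgrad \<Omega> \<phi> x) = m x * (b x \<bullet> h x)"
      using H10_grad_wgrad_AE[OF \<phi>] by eventually_elim simp
  qed
  show ?thesis
    unfolding weak_KFP_def solves_KFP_def by (simp only: m simp_thms) (rule ball_H1_0_iff, rule eq)
qed

text \<open>The Hamiltonians at hand depend on p alone over \<Omega>, and \<open>k\<close> is that
  function of p; it stands for the norm as well as for its regularizations.\<close>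

definition solves_HJB :: "real \<Rightarrow> ('a \<Rightarrow> real) \<Rightarrow> ('a \<Rightarrow> real) \<Rightarrow> ('a \<Rightarrow> 'a) \<Rightarrow> bool" where
  "solves_HJB \<nu> k u g \<longleftrightarrow> H10_grad u g \<and> (\<forall>\<psi> h. H10_grad \<psi> h \<longrightarrow>
    \<nu> * (\<integral>x. g x \<bullet> h x \<partial>M) + (\<integral>x. k (g x) * \<psi> x \<partial>M) = 0)"

lemma L2_hamiltonian:
  assumes "k \<in> borel_measurable borel" "\<And>p. \<bar>k p\<bar> \<le> norm p" "g \<in> L2 \<Omega>"
  shows "(\<lambda>x. k (g x)) \<in> L2 \<Omega>"
  by (rule L2_bound[OF measurable_compose[OF L2_measurable[OF assms(3)] assms(1)] assms(3), where C = 1])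
     (use assms(2) in \<open>simp add: AE_I2\<close>)

lemma weak_HJB_iff_solves_HJB:
  assumes k: "k \<in> borel_measurable borel" "\<And>p. \<bar>k p\<bar> \<le> norm p"
    and H: "\<And>x p. x \<in> \<Omega> \<Longrightarrow> H x p = k p" and u: "H10_grad u g"
  shows "weak_HJB \<nu> \<Omega> H u \<longleftrightarrow> solves_HJB \<nu> k u g"
proof -
  have eq: "(\<integral>x. \<nu> * (wgrad \<Omega> u x \<bullet> wgrad \<Omega> \<psi> x) + H x (wgrad \<Omega> u x) * \<psi> x \<partial>M) =
      \<nu> * (\<integral>x. g x \<bullet> h x \<partial>M) + (\<integral>x. k (g x) * \<psi> x \<partial>M)" if \<psi>: "H10_grad \<psi> h" for \<psi> h
  proof (rule integral_wgrad_eq[OF u \<psi>])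
    have i: "integrable M (\<lambda>x. k (q x) * \<psi> x)" if "H10_grad u q" for q
      by (rule L2_mult_integrable[OF L2_hamiltonian[OF k H10_grad_L2(2)[OF that]] H10_grad_L2(1)[OF \<psi>]])
    show "integrable M (\<lambda>x. k (g x) * \<psi> x)" by (rule i[OF u])
    have "integrable M (\<lambda>x. k (wgrad \<Omega> u x) * \<psi> x)"
      using u H1_0_iff by (intro i H10_grad_wgrad) blast
    then show "integrable M (\<lambda>x. H x (wgrad \<Omega> u x) * \<psi> x)"
      by (rule Bochner_Integration.integrable_cong[OF refl, THEN iffD1, rotated]) (simp add: H)
    show "AE x in M. H x (wgrad \<Omega> u x) * \<psi> x = k (g x) * \<psi> x"
      using H10_grad_wgrad_AE[OF u] AE_space by eventually_elim (simp add: H)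
  qed
  show ?thesis
    unfolding weak_HJB_def solves_HJB_def by (simp only: u simp_thms) (rule ball_H1_0_iff, rule eq)
qed

text \<open>As n grows, the scaled truncation detects the set where \<open>m\<close> is negative,
  while the error term of the sign estimate disappears pointwise. The constant majorants 1 and 2 are
  integrable because \<Omega> has finite measure.\<close>

lemma integral_flat_tendsto:
  assumes m: "m \<in> L2 \<Omega>"
  shows "(\<lambda>n. \<integral>x. (flat (- real (Suc n) * m x))\<^sup>2 \<partial>M) \<longlonglongrightarrow> (\<integral>x. indicator {t. t < 0} (m x) \<partial>M)"
    and "(\<lambda>n. \<integral>x. (- real (Suc n) * m x)\<^sup>2 * flat' (- real (Suc n) * m x) \<partial>M) \<longlonglongrightarrow> 0"
proof -
  have mm: "m \<in> borel_measurable M" by (rule L2_measurable[OF m])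
  have sm: "(\<lambda>x. - real (Suc n) * m x) \<in> borel_measurable M" for n
    using mm by measurable
  have top: "filterlim (\<lambda>n. - real (Suc n) * t) at_top sequentially" if "t < 0" for t
  proof -
    have "filterlim (\<lambda>n. (- t) * real (Suc n)) at_top sequentially"
      by (rule filterlim_tendsto_pos_mult_at_top[OF tendsto_const])
         (use that filterlim_compose[OF filterlim_real_sequentially filterlim_Suc] in auto)
    moreover have "(- t) * real (Suc n) = - real (Suc n) * t" for n by (simp add: algebra_simps)
    ultimately show ?thesis by (simp only:)
  qed
  show "(\<lambda>n. \<integral>x. (flat (- real (Suc n) * m x))\<^sup>2 \<partial>M) \<longlonglongrightarrow> (\<integral>x. indicator {t. t < 0} (m x) \<partial>M)"
  proof (rule integral_dominated_convergence[where w = "\<lambda>_. 1"])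
    show "(\<lambda>x. indicator {t. t < 0} (m x)) \<in> borel_measurable M"
      by (rule measurable_compose[OF mm]) simp
    show "(\<lambda>x. (flat (- real (Suc n) * m x))\<^sup>2) \<in> borel_measurable M" for n
      using measurable_compose[OF sm flat_measurable] by measurable
    show "AE x in M. (\<lambda>n. (flat (- real (Suc n) * m x))\<^sup>2) \<longlonglongrightarrow> indicator {t. t < 0} (m x)"
    proof (rule AE_I2)
      fix x
      show "(\<lambda>n. (flat (- real (Suc n) * m x))\<^sup>2) \<longlonglongrightarrow> indicator {t. t < 0} (m x)"
      proof (cases "m x < 0")
        case True
        from tendsto_power[OF filterlim_compose[OF flat_tendsto_1 top[OF True]], of 2]
        show ?thesis using True by simp
      next
        case False
        then have "flat (- real (Suc n) * m x) = 0" for n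
          by (intro flat_nonpos_eq) (simp add: mult_nonpos_nonneg)
        then show ?thesis using False by simp
      qed
    qed
    have "norm ((flat t)\<^sup>2) \<le> 1" for t
      using power_le_one[OF flat_nonneg flat_le_1, of t 2] by simp
    then show "AE x in M. norm ((flat (- real (Suc n) * m x))\<^sup>2) \<le> 1" for n
      by (intro AE_I2)
  qed simp
  have "(\<lambda>n. \<integral>x. (- real (Suc n) * m x)\<^sup>2 * flat' (- real (Suc n) * m x) \<partial>M) \<longlonglongrightarrow> (\<integral>x. 0 \<partial>M)"
  proof (rule integral_dominated_convergence[where w = "\<lambda>_. 2"])
    show "(\<lambda>x. (- real (Suc n) * m x)\<^sup>2 * flat' (- real (Suc n) * m x)) \<in> borel_measurable M" for n
      by (rule borel_measurable_times[OF borel_measurable_power[OF sm] measurable_compose[OF sm flat'_measurable]])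
    show "AE x in M. (\<lambda>n. (- real (Suc n) * m x)\<^sup>2 * flat' (- real (Suc n) * m x)) \<longlonglongrightarrow> 0"
    proof (rule AE_I2)
      fix x
      show "(\<lambda>n. (- real (Suc n) * m x)\<^sup>2 * flat' (- real (Suc n) * m x)) \<longlonglongrightarrow> 0"
      proof (cases "m x < 0")
        case True
        from filterlim_compose[OF square_times_flat'_tendsto_0 top[OF True]] show ?thesis .
      next
        case False
        then have "flat' (- real (Suc n) * m x) = 0" for n
          by (intro flat'_nonpos_eq) (simp add: mult_nonpos_nonneg)
        then show ?thesis by simp
      qed
    qed
    have "norm (t\<^sup>2 * flat' t) \<le> 2" for t
      using square_times_flat'_le_2[of t] flat'_nonneg[of t] by simp
    then show "AE x in M. norm ((- real (Suc n) * m x)\<^sup>2 * flat' (- real (Suc n) * m x)) \<le> 2" for n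
      by (intro AE_I2)
  qed simp_all
  then show "(\<lambda>n. \<integral>x. (- real (Suc n) * m x)\<^sup>2 * flat' (- real (Suc n) * m x) \<partial>M) \<longlonglongrightarrow> 0" by simp
qed

lemma L2_flat'_mult:
  assumes "u \<in> L2 \<Omega>" "g \<in> L2 \<Omega>"
  shows "(\<lambda>x. flat' (c * u x) *\<^sub>R g x) \<in> L2 \<Omega>"
proof (rule L2_mult_bounded[OF assms(2), where C = 4])
  show "(\<lambda>x. flat' (c * u x)) \<in> borel_measurable M"
    by (rule measurable_compose[OF _ flat'_measurable]) (use L2_measurable[OF assms(1)] in measurable)
  show "AE x in M. \<bar>flat' (c * u x)\<bar> \<le> 4"
    using flat'_nonneg flat'_le_4 by (intro AE_I2) simp
qed

text \<open>Testing with \<open>flat (- n * m)\<close> bounds the integral of \<open>(flat (- n * m))\<^sup>2\<close> by that of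
  \<open>(n * m)\<^sup>2 * flat' (- n * m)\<close>, which vanishes as \<open>n \<rightarrow> \<infinity>\<close>.\<close>

lemma KFP_nonneg:
  assumes \<nu>: "0 < \<nu>" and b: "b \<in> borel_measurable M" "AE x in M. norm (b x) \<le> 1"
    and s: "solves_KFP \<nu> b m g"
  shows "AE x in M. 0 \<le> m x"
proof -
  have m: "H10_grad m g" using s by (simp add: solves_KFP_def)
  note mL = H10_grad_L2[OF m]
  obtain C where C: "C > 0" "\<forall>u g. H10_grad u g \<longrightarrow> (\<integral>x. (u x)\<^sup>2 \<partial>M) \<le> C * (sqnorm g)"
    using H10_Poincare by blast
  have bound: "(\<integral>x. (flat (- real (Suc n) * m x))\<^sup>2 \<partial>M) \<le>
      4 * C / \<nu>\<^sup>2 * (\<integral>x. (- real (Suc n) * m x)\<^sup>2 * flat' (- real (Suc n) * m x) \<partial>M)" for n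
  proof -
    define c where "c = real (Suc n)"
    have c: "0 < c" by (simp add: c_def)
    define F where "F x = flat' (- c * m x)" for x
    have F: "0 \<le> F x" "F x \<le> 4" for x by (simp_all only: F_def flat'_nonneg flat'_le_4)
    have t: "H10_grad (\<lambda>x. flat (- c * m x)) (\<lambda>x. (- c * F x) *\<^sub>R g x)"
      using H10_grad_flat[OF m, of "- c"] by (simp only: F_def)
    have FgL: "(\<lambda>x. F x *\<^sub>R g x) \<in> L2 \<Omega>" and FmL: "(\<lambda>x. F x * m x) \<in> L2 \<Omega>"
      using L2_flat'_mult[OF mL(1) mL(2), of "- c"] L2_flat'_mult[OF mL(1) mL(1), of "- c"]
      by (simp_all only: F_def real_scaleR_def)
    have iG: "integrable M (\<lambda>x. F x * (norm (g x))\<^sup>2)"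
      using L2_inner_integrable[OF FgL mL(2)] by (simp add: power2_norm_eq_inner)
    have im: "integrable M (\<lambda>x. F x * (m x)\<^sup>2)"
      using L2_mult_integrable[OF FmL mL(1)] by (simp add: power2_eq_square mult.assoc)
    have ib: "integrable M (\<lambda>x. F x * (m x * (b x \<bullet> g x)))"
      using L2_mult_integrable[OF FmL L2_inner_bounded[OF b mL(2)]] by (simp add: mult.assoc)
    define G where "G = (\<integral>x. F x * (norm (g x))\<^sup>2 \<partial>M)"
    define Q where "Q = (\<integral>x. F x * (m x)\<^sup>2 \<partial>M)"
    have "\<nu> * (\<integral>x. g x \<bullet> ((- c * F x) *\<^sub>R g x) \<partial>M) + (\<integral>x. m x * (b x \<bullet> ((- c * F x) *\<^sub>R g x)) \<partial>M)
        = (\<integral>x. flat (- c * m x) \<partial>M)"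
      using s t unfolding solves_KFP_def by blast
    moreover have "(\<integral>x. g x \<bullet> ((- c * F x) *\<^sub>R g x) \<partial>M) = - c * G"
    proof -
      have "g x \<bullet> ((- c * F x) *\<^sub>R g x) = - c * (F x * (norm (g x))\<^sup>2)" for x
        by (simp add: power2_norm_eq_inner)
      then show ?thesis by (simp only: G_def integral_mult_right_zero)
    qed
    moreover have "(\<integral>x. m x * (b x \<bullet> ((- c * F x) *\<^sub>R g x)) \<partial>M) = - c * (\<integral>x. F x * (m x * (b x \<bullet> g x)) \<partial>M)"
    proof -
      have "m x * (b x \<bullet> ((- c * F x) *\<^sub>R g x)) = - c * (F x * (m x * (b x \<bullet> g x)))" for x by simp
      then show ?thesis by (simp only: integral_mult_right_zero)
    qed
    ultimately have "\<nu> * (- c * G) + - c * (\<integral>x. F x * (m x * (b x \<bullet> g x)) \<partial>M) = (\<integral>x. flat (- c * m x) \<partial>M)"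
      by (simp only:)
    moreover have "0 \<le> (\<integral>x. flat (- c * m x) \<partial>M)" by (simp add: flat_nonneg)
    moreover have "\<nu> * (- c * G) + - c * (\<integral>x. F x * (m x * (b x \<bullet> g x)) \<partial>M) =
        c * (- (\<integral>x. F x * (m x * (b x \<bullet> g x)) \<partial>M)) - c * (\<nu> * G)"
      by (simp only: mult_minus_left mult_minus_right mult.left_commute)
    ultimately have "c * (\<nu> * G) \<le> c * (- (\<integral>x. F x * (m x * (b x \<bullet> g x)) \<partial>M))" by linarith
    then have "\<nu> * G \<le> - (\<integral>x. F x * (m x * (b x \<bullet> g x)) \<partial>M)"
      by (simp only: mult_le_cancel_left_pos[OF c])
    also have "\<dots> = (\<integral>x. - (F x * (m x * (b x \<bullet> g x))) \<partial>M)" by simp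
    \<comment> \<open>Young's inequality, balanced so that half of \<open>\<nu> * G\<close> is
      absorbed on the left. The weight \<open>F\<close> confines both terms to the set where
      \<open>m\<close> is negative.\<close>
    also have "\<dots> \<le> (\<integral>x. (\<nu> / 2) * (F x * (norm (g x))\<^sup>2) + (1 / (2 * \<nu>)) * (F x * (m x)\<^sup>2) \<partial>M)"
    proof (rule integral_mono_AE)
      show "integrable M (\<lambda>x. - (F x * (m x * (b x \<bullet> g x))))" using ib by simp
      show "integrable M (\<lambda>x. (\<nu> / 2) * (F x * (norm (g x))\<^sup>2) + (1 / (2 * \<nu>)) * (F x * (m x)\<^sup>2))"
        by (intro Bochner_Integration.integrable_add integrable_mult_right iG im)
      show "AE x in M. - (F x * (m x * (b x \<bullet> g x))) \<le> (\<nu> / 2) * (F x * (norm (g x))\<^sup>2) + (1 / (2 * \<nu>)) * (F x * (m x)\<^sup>2)"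
        using b(2)
      proof eventually_elim
        case (elim x)
        have "\<bar>b x \<bullet> g x\<bar> \<le> norm (b x) * norm (g x)" by (rule Cauchy_Schwarz_ineq2)
        also have "\<dots> \<le> 1 * norm (g x)" using elim by (intro mult_right_mono) auto
        finally have "\<bar>m x\<bar> * \<bar>b x \<bullet> g x\<bar> \<le> \<bar>m x\<bar> * norm (g x)" by (intro mult_left_mono) auto
        moreover have "- (m x * (b x \<bullet> g x)) \<le> \<bar>m x\<bar> * \<bar>b x \<bullet> g x\<bar>"
          using abs_ge_minus_self[of "m x * (b x \<bullet> g x)"] by (simp add: abs_mult)
        moreover have "\<bar>m x\<bar> * norm (g x) \<le> (\<nu> / 2) * (norm (g x))\<^sup>2 + (1 / (2 * \<nu>)) * (m x)\<^sup>2"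
        proof -
          have "0 \<le> (\<nu> * norm (g x) - \<bar>m x\<bar>)\<^sup>2 / (2 * \<nu>)" using \<nu> by simp
          also have "\<dots> = (\<nu> / 2) * (norm (g x))\<^sup>2 + (1 / (2 * \<nu>)) * (m x)\<^sup>2 - \<bar>m x\<bar> * norm (g x)"
            using \<nu> by (simp add: power2_diff power_mult_distrib add_divide_distrib diff_divide_distrib) (simp add: power2_eq_square field_simps)
          finally show ?thesis by simp
        qed
        ultimately have "- (m x * (b x \<bullet> g x)) \<le> (\<nu> / 2) * (norm (g x))\<^sup>2 + (1 / (2 * \<nu>)) * (m x)\<^sup>2" by linarith
        from mult_left_mono[OF this F(1)[of x]] show ?case by (simp add: algebra_simps)
      qed
    qed
    also have "\<dots> = (\<nu> / 2) * G + (1 / (2 * \<nu>)) * Q"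
      using iG im by (simp add: G_def Q_def)
    finally have GQ: "G \<le> Q / \<nu>\<^sup>2" using \<nu> by (simp add: field_simps power2_eq_square)
    have G0: "0 \<le> G" unfolding G_def using F(1) by (intro integral_nonneg_AE AE_I2) simp
    have "(\<integral>x. (flat (- c * m x))\<^sup>2 \<partial>M) \<le> C * (sqnorm (\<lambda>x. (- c * F x) *\<^sub>R g x))"
      using C(2) t by blast
    also have "(sqnorm (\<lambda>x. (- c * F x) *\<^sub>R g x)) \<le> (\<integral>x. 4 * c\<^sup>2 * (F x * (norm (g x))\<^sup>2) \<partial>M)"
    proof (rule integral_mono)
      show "integrable M (\<lambda>x. (norm ((- c * F x) *\<^sub>R g x))\<^sup>2)"
        by (rule L2_square_integrable[OF H10_grad_L2(2)[OF t]])
      show "integrable M (\<lambda>x. 4 * c\<^sup>2 * (F x * (norm (g x))\<^sup>2))" by (intro integrable_mult_right iG)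
      fix x
      \<comment> \<open>The squared gradient of the test function contains F^2, while the energy
        estimate controls F |g|^2; the bound 4 on \<open>flat'\<close> closes the gap.\<close>
      have "F x * F x \<le> 4 * F x" using F[of x] by (intro mult_right_mono) auto
      then have "c\<^sup>2 * (norm (g x))\<^sup>2 * (F x * F x) \<le> c\<^sup>2 * (norm (g x))\<^sup>2 * (4 * F x)"
        by (intro mult_left_mono) auto
      then show "(norm ((- c * F x) *\<^sub>R g x))\<^sup>2 \<le> 4 * c\<^sup>2 * (F x * (norm (g x))\<^sup>2)"
        by (simp add: power_mult_distrib power2_eq_square mult_ac)
    qed
    also have "\<dots> = 4 * c\<^sup>2 * G" by (simp add: G_def)
    also have "\<dots> \<le> 4 * c\<^sup>2 * (Q / \<nu>\<^sup>2)" using GQ by (intro mult_left_mono) auto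
    finally have "(\<integral>x. (flat (- c * m x))\<^sup>2 \<partial>M) \<le> C * (4 * c\<^sup>2 * (Q / \<nu>\<^sup>2))"
      using C(1) by simp
    also have "\<dots> = 4 * C / \<nu>\<^sup>2 * (c\<^sup>2 * Q)" by simp
    also have "c\<^sup>2 * Q = (\<integral>x. (- c * m x)\<^sup>2 * flat' (- c * m x) \<partial>M)"
    proof -
      have "(- c * m x)\<^sup>2 * flat' (- c * m x) = c\<^sup>2 * (F x * (m x)\<^sup>2)" for x
        by (simp add: F_def power_mult_distrib)
      then show ?thesis by (simp only: Q_def integral_mult_right_zero)
    qed
    finally show ?thesis by (simp only: c_def)
  qed
  have "(\<integral>x. indicator {t. t < 0} (m x) \<partial>M) \<le> 4 * C / \<nu>\<^sup>2 * 0"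
    by (rule LIMSEQ_le[OF integral_flat_tendsto(1)[OF mL(1)]
          tendsto_mult[OF tendsto_const integral_flat_tendsto(2)[OF mL(1)]]])
       (use bound in blast)
  then have i0: "(\<integral>x. indicator {t. t < 0} (m x) \<partial>M) = (0::real)"
    by (intro order_antisym integral_nonneg_AE) simp_all
  have "integrable M (\<lambda>x. indicator {t. t < 0} (m x) :: real)"
    by (rule integrable_const_bound[where B = 1])
       (auto intro: measurable_compose[OF L2_measurable[OF mL(1)]] simp: indicator_def)
  from integral_nonneg_eq_0_iff_AE[OF this] i0
  have "AE x in M. indicator {t. t < 0} (m x) = (0::real)" by simp
  then show ?thesis by eventually_elim (auto simp: indicator_def split: if_splits)
qed

text \<open>Testing with the truncation of \<open>v\<close> leaves two nonnegative terms with sum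
  zero: the diffusion, and the Hamiltonian, which is at least \<beta> \<bullet> p, a lower bound
  whose integral against the truncation is 0. So the truncation has zero gradient and vanishes by
  the Poincare inequality.\<close>

lemma HJB_nonpos:
  assumes \<nu>: "0 < \<nu>" and k: "k \<in> borel_measurable borel" "\<And>p. \<bar>k p\<bar> \<le> norm p"
    and \<beta>: "\<And>p. \<beta> \<bullet> p \<le> k p" and s: "solves_HJB \<nu> k v g"
  shows "AE x in M. v x \<le> 0"
proof -
  have v: "H10_grad v g" using s by (simp add: solves_HJB_def)
  note vL = H10_grad_L2[OF v]
  have t: "H10_grad (\<lambda>x. flat (v x)) (\<lambda>x. flat' (v x) *\<^sub>R g x)"
    using H10_grad_flat[OF v, of 1] by simp
  note tL = H10_grad_L2[OF t]
  have iG: "integrable M (\<lambda>x. flat' (v x) * (norm (g x))\<^sup>2)"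
    using L2_inner_integrable[OF tL(2) vL(2)] by (simp add: power2_norm_eq_inner)
  have "(\<integral>x. flat (v x) * (g x \<bullet> \<beta>) \<partial>M) \<le> (\<integral>x. k (g x) * flat (v x) \<partial>M)"
  proof (rule integral_mono)
    show "integrable M (\<lambda>x. flat (v x) * (g x \<bullet> \<beta>))"
      by (rule L2_mult_integrable[OF tL(1) L2_inner_const[OF vL(2)]])
    show "integrable M (\<lambda>x. k (g x) * flat (v x))"
      by (rule L2_mult_integrable[OF L2_hamiltonian[OF k vL(2)] tL(1)])
    show "flat (v x) * (g x \<bullet> \<beta>) \<le> k (g x) * flat (v x)" for x
      using mult_left_mono[OF \<beta>[of "g x"] flat_nonneg[of "v x"]] by (simp add: inner_commute mult.commute)
  qed
  then have "0 \<le> (\<integral>x. k (g x) * flat (v x) \<partial>M)"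
    by (simp only: H10_integral_flat_grad_eq_0[OF v])
  moreover have "\<nu> * (\<integral>x. g x \<bullet> (flat' (v x) *\<^sub>R g x) \<partial>M) + (\<integral>x. k (g x) * flat (v x) \<partial>M) = 0"
    using s t unfolding solves_HJB_def by blast
  moreover have "(\<integral>x. g x \<bullet> (flat' (v x) *\<^sub>R g x) \<partial>M) = (\<integral>x. flat' (v x) * (norm (g x))\<^sup>2 \<partial>M)"
    by (simp add: power2_norm_eq_inner)
  ultimately have "0 \<le> (\<integral>x. k (g x) * flat (v x) \<partial>M)"
    "\<nu> * (\<integral>x. flat' (v x) * (norm (g x))\<^sup>2 \<partial>M) = - (\<integral>x. k (g x) * flat (v x) \<partial>M)"
    by (simp_all only: eq_neg_iff_add_eq_0)
  then have "\<nu> * (\<integral>x. flat' (v x) * (norm (g x))\<^sup>2 \<partial>M) \<le> 0" by simp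
  then have G: "(\<integral>x. flat' (v x) * (norm (g x))\<^sup>2 \<partial>M) \<le> 0"
    using \<nu> by (simp add: mult_le_0_iff)
  have "(sqnorm (\<lambda>x. flat' (v x) *\<^sub>R g x)) \<le> (\<integral>x. 4 * (flat' (v x) * (norm (g x))\<^sup>2) \<partial>M)"
  proof (rule integral_mono[OF L2_square_integrable[OF tL(2)] integrable_mult_right[OF iG]])
    fix x
    have "flat' (v x) * flat' (v x) \<le> 4 * flat' (v x)"
      by (intro mult_right_mono flat'_nonneg flat'_le_4)
    then have "flat' (v x) * flat' (v x) * (norm (g x))\<^sup>2 \<le> 4 * flat' (v x) * (norm (g x))\<^sup>2"
      by (rule mult_right_mono) simp
    then show "(norm (flat' (v x) *\<^sub>R g x))\<^sup>2 \<le> 4 * (flat' (v x) * (norm (g x))\<^sup>2)"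
      by (simp add: power_mult_distrib power2_eq_square mult_ac)
  qed
  also have "\<dots> \<le> 0" using G by simp
  finally have "AE x in M. flat (v x) = 0" by (rule H10_AE_eq_0[OF t])
  then show ?thesis
  proof eventually_elim
    case (elim x)
    then show ?case using flat_pos[of "v x"] by (cases "0 < v x") auto
  qed
qed

text \<open>Energy method: the difference of the solutions is an admissible test function, and a
  constant drift contributes nothing to its energy, so its gradient vanishes.\<close>

lemma KFP_constant_drift_unique:
  assumes \<nu>: "0 < \<nu>" and s: "solves_KFP \<nu> (\<lambda>_. b) m g" "solves_KFP \<nu> (\<lambda>_. b) w h"
  shows "AE x in M. m x = w x"
proof -
  have m: "H10_grad m g" and w: "H10_grad w h" using s by (simp_all add: solves_KFP_def)
  define z where "z x = m x - w x" for x
  define f where "f x = g x - h x" for x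
  have z: "H10_grad z f"
    unfolding z_def[abs_def] f_def[abs_def] by (rule H10_grad_diff[OF m w])
  note zL = H10_grad_L2[OF z]
  have bf: "(\<lambda>x. b \<bullet> f x) \<in> L2 \<Omega>" using L2_inner_const[OF zL(2), of b] by (simp add: inner_commute)
  have e1: "\<nu> * (\<integral>x. g x \<bullet> f x \<partial>M) + (\<integral>x. m x * (b \<bullet> f x) \<partial>M) = (\<integral>x. z x \<partial>M)"
    and e2: "\<nu> * (\<integral>x. h x \<bullet> f x \<partial>M) + (\<integral>x. w x * (b \<bullet> f x) \<partial>M) = (\<integral>x. z x \<partial>M)"
    using s z unfolding solves_KFP_def by blast+
  have "(\<integral>x. f x \<bullet> f x \<partial>M) = (\<integral>x. g x \<bullet> f x \<partial>M) - (\<integral>x. h x \<bullet> f x \<partial>M)"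
    using L2_inner_integrable[OF H10_grad_L2(2)[OF m] zL(2)] L2_inner_integrable[OF H10_grad_L2(2)[OF w] zL(2)]
    by (subst Bochner_Integration.integral_diff[symmetric]) (simp_all add: f_def inner_diff_left)
  moreover have "(\<integral>x. z x * (b \<bullet> f x) \<partial>M) = (\<integral>x. m x * (b \<bullet> f x) \<partial>M) - (\<integral>x. w x * (b \<bullet> f x) \<partial>M)"
    using L2_mult_integrable[OF H10_grad_L2(1)[OF m] bf] L2_mult_integrable[OF H10_grad_L2(1)[OF w] bf]
    by (subst Bochner_Integration.integral_diff[symmetric]) (simp_all add: z_def left_diff_distrib)
  moreover have "(\<integral>x. z x * (b \<bullet> f x) \<partial>M) = 0"
    using H10_grad_integral_self_eq_0[OF z, of b] by (simp add: inner_commute)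
  ultimately have "\<nu> * (\<integral>x. f x \<bullet> f x \<partial>M) = 0"
    using e1 e2 by (simp only: right_diff_distrib)
  then have "(sqnorm f) \<le> 0" using \<nu> by (simp add: power2_norm_eq_inner)
  from H10_AE_eq_0[OF z this] show ?thesis by (simp add: z_def)
qed

text \<open>Testing each equation with the solution of the other one makes the diffusion terms cancel;
  convexity then gives \<open>v\<close> a nonnegative integral, while \<open>v \<le> 0\<close>.\<close>

lemma MFG_value_function_eq_0:
  assumes \<nu>: "0 < \<nu>" and k: "k \<in> borel_measurable borel" "\<And>p. \<bar>k p\<bar> \<le> norm p"
    and \<beta>: "\<And>p. \<beta> \<bullet> p \<le> k p"
    and D: "D \<in> borel_measurable borel" "\<And>p. norm (D p) \<le> 1" "\<And>p. k p \<le> D p \<bullet> p"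
    and v: "solves_HJB \<nu> k v g" and w: "solves_KFP \<nu> (\<lambda>x. D (g x)) w h"
  shows "AE x in M. v x = 0"
proof -
  have vg: "H10_grad v g" and wh: "H10_grad w h"
    using v w by (simp_all add: solves_HJB_def solves_KFP_def)
  note vL = H10_grad_L2[OF vg] and wL = H10_grad_L2[OF wh]
  have b: "(\<lambda>x. D (g x)) \<in> borel_measurable M" "AE x in M. norm (D (g x)) \<le> 1"
    using measurable_compose[OF L2_measurable[OF vL(2)] D(1)] D(2) by (simp_all add: AE_I2)
  have w0: "AE x in M. 0 \<le> w x" by (rule KFP_nonneg[OF \<nu> b w])
  have v0: "AE x in M. v x \<le> 0" by (rule HJB_nonpos[OF \<nu> k \<beta> v])
  have e1: "\<nu> * (\<integral>x. g x \<bullet> h x \<partial>M) + (\<integral>x. k (g x) * w x \<partial>M) = 0"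
    using v wh unfolding solves_HJB_def by blast
  have e2: "\<nu> * (\<integral>x. h x \<bullet> g x \<partial>M) + (\<integral>x. w x * (D (g x) \<bullet> g x) \<partial>M) = (\<integral>x. v x \<partial>M)"
    using w vg unfolding solves_KFP_def by blast
  \<comment> \<open>The inequality k(p) \<le> D(p) \<bullet> p may be multiplied by
    \<open>w\<close>, because \<open>w\<close> is nonnegative.\<close>
  have "(\<integral>x. k (g x) * w x \<partial>M) \<le> (\<integral>x. w x * (D (g x) \<bullet> g x) \<partial>M)"
  proof (rule integral_mono_AE)
    show "integrable M (\<lambda>x. k (g x) * w x)"
      by (rule L2_mult_integrable[OF L2_hamiltonian[OF k vL(2)] wL(1)])
    show "integrable M (\<lambda>x. w x * (D (g x) \<bullet> g x))"
      by (rule L2_mult_integrable[OF wL(1) L2_inner_bounded[OF b vL(2)]])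
    show "AE x in M. k (g x) * w x \<le> w x * (D (g x) \<bullet> g x)"
      using w0
    proof eventually_elim
      case (elim x)
      from mult_left_mono[OF D(3)[of "g x"] this] show ?case by (simp add: mult.commute)
    qed
  qed
  moreover have "(\<integral>x. h x \<bullet> g x \<partial>M) = (\<integral>x. g x \<bullet> h x \<partial>M)" by (simp only: inner_commute)
  ultimately have ge: "0 \<le> (\<integral>x. v x \<partial>M)" using e1 e2 by simp
  have iv: "integrable M (\<lambda>x. - v x)" using L2_integrable[OF vL(1)] by simp
  have nn: "AE x in M. 0 \<le> - v x" using v0 by eventually_elim simp
  have "0 \<le> (\<integral>x. - v x \<partial>M)" by (rule integral_nonneg_AE[OF nn])
  with ge have "(\<integral>x. - v x \<partial>M) = 0" by simp
  with integral_nonneg_eq_0_iff_AE[OF iv nn] have "AE x in M. - v x = 0" by simp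
  then show ?thesis by simp
qed

lemma solves_KFP_cong_AE:
  assumes b: "b \<in> borel_measurable M" "AE x in M. norm (b x) \<le> 1"
    and c: "c \<in> borel_measurable M" "AE x in M. norm (c x) \<le> 1"
    and eq: "AE x in M. b x = c x" and s: "solves_KFP \<nu> b m g"
  shows "solves_KFP \<nu> c m g"
proof -
  have m: "H10_grad m g" using s by (simp add: solves_KFP_def)
  show ?thesis
    unfolding solves_KFP_def
  proof (intro conjI m allI impI)
    fix \<phi> q assume \<phi>: "H10_grad \<phi> q"
    note qL = H10_grad_L2(2)[OF \<phi>]
    have "(\<integral>x. m x * (c x \<bullet> q x) \<partial>M) = (\<integral>x. m x * (b x \<bullet> q x) \<partial>M)"
    proof (rule integral_cong_AE)
      show "AE x in M. m x * (c x \<bullet> q x) = m x * (b x \<bullet> q x)"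
        using eq by eventually_elim simp
    qed (rule borel_measurable_integrable[OF L2_mult_integrable[OF H10_grad_L2(1)[OF m] L2_inner_bounded[OF c qL]]],
         rule borel_measurable_integrable[OF L2_mult_integrable[OF H10_grad_L2(1)[OF m] L2_inner_bounded[OF b qL]]])
    then show "\<nu> * (\<integral>x. g x \<bullet> q x \<partial>M) + (\<integral>x. m x * (c x \<bullet> q x) \<partial>M) = (\<integral>x. \<phi> x \<partial>M)"
      using s \<phi> unfolding solves_KFP_def by simp
  qed
qed

lemma MFG_solution_unique:
  assumes \<nu>: "0 < \<nu>" and k: "k \<in> borel_measurable borel" "\<And>p. \<bar>k p\<bar> \<le> norm p"
    and \<beta>: "\<And>p. D 0 \<bullet> p \<le> k p"
    and D: "D \<in> borel_measurable borel" "\<And>p. norm (D p) \<le> 1" "\<And>p. k p \<le> D p \<bullet> p"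
    and v: "solves_HJB \<nu> k v g" and w: "solves_KFP \<nu> (\<lambda>x. D (g x)) w h"
    and m: "solves_KFP \<nu> (\<lambda>_. D 0) m f"
  shows "AE x in M. v x = 0" "AE x in M. w x = m x"
proof -
  show v0: "AE x in M. v x = 0"
    by (rule MFG_value_function_eq_0[OF \<nu> k \<beta> D v w])
  have vg: "H10_grad v g" and wh: "H10_grad w h"
    using v w by (simp_all add: solves_HJB_def solves_KFP_def)
  \<comment> \<open>A function that is zero almost everywhere has zero gradient almost everywhere,
    so the drift is the constant \<open>D 0\<close> up to a null set.\<close>
  have g0: "AE x in M. g x = 0" by (rule H10_grad_unique[OF vg H10_grad_zero v0])
  have b: "(\<lambda>x. D (g x)) \<in> borel_measurable M" "AE x in M. norm (D (g x)) \<le> 1"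
    using measurable_compose[OF L2_measurable[OF H10_grad_L2(2)[OF vg]] D(1)] D(2) by (simp_all add: AE_I2)
  have "solves_KFP \<nu> (\<lambda>_. D 0) w h"
  proof (rule solves_KFP_cong_AE[OF b _ _ _ w])
    show "AE x in M. D (g x) = D 0" using g0 by eventually_elim simp
  qed (use D(2) in simp_all)
  then show "AE x in M. w x = m x" by (rule KFP_constant_drift_unique[OF \<nu> _ m])
qed

lemma KFP_solutions_distinct:
  assumes ne: "\<Omega> \<noteq> {}" and i: "i \<in> Basis" and c: "c \<noteq> 0"
    and s: "solves_KFP \<nu> (\<lambda>_. 0) m1 g1" "solves_KFP \<nu> (\<lambda>_. c *\<^sub>R i) m2 g2"
  shows "\<not> (AE x in M. m1 x = m2 x)"
proof
  assume eq: "AE x in M. m1 x = m2 x"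
  have m1: "H10_grad m1 g1" and m2: "H10_grad m2 g2" using s by (simp_all add: solves_KFP_def)
  note L1 = H10_grad_L2[OF m1] and L2' = H10_grad_L2[OF m2]
  have geq: "AE x in M. g1 x = g2 x" by (rule H10_grad_unique[OF m1 m2 eq])
  have "AE x in M. g2 x \<bullet> i = 0"
  proof (rule AE_eq_0_if_test_integrals_eq_0)
    show "(\<lambda>x. g2 x \<bullet> i) \<in> L1loc \<Omega>"
      by (rule L2_imp_L1loc[OF L2_inner_const[OF L2'(2)]])
    fix \<phi> assume \<phi>: "\<phi> \<in> test_functions \<Omega>"
    note t = H10_grad_test[OF \<phi>]
    have "\<nu> * (\<integral>x. g1 x \<bullet> tgrad \<phi> x \<partial>M) + (\<integral>x. m1 x * (0 \<bullet> tgrad \<phi> x) \<partial>M) = (\<integral>x. \<phi> x \<partial>M)"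
      and e2: "\<nu> * (\<integral>x. g2 x \<bullet> tgrad \<phi> x \<partial>M) + (\<integral>x. m2 x * ((c *\<^sub>R i) \<bullet> tgrad \<phi> x) \<partial>M) = (\<integral>x. \<phi> x \<partial>M)"
      using s t unfolding solves_KFP_def by blast+
    moreover have "(\<integral>x. g1 x \<bullet> tgrad \<phi> x \<partial>M) = (\<integral>x. g2 x \<bullet> tgrad \<phi> x \<partial>M)"
    proof (rule integral_cong_AE)
      show "AE x in M. g1 x \<bullet> tgrad \<phi> x = g2 x \<bullet> tgrad \<phi> x"
        using geq by eventually_elim simp
    qed (rule borel_measurable_integrable[OF L2_inner_integrable[OF L1(2) test_functions_L2(2)[OF \<phi>]]],
         rule borel_measurable_integrable[OF L2_inner_integrable[OF L2'(2) test_functions_L2(2)[OF \<phi>]]])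
    \<comment> \<open>With equal gradients, the two equations differ only in this drift
      term.\<close>
    ultimately have "(\<integral>x. m2 x * ((c *\<^sub>R i) \<bullet> tgrad \<phi> x) \<partial>M) = 0" by simp
    moreover have "m2 x * ((c *\<^sub>R i) \<bullet> tgrad \<phi> x) = c * (m2 x * (tgrad \<phi> x \<bullet> i))" for x
      by (simp add: inner_commute)
    ultimately have "(\<integral>x. m2 x * (tgrad \<phi> x \<bullet> i) \<partial>M) = 0"
      using c by (simp only: integral_mult_right_zero mult_eq_0_iff simp_thms)
    then show "(\<integral>x. \<phi> x * (g2 x \<bullet> i) \<partial>M) = 0"
      using H10_grad_integral_by_parts[OF m2 t, of i] by (simp add: mult.commute)
  qed
  then have "(\<integral>x. (g2 x \<bullet> i)\<^sup>2 \<partial>M) = 0"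
    using L2_AE_eq_0_iff[OF L2_inner_const[OF L2'(2), of i]] by simp
  moreover obtain C where "\<forall>u g i. H10_grad u g \<longrightarrow> i \<in> Basis \<longrightarrow> (\<integral>x. (u x)\<^sup>2 \<partial>M) \<le> C * (\<integral>x. (g x \<bullet> i)\<^sup>2 \<partial>M)"
    using H10_Poincare_directional by blast
  ultimately have "(\<integral>x. (m2 x)\<^sup>2 \<partial>M) \<le> 0" using m2 i by fastforce
  then have "(sqnorm m2) = 0" by (simp add: order_antisym)
  then have m20: "AE x in M. m2 x = 0" using L2_AE_eq_0_iff[OF L2'(1)] by simp
  with eq have m10: "AE x in M. m1 x = 0" by eventually_elim simp
  have g10: "AE x in M. g1 x = 0" by (rule H10_grad_unique[OF m1 H10_grad_zero m10])
  \<comment> \<open>The contradiction comes from the source: a vanishing density makes every test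
    function integrate to 0, and the fundamental lemma then forces the constant 1 to vanish on a
    nonempty open set.\<close>
  have "AE x in M. (1::real) = 0"
  proof (rule AE_eq_0_if_test_integrals_eq_0)
    show "(\<lambda>_. 1) \<in> L1loc \<Omega>" by (rule L2_imp_L1loc[OF continuous_L2]) simp
    fix \<phi> assume \<phi>: "\<phi> \<in> test_functions \<Omega>"
    have "(\<integral>x. g1 x \<bullet> tgrad \<phi> x \<partial>M) = (\<integral>x. 0 \<partial>M)"
    proof (rule integral_cong_AE)
      show "AE x in M. g1 x \<bullet> tgrad \<phi> x = 0" using g10 by eventually_elim simp
    qed (rule borel_measurable_integrable[OF L2_inner_integrable[OF L1(2) test_functions_L2(2)[OF \<phi>]]], simp)
    moreover have "\<nu> * (\<integral>x. g1 x \<bullet> tgrad \<phi> x \<partial>M) + (\<integral>x. m1 x * (0 \<bullet> tgrad \<phi> x) \<partial>M) = (\<integral>x. \<phi> x \<partial>M)"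
      using s(1) H10_grad_test[OF \<phi>] unfolding solves_KFP_def by blast
    ultimately show "(\<integral>x. \<phi> x * 1 \<partial>M) = 0" by simp
  qed
  then have "AE x in lebesgue. x \<notin> \<Omega>" by (simp add: AE_restrict_space_iff)
  then have "negligible \<Omega>"
    by (simp add: completion.AE_iff_null_sets negligible_iff_null_sets)
  then show False using open_not_negligible[OF open_Omega ne] by simp
qed

end

section \<open>Regularized Hamiltonians\<close>

text \<open>The constant is subtracted so that \<open>reg_norm t a 0 = 0\<close>; the gradient at \<open>0\<close> is
  \<open>a / sqrt (|a|\<^sup>2 + 1)\<close> for every \<open>t > 0\<close>, so \<open>a\<close> selects the drift in the limit.\<close>

definition reg_norm :: "real \<Rightarrow> 'a::euclidean_space \<Rightarrow> 'a \<Rightarrow> real" where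
  "reg_norm t a p = norm (p + t *\<^sub>R a, t) - norm (t *\<^sub>R a, t)"

text \<open>In the product space \<open>sgn\<close> is the gradient of the norm off the origin, and
  its first component is the part belonging to p. For t > 0 the point is off the origin whatever p
  is.\<close>

definition reg_drift :: "real \<Rightarrow> 'a::euclidean_space \<Rightarrow> 'a \<Rightarrow> 'a" where
  "reg_drift t a p = fst (sgn (p + t *\<^sub>R a, t))"

lemma reg_norm_0: "reg_norm t a 0 = 0"
  by (simp add: reg_norm_def)

lemma reg_norm_Lipschitz: "\<bar>reg_norm t a p - reg_norm t a q\<bar> \<le> norm (p - q)"
proof -
  have "\<bar>reg_norm t a p - reg_norm t a q\<bar> \<le> norm ((p + t *\<^sub>R a, t) - (q + t *\<^sub>R a, t))"
    using norm_triangle_ineq3[of "(p + t *\<^sub>R a, t)" "(q + t *\<^sub>R a, t)"] by (simp add: reg_norm_def)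
  also have "\<dots> = norm (p - q)" by (simp add: norm_Pair)
  finally show ?thesis .
qed

lemma abs_reg_norm_le: "\<bar>reg_norm t a p\<bar> \<le> norm p"
  using reg_norm_Lipschitz[of t a p 0] by (simp add: reg_norm_0)

text \<open>The shift \<open>(t *\<^sub>R a, t)\<close> has norm at most 2 t and enters twice, once
  inside the norm and once as the subtracted constant.\<close>

lemma reg_norm_approx:
  assumes "0 \<le> t" "norm a \<le> 1" shows "\<bar>reg_norm t a p - norm p\<bar> \<le> 4 * t"
proof -
  have "norm (t *\<^sub>R a, t) \<le> norm (t *\<^sub>R a) + norm t" by (rule norm_Pair_le)
  also have "\<dots> \<le> 2 * t" using mult_left_mono[OF assms(2,1)] assms(1) by simp
  finally have b: "norm (t *\<^sub>R a, t) \<le> 2 * t" .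
  have "\<bar>norm (p + t *\<^sub>R a, t) - norm (p, 0::real)\<bar> \<le> norm (t *\<^sub>R a, t)"
    using norm_triangle_ineq3[of "(p + t *\<^sub>R a, t)" "(p, 0)"] by simp
  moreover have "norm (p, 0::real) = norm p" by (simp add: norm_Pair)
  ultimately show ?thesis using b by (simp add: reg_norm_def)
qed

lemma reg_drift_eq: "reg_drift t a p = inverse (norm (p + t *\<^sub>R a, t)) *\<^sub>R (p + t *\<^sub>R a)"
  by (simp add: reg_drift_def sgn_div_norm)

lemma norm_reg_drift_le: "norm (reg_drift t a p) \<le> 1"
proof -
  have "norm (fst z) \<le> norm z" for z :: "'a \<times> real"
    using norm_fst_le[of "fst z" "snd z"] by simp
  then have "norm (reg_drift t a p) \<le> norm (sgn (p + t *\<^sub>R a, t))" unfolding reg_drift_def .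
  also have "\<dots> \<le> 1" by (simp add: norm_sgn)
  finally show ?thesis .
qed

lemma reg_drift_0:
  assumes "0 < t" shows "reg_drift t a 0 = inverse (norm (a, 1::real)) *\<^sub>R a"
proof -
  have "norm (t *\<^sub>R a, t) = t * norm (a, 1::real)"
    using norm_scaleR[of t "(a, 1::real)"] assms by simp
  then show ?thesis using assms by (simp add: reg_drift_eq)
qed

text \<open>Cauchy-Schwarz for \<open>sgn z\<close> in the product space, with equality at
  \<open>z\<close>. This one inequality yields convexity, the lower bound of the Hamiltonian by its
  tangent at 0, and the bound k(p) \<le> D(p) \<bullet> p.\<close>

lemma reg_norm_tangent:
  "reg_norm t a p + reg_drift t a p \<bullet> (q - p) \<le> reg_norm t a q"
proof -
  define z z' where "z = (p + t *\<^sub>R a, t)" and "z' = (q + t *\<^sub>R a, t)"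
  have "sgn z \<bullet> z' \<le> norm (sgn z) * norm z'" by (rule norm_cauchy_schwarz)
  also have "\<dots> \<le> 1 * norm z'" by (intro mult_right_mono) (simp_all add: norm_sgn)
  finally have 1: "sgn z \<bullet> z' \<le> norm z'" by simp
  have "sgn z \<bullet> z = norm z"
    by (cases "z = 0") (simp_all add: sgn_div_norm dot_square_norm power2_eq_square)
  with 1 have "norm z + sgn z \<bullet> (z' - z) \<le> norm z'" by (simp add: inner_diff_right)
  moreover have "sgn z \<bullet> (z' - z) = reg_drift t a p \<bullet> (q - p)"
    unfolding reg_drift_def z_def[symmetric] by (simp add: z'_def z_def inner_prod_def)
  ultimately show ?thesis by (simp add: reg_norm_def z_def z'_def)
qed

text \<open>A function with a supporting affine function at every point is convex: in the average of
  the tangent inequalities at the convex combination \<open>r\<close> the linear parts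
  cancel.\<close>

lemma convex_reg_norm: "convex_on UNIV (reg_norm t a)"
proof (rule convex_onI)
  fix s :: real and p q :: 'a assume s: "0 < s" "s < 1"
  define r where "r = (1 - s) *\<^sub>R p + s *\<^sub>R q"
  have "(1 - s) * (reg_norm t a r + reg_drift t a r \<bullet> (p - r)) \<le> (1 - s) * reg_norm t a p"
    using s by (intro mult_left_mono reg_norm_tangent) auto
  moreover have "s * (reg_norm t a r + reg_drift t a r \<bullet> (q - r)) \<le> s * reg_norm t a q"
    using s by (intro mult_left_mono reg_norm_tangent) auto
  moreover have "(1 - s) * (reg_drift t a r \<bullet> (p - r)) + s * (reg_drift t a r \<bullet> (q - r)) = 0"
  proof -
    have "(1 - s) *\<^sub>R (p - r) + s *\<^sub>R (q - r) = 0" by (simp add: r_def algebra_simps)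
    then have "reg_drift t a r \<bullet> ((1 - s) *\<^sub>R (p - r) + s *\<^sub>R (q - r)) = 0" by simp
    then show ?thesis by (simp only: inner_add_right inner_scaleR_right)
  qed
  ultimately have "reg_norm t a r \<le> (1 - s) * reg_norm t a p + s * reg_norm t a q"
    by (simp add: algebra_simps)
  then show "reg_norm t a ((1 - s) *\<^sub>R p + s *\<^sub>R q) \<le> (1 - s) * reg_norm t a p + s * reg_norm t a q"
    by (simp only: r_def)
qed simp

lemma GDERIV_reg_norm:
  assumes "0 < t" shows "GDERIV (reg_norm t a) p :> reg_drift t a p"
proof -
  let ?z = "(p + t *\<^sub>R a, t)"
  have "?z \<noteq> 0" using assms by (simp add: zero_prod_def)
  then have n: "(norm has_derivative (\<lambda>h. h \<bullet> sgn ?z)) (at ?z)"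
    by (rule has_derivative_norm)
  have "((\<lambda>p. (p + t *\<^sub>R a, t)) has_derivative (\<lambda>h. (h, 0))) (at p)"
    by (auto intro!: derivative_eq_intros)
  from has_derivative_compose[OF this, of norm, OF n]
  have "((\<lambda>p. norm (p + t *\<^sub>R a, t)) has_derivative (\<lambda>h. h \<bullet> reg_drift t a p)) (at p)"
    by (simp add: reg_drift_def inner_prod_def)
  then have "((\<lambda>p. norm (p + t *\<^sub>R a, t) - norm (t *\<^sub>R a, t)) has_derivative (\<lambda>h. h \<bullet> reg_drift t a p - 0)) (at p)"
    by (intro has_derivative_diff has_derivative_const)
  then show ?thesis by (simp add: gderiv_def reg_norm_def[abs_def])
qed

lemma grad_p_eqI:
  assumes "GDERIV (H x) p :> D" shows "grad_p H x p = D"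
  unfolding grad_p_def
proof (rule the_equality)
  show "GDERIV (H x) p :> D" by (rule assms)
  fix E assume "GDERIV (H x) p :> E"
  with assms have "(\<lambda>h. h \<bullet> E) = (\<lambda>h. h \<bullet> D)"
    unfolding gderiv_def by (rule has_derivative_unique[rotated])
  then show "E = D" by (metis vector_eq_ldot)
qed

lemma continuous_reg_norm: "continuous_on UNIV (reg_norm t a)"
  unfolding reg_norm_def[abs_def] by (intro continuous_intros)

lemma continuous_reg_drift:
  assumes "0 < t" shows "continuous_on UNIV (reg_drift t a)"
  unfolding reg_drift_eq[abs_def] using assms by (intro continuous_intros) (auto simp: zero_prod_def)

lemma admissible_family_reg_norm:
  fixes \<Omega> :: "'a::euclidean_space set"
  assumes lam: "\<And>j. 1 \<le> j \<Longrightarrow> 0 < lam j" and a: "\<And>t. norm (a t) \<le> 1"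
    and H: "\<And>x p. x \<in> closure \<Omega> \<Longrightarrow> H x p = norm p"
  shows "admissible_family \<Omega> H lam (\<lambda>t x. reg_norm t (a t))"
  unfolding admissible_family_def
\<comment> \<open>The modulus 4 t is that of \<open>reg_norm_approx\<close>; the Lipschitz constant
  1 serves the norm and all its regularizations.\<close>
proof (rule exI[of _ "\<lambda>t. 4 * t"], rule exI[of _ 1], intro conjI allI ballI impI)
  show "continuous_on {0..1} (\<lambda>t::real. 4 * t)" by (intro continuous_intros)
  fix x assume x: "x \<in> closure \<Omega>"
  show "1-lipschitz_on UNIV (H x)"
    using x by (intro lipschitz_onI) (auto simp: H dist_norm norm_triangle_ineq3)
next
  fix j :: nat assume "1 \<le> j"
  then have t: "0 < lam j" by (rule lam)
  have c: "continuous_on (closure \<Omega> \<times> UNIV) (\<lambda>z. f (snd z))"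
    if "continuous_on UNIV f" for f :: "'a \<Rightarrow> 'c::topological_space"
    by (rule continuous_on_compose2[OF that]) (auto intro: continuous_intros)
  show "continuous_on (closure \<Omega> \<times> UNIV) (\<lambda>(x, p). reg_norm (lam j) (a (lam j)) p)"
    using c[OF continuous_reg_norm] by (simp add: split_def)
  have g: "grad_p (\<lambda>x. reg_norm (lam j) (a (lam j))) x p = reg_drift (lam j) (a (lam j)) p" for x p
    by (rule grad_p_eqI) (rule GDERIV_reg_norm[OF t])
  show "continuous_on (closure \<Omega> \<times> UNIV) (\<lambda>(x, p). grad_p (\<lambda>x. reg_norm (lam j) (a (lam j))) x p)"
    unfolding g using c[OF continuous_reg_drift[OF t]] by (simp add: split_def)
  fix x assume x: "x \<in> closure \<Omega>"
  show "1-lipschitz_on UNIV (reg_norm (lam j) (a (lam j)))"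
    by (intro lipschitz_onI) (auto simp: dist_norm reg_norm_Lipschitz)
  show "convex_on UNIV (reg_norm (lam j) (a (lam j)))" by (rule convex_reg_norm)
  fix p
  show "\<exists>D. GDERIV (reg_norm (lam j) (a (lam j))) p :> D"
    using GDERIV_reg_norm[OF t] by blast
  show "\<bar>reg_norm (lam j) (a (lam j)) p - H x p\<bar> \<le> 4 * lam j"
    using reg_norm_approx[OF less_imp_le[OF t] a] by (simp add: H[OF x])
qed auto

section \<open>Solutions of the inclusion and of the regularized problems\<close>

context bounded_open
begin

lemma MFG_inclusion_solution_zero:
  assumes H: "\<And>x p. x \<in> \<Omega> \<Longrightarrow> H x p = norm p" and b: "norm b \<le> 1"
    and s: "solves_KFP \<nu> (\<lambda>_. b) m g"
  shows "MFG_inclusion_solution \<nu> \<Omega> H (\<lambda>_. 0) m"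
  unfolding MFG_inclusion_solution_def
proof (intro conjI bexI)
  have m: "H10_grad m g" using s by (simp add: solves_KFP_def)
  show "(\<lambda>_. 0) \<in> H1_0 \<Omega>" "m \<in> H1_0 \<Omega>" using m H10_grad_zero H1_0_iff by blast+
  show "weak_KFP \<nu> \<Omega> (\<lambda>_. b) m"
    using weak_KFP_iff_solves_KFP[OF _ _ m, of "\<lambda>_. b" 1] s b by simp
  have "solves_HJB \<nu> norm (\<lambda>_. 0) (\<lambda>_. 0)"
    by (simp add: solves_HJB_def H10_grad_zero)
  moreover have "norm \<in> borel_measurable (borel :: 'a measure)"
    by (intro borel_measurable_continuous_onI continuous_intros)
  ultimately show "weak_HJB \<nu> \<Omega> H (\<lambda>_. 0)"
    using weak_HJB_iff_solves_HJB[where k = norm, OF _ _ H H10_grad_zero] by simp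
  have "AE x in M. b \<in> subdiff_p H x (wgrad \<Omega> (\<lambda>_. 0) x)"
    using H10_grad_wgrad_AE[OF H10_grad_zero] AE_space
  proof eventually_elim
    case (elim x)
    \<comment> \<open>At p = 0 this inequality is the whole subgradient condition for the norm, and
      \<open>wgrad\<close> of the zero function is 0 almost everywhere.\<close>
    have "b \<bullet> q \<le> norm q" for q
      using norm_cauchy_schwarz[of b q] mult_right_mono[OF b norm_ge_zero[of q]] by simp
    with elim show ?case by (simp add: subdiff_p_def H)
  qed
  then show "(\<lambda>_. b) \<in> DpH \<Omega> H (\<lambda>_. 0)"
    by (auto simp: DpH_def Linf_def)
qed

lemma reg_drift_measurable:
  assumes "0 < t" shows "reg_drift t a \<in> borel_measurable borel" "norm (reg_drift t a p) \<le> 1"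
  by (rule borel_measurable_continuous_onI[OF continuous_reg_drift[OF assms]], rule norm_reg_drift_le)

text \<open>The drift keeps \<open>wgrad\<close> because the regularized problem is stated with it,
  whereas \<open>g\<close> and \<open>h\<close> may be any valid gradients.\<close>

lemma regularized_solution_iff:
  assumes t: "0 < t" and v: "H10_grad v g" and w: "H10_grad w h"
  shows "regularized_solution \<nu> \<Omega> (\<lambda>x. reg_norm t a) v w \<longleftrightarrow>
    solves_HJB \<nu> (reg_norm t a) v g \<and> solves_KFP \<nu> (\<lambda>x. reg_drift t a (wgrad \<Omega> v x)) w h"
proof -
  have vw: "v \<in> H1_0 \<Omega>" "w \<in> H1_0 \<Omega>" using v w H1_0_iff by blast+
  have D: "grad_p (\<lambda>x. reg_norm t a) x p = reg_drift t a p" for x p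
    by (rule grad_p_eqI) (rule GDERIV_reg_norm[OF t])
  have "weak_HJB \<nu> \<Omega> (\<lambda>x. reg_norm t a) v \<longleftrightarrow> solves_HJB \<nu> (reg_norm t a) v g"
    by (rule weak_HJB_iff_solves_HJB[OF borel_measurable_continuous_onI[OF continuous_reg_norm] abs_reg_norm_le refl v])
  moreover have "weak_KFP \<nu> \<Omega> (\<lambda>x. reg_drift t a (wgrad \<Omega> v x)) w \<longleftrightarrow>
      solves_KFP \<nu> (\<lambda>x. reg_drift t a (wgrad \<Omega> v x)) w h"
  proof (rule weak_KFP_iff_solves_KFP[OF _ _ w, where C = 1])
    show "(\<lambda>x. reg_drift t a (wgrad \<Omega> v x)) \<in> borel_measurable M"
      by (rule measurable_compose[OF L2_measurable[OF H10_grad_L2(2)[OF H10_grad_wgrad[OF vw(1)]]]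
            reg_drift_measurable(1)[OF t]])
    show "AE x in M. norm (reg_drift t a (wgrad \<Omega> v x)) \<le> 1"
      by (intro AE_I2 norm_reg_drift_le)
  qed
  ultimately show ?thesis
    by (simp add: regularized_solution_def vw D)
qed

lemma regularized_solution_zero:
  assumes t: "0 < t" and s: "solves_KFP \<nu> (\<lambda>_. reg_drift t a 0) m f"
  shows "regularized_solution \<nu> \<Omega> (\<lambda>x. reg_norm t a) (\<lambda>_. 0) m"
proof -
  have m: "H10_grad m f" using s by (simp add: solves_KFP_def)
  have "solves_HJB \<nu> (reg_norm t a) (\<lambda>_. 0) (\<lambda>_. 0)"
    by (simp add: solves_HJB_def H10_grad_zero reg_norm_0)
  moreover have "solves_KFP \<nu> (\<lambda>x. reg_drift t a (wgrad \<Omega> (\<lambda>_. 0) x)) m f"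
  proof (rule solves_KFP_cong_AE[OF _ _ _ _ _ s])
    have "(\<lambda>_. 0) \<in> H1_0 \<Omega>" using H10_grad_zero H1_0_iff by blast
    then show "(\<lambda>x. reg_drift t a (wgrad \<Omega> (\<lambda>_. 0) x)) \<in> borel_measurable M"
      by (rule measurable_compose[OF L2_measurable[OF H10_grad_L2(2)[OF H10_grad_wgrad]]
            reg_drift_measurable(1)[OF t]])
    show "AE x in M. reg_drift t a 0 = reg_drift t a (wgrad \<Omega> (\<lambda>_. 0) x)"
      using H10_grad_wgrad_AE[OF H10_grad_zero] by eventually_elim simp
  qed (simp_all add: norm_reg_drift_le)
  ultimately show ?thesis
    using regularized_solution_iff[OF t H10_grad_zero m] by simp
qed

lemma regularized_solution_unique:
  assumes \<nu>: "0 < \<nu>" and t: "0 < t" and s: "solves_KFP \<nu> (\<lambda>_. reg_drift t a 0) m f"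
    and vw: "regularized_solution \<nu> \<Omega> (\<lambda>x. reg_norm t a) v w"
  shows "ae_eq \<Omega> v (\<lambda>_. 0)" "ae_eq \<Omega> w m"
proof -
  have v: "H10_grad v (wgrad \<Omega> v)" and w: "H10_grad w (wgrad \<Omega> w)"
    using vw H10_grad_wgrad by (simp_all add: regularized_solution_def)
  \<comment> \<open>One tangent inequality is used twice: based at 0 and read at p for
    \<open>\<beta>\<close>, based at p and read at 0 for \<open>D\<close>.\<close>
  have \<beta>: "reg_drift t a 0 \<bullet> p \<le> reg_norm t a p" for p
    using reg_norm_tangent[of t a 0 p] by (simp add: reg_norm_0)
  have D: "reg_norm t a p \<le> reg_drift t a p \<bullet> p" for p
    using reg_norm_tangent[of t a p 0] by (simp add: reg_norm_0)
  note s2 = regularized_solution_iff[OF t v w, THEN iffD1, OF vw]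
  from MFG_solution_unique[OF \<nu> borel_measurable_continuous_onI[OF continuous_reg_norm] abs_reg_norm_le \<beta>
      reg_drift_measurable(1)[OF t] norm_reg_drift_le D conjunct1[OF s2] conjunct2[OF s2] s]
  show "ae_eq \<Omega> v (\<lambda>_. 0)" "ae_eq \<Omega> w m" by (simp_all add: ae_eq_def)
qed

end

theorem proposition8p2:
  fixes \<nu> :: real and \<Omega> :: "(real ^ 'd) set" and H :: "real ^ 'd \<Rightarrow> real ^ 'd \<Rightarrow> real"
  assumes "\<nu> > 0"
    and "bounded_lipschitz_domain \<Omega>"
    and "\<And>x p. x \<in> closure \<Omega> \<Longrightarrow> H x p = ball_hamiltonian x p"
  shows "\<exists>(lam :: nat \<Rightarrow> real) (Hreg :: real \<Rightarrow> real ^ 'd \<Rightarrow> real ^ 'd \<Rightarrow> real)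
           (m1 :: real ^ 'd \<Rightarrow> real) (m2 :: real ^ 'd \<Rightarrow> real)
           (ureg :: real \<Rightarrow> real ^ 'd \<Rightarrow> real) (mreg :: real \<Rightarrow> real ^ 'd \<Rightarrow> real).
    (\<forall>j\<ge>1. 0 < lam j \<and> lam j \<le> 1) \<and> lam \<longlonglongrightarrow> 0 \<and>
    admissible_family \<Omega> H lam Hreg \<and>
    m1 \<in> H1_0 \<Omega> \<and> m2 \<in> H1_0 \<Omega> \<and> \<not> ae_eq \<Omega> m1 m2 \<and>
    MFG_inclusion_solution \<nu> \<Omega> H (\<lambda>_. 0) m1 \<and>
    MFG_inclusion_solution \<nu> \<Omega> H (\<lambda>_. 0) m2 \<and>
    (\<forall>j\<ge>1. regularized_solution \<nu> \<Omega> (Hreg (lam j)) (ureg (lam j)) (mreg (lam j)) \<and>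
       (\<forall>v w. regularized_solution \<nu> \<Omega> (Hreg (lam j)) v w \<longrightarrow>
          ae_eq \<Omega> v (ureg (lam j)) \<and> ae_eq \<Omega> w (mreg (lam j)))) \<and>
    (\<forall>k\<ge>1. ae_eq \<Omega> (mreg (lam (2 * k + 1))) m1 \<and> ae_eq \<Omega> (mreg (lam (2 * k))) m2)"
proof -
  have O: "open \<Omega>" "bounded \<Omega>" "\<Omega> \<noteq> {}"
    using assms(2) by (simp_all add: bounded_lipschitz_domain_def)
  interpret bounded_open \<Omega> by unfold_locales (fact O)+
  have H: "H x p = norm p" if "x \<in> closure \<Omega>" for x p
    using assms(3)[OF that] by (simp add: ball_hamiltonian_eq_norm)
  have H': "H x p = norm p" if "x \<in> \<Omega>" for x p
    using H that closure_subset by blast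
  obtain i :: "real ^ 'd" where i: "i \<in> Basis" using nonempty_Basis by blast
  \<comment> \<open>The length of the drift that the shift by the unit vector \<open>i\<close>
    produces at p = 0.\<close>
  define c where "c = inverse (norm (i, 1::real))"
  have c: "c \<noteq> 0" by (simp add: c_def zero_prod_def)
  define lam :: "nat \<Rightarrow> real" where "lam j = 1 / real j" for j
  \<comment> \<open>The family is indexed by the parameter value, so the parity of j has to be read
    off from t. This is consistent because \<open>lam\<close> is injective; k = 0 adds only the
    value t = 0, since 1 / 0 = 0.\<close>
  define a :: "real \<Rightarrow> real ^ 'd" where "a t = (if \<exists>k. t = lam (2 * k) then i else 0)" for t
  define b where "b t = (if a t = 0 then 0 else c *\<^sub>R i)" for t
  have lam: "0 < lam j" "lam j \<le> 1" if "1 \<le> j" for j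
    using that by (simp_all add: lam_def)
  have a_norm: "norm (a t) \<le> 1" for t using i by (simp add: a_def)
  have i0: "i \<noteq> 0" using i nonzero_Basis by blast
  have a_even: "a (lam (2 * k)) = i" for k by (auto simp: a_def)
  have a_odd: "a (lam (2 * k + 1)) = 0" for k
  proof -
    have "lam (2 * k + 1) \<noteq> lam (2 * l)" for l
    proof
      assume "lam (2 * k + 1) = lam (2 * l)"
      then have "real (2 * k + 1) = real (2 * l)"
        unfolding lam_def by (metis divide_inverse inverse_inverse_eq mult_1)
      then have "2 * k + 1 = 2 * l" by (simp only: of_nat_eq_iff)
      then show False by presburger
    qed
    then show ?thesis by (simp add: a_def)
  qed
  have drift: "reg_drift t (a t) 0 = b t" if "0 < t" for t
    using reg_drift_0[OF that, of "a t"] i0 by (auto simp: a_def b_def c_def)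
  obtain m1 g1 where m1: "solves_KFP \<nu> (\<lambda>_. 0) m1 g1"
    using KFP_constant_drift_exists[OF assms(1)] by blast
  obtain m2 g2 where m2: "solves_KFP \<nu> (\<lambda>_. c *\<^sub>R i) m2 g2"
    using KFP_constant_drift_exists[OF assms(1)] by blast
  define mreg where "mreg t = (if a t = 0 then m1 else m2)" for t
  have mreg: "\<exists>g. solves_KFP \<nu> (\<lambda>_. reg_drift t (a t) 0) (mreg t) g" if "0 < t" for t
    using m1 m2 drift[OF that] by (auto simp: mreg_def b_def)
  \<comment> \<open>Read off from the bound on \<open>reg_drift\<close> at t = 1, whose value at p =
    0 is this vector.\<close>
  have "norm (c *\<^sub>R i) \<le> 1"
    using norm_reg_drift_le[of 1 i 0] reg_drift_0[of 1 i] by (simp add: c_def)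
  then have inc: "MFG_inclusion_solution \<nu> \<Omega> H (\<lambda>_. 0) m1" "MFG_inclusion_solution \<nu> \<Omega> H (\<lambda>_. 0) m2"
    using MFG_inclusion_solution_zero[OF H' _ m1] MFG_inclusion_solution_zero[OF H' _ m2] by simp_all
  have reg: "regularized_solution \<nu> \<Omega> (\<lambda>x. reg_norm t (a t)) (\<lambda>_. 0) (mreg t)"
    and uni: "regularized_solution \<nu> \<Omega> (\<lambda>x. reg_norm t (a t)) v w \<Longrightarrow>
      ae_eq \<Omega> v (\<lambda>_. 0) \<and> ae_eq \<Omega> w (mreg t)" if t: "0 < t" for t v w
  proof -
    obtain g where g: "solves_KFP \<nu> (\<lambda>_. reg_drift t (a t) 0) (mreg t) g" using mreg[OF t] ..
    show "regularized_solution \<nu> \<Omega> (\<lambda>x. reg_norm t (a t)) (\<lambda>_. 0) (mreg t)"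
      by (rule regularized_solution_zero[OF t g])
    show "ae_eq \<Omega> v (\<lambda>_. 0) \<and> ae_eq \<Omega> w (mreg t)"
      if "regularized_solution \<nu> \<Omega> (\<lambda>x. reg_norm t (a t)) v w"
      using regularized_solution_unique[OF assms(1) t g that] by blast
  qed
  show ?thesis
  proof (rule exI[of _ lam], rule exI[of _ "\<lambda>t x. reg_norm t (a t)"], rule exI[of _ m1],
      rule exI[of _ m2], rule exI[of _ "\<lambda>_ _. 0"], rule exI[of _ mreg], intro conjI allI impI)
    show "lam \<longlonglongrightarrow> 0"
      unfolding lam_def[abs_def] by (rule lim_1_over_n)
    show "admissible_family \<Omega> H lam (\<lambda>t x. reg_norm t (a t))"
      by (rule admissible_family_reg_norm[OF lam(1) a_norm H])
    show "m1 \<in> H1_0 \<Omega>" "m2 \<in> H1_0 \<Omega>"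
      using inc by (simp_all add: MFG_inclusion_solution_def)
    show "\<not> ae_eq \<Omega> m1 m2"
      using KFP_solutions_distinct[OF O(3) i c m1 m2] by (simp add: ae_eq_def)
  next
    fix j :: nat assume "1 \<le> j"
    note t = lam(1)[OF this]
    show "regularized_solution \<nu> \<Omega> (\<lambda>x. reg_norm (lam j) (a (lam j))) (\<lambda>_. 0) (mreg (lam j))"
      by (rule reg[OF t])
    fix v w assume "regularized_solution \<nu> \<Omega> (\<lambda>x. reg_norm (lam j) (a (lam j))) v w"
    from uni[OF t this] show "ae_eq \<Omega> v (\<lambda>_. 0)" "ae_eq \<Omega> w (mreg (lam j))" by blast+
  next
    fix k :: nat
    show "ae_eq \<Omega> (mreg (lam (2 * k + 1))) m1"
      by (simp only: mreg_def a_odd if_True) (simp add: ae_eq_def)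
    show "ae_eq \<Omega> (mreg (lam (2 * k))) m2"
      by (simp only: mreg_def a_even i0 if_False) (simp add: ae_eq_def)
  qed (fact lam inc)+
qed

end
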